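(* Let $\Omega^j$ ($j\ge1$) and $\Omega_\infty$ be domains in $\mathbb{C}^n$ such that $\Omega^j\to\Omega_\infty$ in the local Hausdorff sense. Assume: (a) $K_{\Omega_\infty}(z,z)>0$ for all $z\in\Omega_\infty$ and $b_{\Omega_\infty}$ is positive definite; (b) $\Omega^j$ and $\Omega_\infty$ are Bergman complete; (c) $K_{\Omega^j}(z,z)\to K_{\Omega_\infty}(z,z)$ for every $z\in\Omega_\infty$. Then for every $z^0\in\Omega_\infty$, $d^b_{\Omega^j}(z^0,\cdot)\to d^b_{\Omega_\infty}(z^0,\cdot)$ uniformly on compact subsets of $\Omega_\infty$.
   Context: $\Omega^j\to\Omega_\infty$ in the local Hausdorff sense means: every compact subset of $\Omega_\infty$ is contained in $\Omega^j$ for all large $j$, and every compact set contained in the interior of $\bigcap_{j\ge j_0}\Omega^j$ for some $j_0$ is contained in $\Omega_\infty$. $K_\Omega$ is the Bergman kernel; $b_\Omega(z,\xi)=(\sum_{\mu,\nu}g^\Omega_{\mu\nu}(z)\xi_\mu\bar\xi_\nu)^{1/2}$ with $g^\Omega_{\mu\nu}=\partial^2\log K_\Omega(z,z)/\partial z_\mu\partial\bar z_\nu$ is the Bergman metric, $d^b_\Omega$ the induced distance. Bergman complete: $K_\Omega(z,z)>0$ on $\Omega$, $b_\Omega$ is positive definite, and $(\Omega,d^b_\Omega)$ is a complete metric space. *)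

theory Defs
  imports "HOL-Analysis.Analysis"
begin

definition cdomain :: "(complex ^ 'n::finite) set \<Rightarrow> bool" where
  "cdomain \<Omega> \<longleftrightarrow> open \<Omega> \<and> connected \<Omega> \<and> \<Omega> \<noteq> {}"

definition holo_on :: "(complex ^ 'n::finite) set \<Rightarrow> (complex ^ 'n \<Rightarrow> complex) \<Rightarrow> bool" where
  "holo_on \<Omega> f \<longleftrightarrow> (\<forall>z\<in>\<Omega>. \<exists>D. (f has_derivative D) (at z) \<and> (\<forall>c h. D (c *s h) = c * D h))"

definition bergman_diag :: "(complex ^ 'n::finite) set \<Rightarrow> complex ^ 'n \<Rightarrow> real" where
  "bergman_diag \<Omega> z = Sup {(cmod (f z))\<^sup>2 | f. holo_on \<Omega> f \<and>
       (\<integral>\<^sup>+ w. ennreal (indicator \<Omega> w * (cmod (f w))\<^sup>2) \<partial>lborel) \<le> 1}"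

definition dx :: "'n::finite \<Rightarrow> (complex ^ 'n \<Rightarrow> complex) \<Rightarrow> complex ^ 'n \<Rightarrow> complex" where
  "dx \<mu> F z = vector_derivative (\<lambda>t::real. F (z + complex_of_real t *s axis \<mu> 1)) (at 0)"

definition dy :: "'n::finite \<Rightarrow> (complex ^ 'n \<Rightarrow> complex) \<Rightarrow> complex ^ 'n \<Rightarrow> complex" where
  "dy \<mu> F z = vector_derivative (\<lambda>t::real. F (z + (\<i> * complex_of_real t) *s axis \<mu> 1)) (at 0)"

definition dz :: "'n::finite \<Rightarrow> (complex ^ 'n \<Rightarrow> complex) \<Rightarrow> complex ^ 'n \<Rightarrow> complex" where
  "dz \<mu> F z = (dx \<mu> F z - \<i> * dy \<mu> F z) / 2"

definition dzbar :: "'n::finite \<Rightarrow> (complex ^ 'n \<Rightarrow> complex) \<Rightarrow> complex ^ 'n \<Rightarrow> complex" where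
  "dzbar \<mu> F z = (dx \<mu> F z + \<i> * dy \<mu> F z) / 2"

definition bergman_g :: "(complex ^ 'n::finite) set \<Rightarrow> 'n \<Rightarrow> 'n \<Rightarrow> complex ^ 'n \<Rightarrow> complex" where
  "bergman_g \<Omega> \<mu> \<nu> z = dz \<mu> (dzbar \<nu> (\<lambda>w. complex_of_real (ln (bergman_diag \<Omega> w)))) z"

definition bergman_form :: "(complex ^ 'n::finite) set \<Rightarrow> complex ^ 'n \<Rightarrow> complex ^ 'n \<Rightarrow> complex" where
  "bergman_form \<Omega> z \<xi> = (\<Sum>\<mu>\<in>UNIV. \<Sum>\<nu>\<in>UNIV. bergman_g \<Omega> \<mu> \<nu> z * \<xi> $ \<mu> * cnj (\<xi> $ \<nu>))"

definition bergman_metric :: "(complex ^ 'n::finite) set \<Rightarrow> complex ^ 'n \<Rightarrow> complex ^ 'n \<Rightarrow> real" where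
  "bergman_metric \<Omega> z \<xi> = sqrt (Re (bergman_form \<Omega> z \<xi>))"

definition bergman_pos_def :: "(complex ^ 'n::finite) set \<Rightarrow> bool" where
  "bergman_pos_def \<Omega> \<longleftrightarrow> (\<forall>z\<in>\<Omega>. \<forall>\<xi>. \<xi> \<noteq> 0 \<longrightarrow>
       Im (bergman_form \<Omega> z \<xi>) = 0 \<and> Re (bergman_form \<Omega> z \<xi>) > 0)"

definition bergman_length :: "(complex ^ 'n::finite) set \<Rightarrow> (real \<Rightarrow> complex ^ 'n) \<Rightarrow> real" where
  "bergman_length \<Omega> \<gamma> = integral {0..1} (\<lambda>t. bergman_metric \<Omega> (\<gamma> t) (vector_derivative \<gamma> (at t)))"

definition bergman_dist :: "(complex ^ 'n::finite) set \<Rightarrow> complex ^ 'n \<Rightarrow> complex ^ 'n \<Rightarrow> real" where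
  "bergman_dist \<Omega> z w = Inf {bergman_length \<Omega> \<gamma> | \<gamma>. valid_path \<gamma> \<and> path_image \<gamma> \<subseteq> \<Omega> \<and>
       pathstart \<gamma> = z \<and> pathfinish \<gamma> = w \<and>
       (\<lambda>t. bergman_metric \<Omega> (\<gamma> t) (vector_derivative \<gamma> (at t))) integrable_on {0..1}}"

definition bergman_complete :: "(complex ^ 'n::finite) set \<Rightarrow> bool" where
  "bergman_complete \<Omega> \<longleftrightarrow> (\<forall>z\<in>\<Omega>. bergman_diag \<Omega> z > 0) \<and> bergman_pos_def \<Omega> \<and>
     (\<forall>x::nat \<Rightarrow> complex ^ 'n. (\<forall>k. x k \<in> \<Omega>) \<and>
        (\<forall>e>0. \<exists>N. \<forall>m\<ge>N. \<forall>k\<ge>N. bergman_dist \<Omega> (x m) (x k) < e)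
        \<longrightarrow> (\<exists>y\<in>\<Omega>. (\<lambda>k. bergman_dist \<Omega> (x k) y) \<longlonglongrightarrow> 0))"

definition local_hausdorff_conv :: "(nat \<Rightarrow> (complex ^ 'n::finite) set) \<Rightarrow> (complex ^ 'n) set \<Rightarrow> bool" where
  "local_hausdorff_conv \<Omega> OmInf \<longleftrightarrow>
     (\<forall>C. compact C \<and> C \<subseteq> OmInf \<longrightarrow> (\<exists>J. \<forall>j\<ge>J. C \<subseteq> \<Omega> j)) \<and>
     (\<forall>C. compact C \<and> (\<exists>j0. C \<subseteq> interior (\<Inter>j\<in>{j0..}. \<Omega> j)) \<longrightarrow> C \<subseteq> OmInf)"

end

(* Near a point of the diagonal log K(z, z) is the restriction to y = conj z of a function L(x, y), holomorphic
   in 2n variables, and g is a mixed second derivative of L.  The sub-mean-value bound makes these extensions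
   locally bounded uniformly in j, so by the Cauchy estimates the pointwise convergence of K_j(z, z) already
   forces the mixed second derivatives, hence the Bergman metrics, to converge locally uniformly.
   The rest is Finsler geometry.  Upper bounds on the distances come from near-minimal paths, which are compact.
   For lower bounds, completeness of the limit gives relatively compact balls (Hopf-Rinow), so a path that
   leaves a large compact set is already longer than the distance it should undercut. *)

theory Submission
  imports Defs "HOL-Complex_Analysis.Complex_Analysis"
begin

section \<open>Holomorphic functions of several variables\<close>

text \<open>The convergence hypothesis is weak: pointwise, and only at pairs (z, conj z), a set of
  real dimension 2n in a space of real dimension 4n. A difference quotient with a fixed real step
  differs from the derivative by a constant times the step, and the constant depends only on a
  common bound of the functions; so pointwise convergence along a real segment passes to the
  directional derivative. The tangent vectors of that set span C^(2n) over the complex numbers,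
  hence complex linearity supplies every direction; and since the outcome is again convergence at
  such pairs, the argument can be iterated to reach second derivatives. The common bound exists
  because the extremal definition of K(z, z) is first turned into a genuine reproducing kernel,
  which Cauchy-Schwarz controls by its diagonal. In the geometric part the domains
  \<open>\<Omega> j\<close> need not lie in the limit, and the metrics are comparable only on
  compact sets; for lower bounds a path is therefore compared only up to a first exit time.\<close>

abbreviation fderiv :: "('a::real_normed_vector \<Rightarrow> 'b::real_normed_vector) \<Rightarrow> 'a \<Rightarrow> 'a \<Rightarrow> 'b" where
  "fderiv f z \<equiv> frechet_derivative f (at z)"

lemma norm_vector_smult: "norm (c *s (v::complex^'m::finite)) = cmod c * norm v"
  by (simp add: norm_vec_def norm_mult L2_set_right_distrib)

lemma of_real_vector_smult: "complex_of_real t *s (v::complex^'m::finite) = t *\<^sub>R v"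
  by (simp add: vec_eq_iff) (simp add: scaleR_conv_of_real)

lemma bounded_linear_smult_left: "bounded_linear (\<lambda>t. t *s (v::complex^'m::finite))"
proof -
  have "linear (\<lambda>t. t *s v)"
    by (rule linearI) (auto simp: vec_eq_iff algebra_simps)
  then show ?thesis by (rule linear_conv_bounded_linear[THEN iffD1])
qed

section \<open>Complex differentiability and one-variable estimates on complex lines\<close>

lemma holo_on_has_derivative:
  assumes "holo_on S f" "z \<in> S"
  shows "(f has_derivative fderiv f z) (at z)"
  using assms unfolding holo_on_def by (metis frechet_derivative_at)

lemma holo_on_fderiv_smult:
  assumes "holo_on S f" "z \<in> S"
  shows "fderiv f z (c *s h) = c * fderiv f z h"
  using assms unfolding holo_on_def by (metis frechet_derivative_at)

lemma holo_on_linear_fderiv: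
  assumes "holo_on S f" "z \<in> S"
  shows "linear (fderiv f z)"
  using holo_on_has_derivative[OF assms] has_derivative_linear by blast

lemma holo_on_continuous_on: "holo_on S f \<Longrightarrow> continuous_on S f"
  by (meson continuous_at_imp_continuous_on has_derivative_continuous holo_on_has_derivative)

lemma holo_on_subset: "holo_on S f \<Longrightarrow> T \<subseteq> S \<Longrightarrow> holo_on T f"
  unfolding holo_on_def by blast

lemma holo_onI:
  assumes "\<And>z. z \<in> S \<Longrightarrow> \<exists>D. (f has_derivative D) (at z) \<and> (\<forall>c h. D (c *s h) = c * D h)"
  shows "holo_on S f"
  using assms unfolding holo_on_def by blast

lemma holo_on_const: "holo_on S (\<lambda>z. c)"
  by (rule holo_onI) (auto intro!: exI[of _ "\<lambda>h. 0"])

lemma holo_on_add: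
  assumes "holo_on S f" "holo_on S g" shows "holo_on S (\<lambda>z. f z + g z)"
proof (rule holo_onI)
  fix z assume z: "z \<in> S"
  show "\<exists>D. ((\<lambda>z. f z + g z) has_derivative D) (at z) \<and> (\<forall>c h. D (c *s h) = c * D h)"
    by (rule exI[of _ "\<lambda>h. fderiv f z h + fderiv g z h"])
      (auto intro!: has_derivative_add holo_on_has_derivative[OF assms(1) z] holo_on_has_derivative[OF assms(2) z]
        simp: holo_on_fderiv_smult[OF assms(1) z] holo_on_fderiv_smult[OF assms(2) z] algebra_simps)
qed

lemma holo_on_compose:
  assumes f: "holo_on S f" and g: "\<And>z. z \<in> S \<Longrightarrow> (g has_field_derivative g' z) (at (f z))"
  shows "holo_on S (\<lambda>z. g (f z))"
proof (rule holo_onI)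
  fix z assume z: "z \<in> S"
  show "\<exists>D. ((\<lambda>z. g (f z)) has_derivative D) (at z) \<and> (\<forall>c h. D (c *s h) = c * D h)"
  proof (intro exI conjI allI)
    show "((\<lambda>z. g (f z)) has_derivative (\<lambda>h. g' z * fderiv f z h)) (at z)"
      using has_derivative_compose[OF holo_on_has_derivative[OF f z] g[OF z, unfolded has_field_derivative_def]] .
  qed (simp add: holo_on_fderiv_smult[OF f z])
qed

lemma holo_on_cmult: "holo_on S f \<Longrightarrow> holo_on S (\<lambda>z. c * f z)"
  by (rule holo_on_compose) (auto intro!: derivative_eq_intros)

lemma holo_on_diff:
  assumes "holo_on S f" "holo_on S g" shows "holo_on S (\<lambda>z. f z - g z)"
  using holo_on_add[OF assms(1) holo_on_cmult[OF assms(2), of "-1"]] by simp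

lemma holo_on_cong:
  assumes "open S" "\<And>z. z \<in> S \<Longrightarrow> f z = g z" "holo_on S f"
  shows "holo_on S g"
  by (metis (no_types, lifting) assms has_derivative_transform_within_open holo_on_def)

lemma fderiv_diff:
  assumes "holo_on S f" "holo_on S g" "z \<in> S"
  shows "fderiv (\<lambda>w. f w - g w) z = (\<lambda>h. fderiv f z h - fderiv g z h)"
  using frechet_derivative_at[OF has_derivative_diff[OF holo_on_has_derivative[OF assms(1,3)] holo_on_has_derivative[OF assms(2,3)]]]
  by simp

text \<open>Reduces several variables to one: the Cauchy and Taylor estimates below are one-variable
  estimates on the complex line through \<open>z\<close> in direction \<open>v\<close>.\<close>

lemma holo_on_line:
  assumes "holo_on S f" "z + t *s v \<in> S"
  shows "((\<lambda>t. f (z + t *s v)) has_field_derivative fderiv f (z + t *s v) v) (at t)"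
proof -
  have "((\<lambda>t. z + t *s v) has_derivative (\<lambda>t. t *s v)) (at t)"
    by (auto intro!: derivative_eq_intros bounded_linear_imp_has_derivative bounded_linear_smult_left)
  from has_derivative_compose[OF this holo_on_has_derivative[OF assms]]
  have "((\<lambda>t. f (z + t *s v)) has_derivative (\<lambda>s. fderiv f (z + t *s v) (s *s v))) (at t)" .
  then show ?thesis
    unfolding has_field_derivative_def holo_on_fderiv_smult[OF assms] mult.commute[of _ "fderiv f (z + t *s v) v"] .
qed

lemma holo_on_cauchy:
  assumes f: "holo_on S f" and sub: "cball z r \<subseteq> S" and r: "r > 0"
    and M: "\<And>w. w \<in> cball z r \<Longrightarrow> cmod (f w) \<le> M"
  shows "cmod (fderiv f z v) \<le> M / r * norm v"
proof (cases "v = 0")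
  case True
  have "z \<in> S" using sub r by auto
  then show ?thesis
    using linear_0[OF holo_on_linear_fderiv[OF f]] True by simp
next
  case False
  \<comment> \<open>The parameter disc of radius \<open>R\<close> is the full preimage of the ball
    under the line, so the one-variable bound \<open>M / R\<close> is already the claimed
    one.\<close>
  define R where "R = r / norm v"
  have R: "R > 0" using r False by (simp add: R_def)
  have inb: "z + t *s v \<in> cball z r" if "t \<in> cball 0 R" for t
    using that False r by (simp add: dist_norm norm_vector_smult R_def field_simps)
  define \<phi> where "\<phi> = (\<lambda>t. f (z + t *s v))"
  have der: "(\<phi> has_field_derivative fderiv f (z + t *s v) v) (at t)" if "t \<in> cball 0 R" for t
    unfolding \<phi>_def using holo_on_line[OF f] inb[OF that] sub by blast
  have "norm ((deriv ^^ 1) \<phi> 0) \<le> fact 1 * M / R ^ 1"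
  proof (rule Cauchy_inequality)
    show "\<phi> holomorphic_on ball 0 R"
      by (metis ball_subset_cball der field_differentiable_def field_differentiable_at_within holomorphic_on_def subsetD)
    show "continuous_on (cball 0 R) \<phi>"
      by (meson DERIV_isCont continuous_at_imp_continuous_on der)
    show "norm (\<phi> x) \<le> M" if "norm (0 - x) = R" for x
      unfolding \<phi>_def using M inb[of x] that by auto
  qed (rule R)
  moreover have "deriv \<phi> 0 = fderiv f z v"
    using DERIV_imp_deriv[OF der[of 0]] R by simp
  ultimately show ?thesis by (simp add: R_def)
qed

text \<open>The second-order remainder on a complex line, taken from parameter 0 to 1. Its constant
  depends only on \<open>M\<close> and \<open>r\<close>, so the estimate is uniform over families of
  functions.\<close>

lemma holo_on_taylor:
  assumes f: "holo_on S f" and sub: "cball z r \<subseteq> S" and r: "r > 0"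
    and M: "\<And>w. w \<in> cball z r \<Longrightarrow> cmod (f w) \<le> M" and h: "norm h \<le> r / 2"
  shows "cmod (f (z + h) - f z - fderiv f z h) \<le> 8 * M / r\<^sup>2 * (norm h)\<^sup>2"
proof (cases "h = 0")
  case True
  have "z \<in> S" using sub r by auto
  then show ?thesis
    using linear_0[OF holo_on_linear_fderiv[OF f]] True by simp
next
  case False
  \<comment> \<open>Half of the largest admissible parameter radius. For \<open>|t| \<le> 1\<close>
    the disc of radius \<open>R\<close> about \<open>t\<close> then fits into the disc of radius
    \<open>2 * R\<close>, because \<open>norm h \<le> r / 2\<close> gives
    \<open>R \<ge> 1\<close>.\<close>
  define R where "R = r / (2 * norm h)"
  have R: "R > 0" "R \<ge> 1" using r False h by (auto simp: R_def field_simps)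
  have inb: "z + t *s h \<in> cball z r" if "t \<in> cball 0 (2*R)" for t
    using that False r by (simp add: dist_norm norm_vector_smult R_def field_simps)
  define \<phi> where "\<phi> = (\<lambda>t. f (z + t *s h))"
  have der: "(\<phi> has_field_derivative fderiv f (z + t *s h) h) (at t)" if "t \<in> cball 0 (2*R)" for t
    unfolding \<phi>_def using holo_on_line[OF f] inb[OF that] sub by blast
  have hol: "\<phi> holomorphic_on ball 0 (2*R)"
    by (metis ball_subset_cball der field_differentiable_def field_differentiable_at_within holomorphic_on_def subsetD)
  have cont: "continuous_on (cball 0 (2*R)) \<phi>"
    by (meson DERIV_isCont continuous_at_imp_continuous_on der)
  have bd: "norm ((deriv ^^ 2) \<phi> t) \<le> fact 2 * M / R ^ 2" if t: "t \<in> cball 0 1" for t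
  proof (rule Cauchy_inequality)
    have sb: "cball t R \<subseteq> cball 0 (2*R)"
    proof
      fix x assume "x \<in> cball t R"
      then have "norm x \<le> norm t + R" using norm_triangle_sub[of x t] by (auto simp: dist_norm norm_minus_commute)
      then show "x \<in> cball 0 (2*R)" using t R by auto
    qed
    have "ball t R \<subseteq> ball 0 (2*R)"
      using interior_mono[OF sb] by simp
    then show "\<phi> holomorphic_on ball t R" using hol holomorphic_on_subset by blast
    show "continuous_on (cball t R) \<phi>" using cont sb continuous_on_subset by blast
    show "norm (\<phi> x) \<le> M" if "norm (t - x) = R" for x
      unfolding \<phi>_def using M inb[of x] that sb by (auto simp: dist_norm)
  qed (use R in auto)
  have "cmod ((deriv ^^ 0) \<phi> 1 - (\<Sum>i\<le>1. (deriv ^^ i) \<phi> 0 * (1 - 0) ^ i / fact i)) \<le> (fact 2 * M / R ^ 2) * cmod (1 - 0) ^ (Suc 1) / fact 1"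
  proof (rule complex_Taylor)
    show "convex (cball 0 1 :: complex set)" by simp
    show "((deriv ^^ i) \<phi> has_field_derivative (deriv ^^ Suc i) \<phi> x) (at x within cball 0 1)"
      if "x \<in> cball 0 1" for i x
    proof -
      have "(deriv ^^ i) \<phi> holomorphic_on ball 0 (2*R)"
        by (rule holomorphic_higher_deriv[OF hol]) simp
      moreover have "x \<in> ball 0 (2*R)" using that R by auto
      ultimately show ?thesis
        using holomorphic_derivI[OF _ open_ball] by (simp add: has_field_derivative_at_within)
    qed
    show "norm ((deriv ^^ Suc 1) \<phi> x) \<le> fact 2 * M / R ^ 2" if "x \<in> cball 0 1" for x
      using bd[OF that] by (simp add: numeral_2_eq_2)
  qed auto
  moreover have "deriv \<phi> 0 = fderiv f z h"
    using DERIV_imp_deriv[OF der[of 0]] R by simp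
  ultimately have "cmod (f (z + h) - f z - fderiv f z h) \<le> 2 * M / R^2"
    by (simp add: \<phi>_def diff_diff_eq)
  also have "2 * M / R^2 = 8 * M / r\<^sup>2 * (norm h)\<^sup>2"
    by (simp add: R_def power_divide power_mult_distrib)
  finally show ?thesis .
qed

text \<open>The 5 is 4 + 1: in the range \<open>norm h \<le> r / 2\<close> the quadratic remainder
  costs at most 4, the linear term 1.\<close>

lemma holo_on_lipschitz:
  assumes f: "holo_on S f" and sub: "cball z r \<subseteq> S" and r: "r > 0"
    and M: "\<And>w. w \<in> cball z r \<Longrightarrow> cmod (f w) \<le> M" and h: "norm h \<le> r / 2"
  shows "cmod (f (z + h) - f z) \<le> 5 * M / r * norm h"
proof -
  have M0: "M \<ge> 0" using M[of z] r norm_ge_zero[of "f z"] by (simp del: norm_ge_zero)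
  have "8 * M / r\<^sup>2 * (norm h)\<^sup>2 = (8 * M / r\<^sup>2 * norm h) * norm h" by (simp add: power2_eq_square)
  also have "\<dots> \<le> (8 * M / r\<^sup>2 * norm h) * (r/2)"
    using h M0 by (intro mult_left_mono) auto
  also have "\<dots> = 4 * M / r * norm h" using r by (simp add: power2_eq_square)
  finally have "8 * M / r\<^sup>2 * (norm h)\<^sup>2 \<le> 4 * M / r * norm h" .
  moreover have "cmod (f (z + h) - f z) \<le> cmod (f (z + h) - f z - fderiv f z h) + cmod (fderiv f z h)"
    by (metis diff_add_cancel norm_triangle_ineq)
  moreover note holo_on_taylor[OF f sub r M h] holo_on_cauchy[OF f sub r M, of h]
  moreover have "5 * M / r * norm h = 4 * M / r * norm h + M / r * norm h" by (simp add: field_simps)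
  ultimately show ?thesis by linarith
qed

text \<open>A rate linear in the step and common to all functions bounded by \<open>M\<close>.
  Holomorphy of derivatives and convergence of derivatives both rest on it.\<close>

lemma holo_on_difference_quotient:
  assumes f: "holo_on S f" and sub: "cball z r \<subseteq> S" and r: "r > 0"
    and M: "\<And>w. w \<in> cball z r \<Longrightarrow> cmod (f w) \<le> M" and t: "t > 0" "norm (t *\<^sub>R v) \<le> r / 2"
  shows "cmod (inverse (of_real t) * (f (z + t *\<^sub>R v) - f z) - fderiv f z v) \<le> 8 * M / r\<^sup>2 * (norm v)\<^sup>2 * t"
proof -
  define C where "C = 8 * M / r\<^sup>2 * (norm v)\<^sup>2"
  define E where "E = f (z + t *\<^sub>R v) - f z - fderiv f z (t *\<^sub>R v)"
  have zS: "z \<in> S" using sub r by auto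
  have "cmod E \<le> 8 * M / r\<^sup>2 * (norm (t *\<^sub>R v))\<^sup>2"
    unfolding E_def by (rule holo_on_taylor[OF f sub r M t(2)])
  also have "\<dots> = (C * t) * t"
    by (simp add: C_def power2_eq_square)
  finally have E: "cmod E \<le> (C * t) * t" .
  have lin: "fderiv f z (t *\<^sub>R v) = of_real t * fderiv f z v"
    using linear_cmul[OF holo_on_linear_fderiv[OF f zS]] by (simp add: scaleR_conv_of_real)
  have "inverse (of_real t) * (f (z + t *\<^sub>R v) - f z) - fderiv f z v = inverse (of_real t) * E"
    using t(1) by (simp add: E_def lin field_simps)
  then have "cmod (inverse (of_real t) * (f (z + t *\<^sub>R v) - f z) - fderiv f z v) = inverse t * cmod E"
    using t(1) by (simp add: norm_mult norm_inverse)
  also have "\<dots> \<le> inverse t * ((C * t) * t)"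
    using E t(1) by (intro mult_left_mono) auto
  also have "\<dots> = C * t" using t(1) by simp
  finally show ?thesis by (simp add: C_def)
qed

section \<open>Limits and derivatives of holomorphic functions\<close>

lemma has_derivative_quadratic:
  assumes D: "bounded_linear D" and d: "d > 0"
    and bd: "\<And>h. norm h < d \<Longrightarrow> norm (f (z + h) - f z - D h) \<le> C * (norm h)\<^sup>2"
  shows "(f has_derivative D) (at z)"
  unfolding has_derivative_at
proof (intro conjI D)
  show "(\<lambda>h. norm (f (z + h) - f z - D h) / norm h) \<midarrow>0\<rightarrow> 0"
  proof (rule Lim_null_comparison)
    show "\<forall>\<^sub>F h in at 0. norm (norm (f (z + h) - f z - D h) / norm h) \<le> C * norm h"
      unfolding eventually_at
    proof (intro exI conjI ballI impI)
      fix h :: 'a assume h: "h \<noteq> 0 \<and> dist h 0 < d"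
      then show "norm (norm (f (z + h) - f z - D h) / norm h) \<le> C * norm h"
        using bd[of h] by (simp add: divide_simps power2_eq_square mult.assoc)
    qed (use d in auto)
    show "(\<lambda>h. C * norm h) \<midarrow>0\<rightarrow> 0"
      by (intro tendsto_eq_intros) auto
  qed
qed

text \<open>Weierstrass's theorem in several variables. The Cauchy estimate for differences
  \<open>f k - f l\<close> makes the derivatives uniformly Cauchy; complex homogeneity survives the
  pointwise limit of the derivatives.\<close>

lemma holo_on_uniform_limit:
  assumes op: "open S" and f: "\<And>k. holo_on S (f k)"
    and lim: "\<And>z. z \<in> S \<Longrightarrow> \<exists>r>0. cball z r \<subseteq> S \<and> uniform_limit (cball z r) f g sequentially"
  shows "holo_on S g"
proof (rule holo_onI)
  fix z assume z: "z \<in> S"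
  then obtain r where r: "r > 0" "cball z r \<subseteq> S" and ul: "uniform_limit (cball z r) f g sequentially"
    using lim by blast
  define B where "B = ball z (r/2)"
  have cb: "cball x (r/2) \<subseteq> cball z r" if "x \<in> B" for x
  proof
    fix y assume "y \<in> cball x (r/2)"
    then show "y \<in> cball z r" using that dist_triangle[of z y x] by (simp add: B_def)
  qed
  have BS: "x \<in> S" if "x \<in> B" for x
    using subsetD[OF cb[OF that], of x] r by auto
  have key: "\<exists>N. \<forall>k\<ge>N. \<forall>l\<ge>N. \<forall>x\<in>B. \<forall>h. cmod (fderiv (f k) x h - fderiv (f l) x h) \<le> e * norm h"
    if e: "e > 0" for e
  proof -
    have "e * r / 4 > 0" using e r by simp
    from ul[unfolded uniform_limit_iff, rule_format, OF this]
    obtain N where N: "\<And>n x. n \<ge> N \<Longrightarrow> x \<in> cball z r \<Longrightarrow> dist (f n x) (g x) < e * r / 4"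
      unfolding eventually_sequentially by blast
    show ?thesis
    proof (intro exI[of _ N] allI impI ballI)
      fix k l x h assume kl: "N \<le> k" "N \<le> l" and x: "x \<in> B"
      have "cmod (fderiv (\<lambda>w. f k w - f l w) x h) \<le> (e * r / 2) / (r/2) * norm h"
      proof (rule holo_on_cauchy)
        show "holo_on S (\<lambda>w. f k w - f l w)" by (intro holo_on_diff f)
        show "cball x (r/2) \<subseteq> S" using cb[OF x] r by blast
        fix w assume "w \<in> cball x (r/2)"
        then have "w \<in> cball z r" using cb[OF x] by blast
        from N[OF kl(1) this] N[OF kl(2) this] show "cmod (f k w - f l w) \<le> e * r / 2"
          using dist_triangle2[of "f k w" "f l w" "g w"] by (simp add: dist_norm)
      qed (use r in auto)
      then show "cmod (fderiv (f k) x h - fderiv (f l) x h) \<le> e * norm h"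
        using r fderiv_diff[OF f f BS[OF x]] by (simp add: fun_eq_iff)
    qed
  qed
  define G where "G = (\<lambda>x h. lim (\<lambda>k. fderiv (f k) x h))"
  have G: "(\<lambda>k. fderiv (f k) x h) \<longlonglongrightarrow> G x h" if x: "x \<in> B" for x h
  proof -
    have "Cauchy (\<lambda>k. fderiv (f k) x h)"
      unfolding Cauchy_def
    proof (intro allI impI)
      fix e :: real assume e: "e > 0"
      have p: "norm h + 1 > 0" by (simp add: add_nonneg_pos)
      with e have "e / (norm h + 1) > 0" by simp
      from key[OF this] obtain N where N: "\<And>k l. k \<ge> N \<Longrightarrow> l \<ge> N \<Longrightarrow> cmod (fderiv (f k) x h - fderiv (f l) x h) \<le> e / (norm h + 1) * norm h"
        using x by blast
      have "e / (norm h + 1) * norm h < e"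
        using e p by (simp add: pos_divide_less_eq)
      then show "\<exists>M. \<forall>m\<ge>M. \<forall>n\<ge>M. dist (fderiv (f m) x h) (fderiv (f n) x h) < e"
        using N unfolding dist_norm by (meson le_less_trans)
    qed
    then show ?thesis
      unfolding G_def using Cauchy_convergent_iff convergent_LIMSEQ_iff by blast
  qed
  have "\<exists>g'. \<forall>x\<in>B. (\<lambda>n. f n x) \<longlonglongrightarrow> g' x \<and> (g' has_derivative G x) (at x within B)"
  proof (rule has_derivative_sequence)
    show "convex B" by (simp add: B_def)
    show "(f n has_derivative fderiv (f n) x) (at x within B)" if "x \<in> B" for n x
      using holo_on_has_derivative[OF f BS[OF that]] has_derivative_at_withinI by blast
    show "\<forall>\<^sub>F n in sequentially. \<forall>x\<in>B. \<forall>h. cmod (fderiv (f n) x h - G x h) \<le> e * norm h" if e: "e > 0" for e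
    proof -
      obtain N where N: "\<And>k l x h. k \<ge> N \<Longrightarrow> l \<ge> N \<Longrightarrow> x \<in> B \<Longrightarrow> cmod (fderiv (f k) x h - fderiv (f l) x h) \<le> e * norm h"
        using key[OF e] by blast
      show ?thesis
        unfolding eventually_sequentially
      proof (intro exI[of _ N] allI impI ballI)
        fix k x h assume k: "N \<le> k" and x: "x \<in> B"
        have "(\<lambda>l. cmod (fderiv (f k) x h - fderiv (f l) x h)) \<longlonglongrightarrow> cmod (fderiv (f k) x h - G x h)"
          by (intro tendsto_intros G x)
        then show "cmod (fderiv (f k) x h - G x h) \<le> e * norm h"
          by (rule LIMSEQ_le_const2) (use N k x in blast)
      qed
    qed
    show "z \<in> B" using r by (simp add: B_def)
    show "(\<lambda>n. f n z) \<longlonglongrightarrow> g z"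
      using tendsto_uniform_limitI[OF ul] r by simp
  qed
  then obtain g' where g': "\<And>x. x \<in> B \<Longrightarrow> (\<lambda>n. f n x) \<longlonglongrightarrow> g' x" "\<And>x. x \<in> B \<Longrightarrow> (g' has_derivative G x) (at x within B)"
    by blast
  have zB: "z \<in> B" and oB: "open B" using r by (auto simp: B_def)
  have "g' x = g x" if "x \<in> B" for x
  proof -
    have "x \<in> cball z r" using subsetD[OF cb[OF that], of x] r by auto
    then show ?thesis using LIMSEQ_unique[OF g'(1)[OF that] tendsto_uniform_limitI[OF ul]] by blast
  qed
  moreover have "(g' has_derivative G z) (at z)"
    using g'(2)[OF zB] at_within_open[OF zB oB] by simp
  ultimately have "(g has_derivative G z) (at z)"
    using has_derivative_transform_within_open oB zB by blast
  moreover have "G z (c *s h) = c * G z h" for c h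
  proof -
    have "(\<lambda>k. fderiv (f k) z (c *s h)) \<longlonglongrightarrow> c * G z h"
      unfolding holo_on_fderiv_smult[OF f z] by (intro tendsto_intros G zB)
    then show ?thesis using G[OF zB] LIMSEQ_unique by blast
  qed
  ultimately show "\<exists>D. (g has_derivative D) (at z) \<and> (\<forall>c h. D (c *s h) = c * D h)" by blast
qed

text \<open>The directional derivative is a locally uniform limit of difference quotients with real
  steps. These are holomorphic, so the preceding limit theorem applies.\<close>

lemma holo_on_fderiv:
  assumes op: "open S" and f: "holo_on S f"
  shows "holo_on S (\<lambda>z. fderiv f z v)"
proof -
  have "\<exists>T. open T \<and> z \<in> T \<and> holo_on T (\<lambda>z. fderiv f z v)" if z: "z \<in> S" for z
  proof -
    obtain r where r: "r > 0" "cball z r \<subseteq> S"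
      using open_contains_cball op z by blast
    obtain M where M: "\<And>w. w \<in> cball z r \<Longrightarrow> cmod (f w) \<le> M"
      using compact_imp_bounded[OF compact_continuous_image[OF continuous_on_subset[OF holo_on_continuous_on[OF f] r(2)] compact_cball]]
      unfolding bounded_iff by blast
    \<comment> \<open>Keeps every shift below \<open>r / 8\<close>, so that the quotient estimate
      applies with radius \<open>r / 2\<close> around each point of \<open>ball z (r/4)\<close>. The
      \<open>1 +\<close> covers \<open>v = 0\<close>.\<close>
    define d where "d = r / (8 * (1 + norm v))"
    have p: "1 + norm v > 0" by (simp add: add_pos_nonneg)
    have d: "d > 0" using r p by (simp add: d_def)
    have dv: "d * norm v \<le> r / 8"
      using r p by (simp add: d_def field_simps)
    define t where "t = (\<lambda>k::nat. d / real (Suc k))"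
    have t: "t k > 0" "t k \<le> d" for k
      using d by (auto simp: t_def field_simps)
    have tv: "norm (t k *\<^sub>R v) \<le> r / 8" for k
      using t[of k] dv mult_right_mono[OF t(2)[of k], of "norm v"] by simp
    have t0: "t \<longlonglongrightarrow> 0"
      unfolding t_def using tendsto_mult[OF tendsto_const[of d] LIMSEQ_inverse_real_of_nat] by (simp add: divide_inverse)
    define B where "B = ball z (r/4)"
    define q where "q = (\<lambda>k w. inverse (complex_of_real (t k)) * (f (w + t k *\<^sub>R v) - f w))"
    have wcb: "cball w (r/2) \<subseteq> cball z r" if "w \<in> B" for w
    proof
      fix x assume "x \<in> cball w (r/2)"
      then show "x \<in> cball z r" using that dist_triangle[of z x w] r by (simp add: B_def)
    qed
    have inS: "w + t k *\<^sub>R v \<in> S" if "w \<in> B" for w k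
      using wcb[OF that] tv[of k] r by (auto simp: dist_norm subset_iff)
    have "holo_on B (\<lambda>z. fderiv f z v)"
    proof (rule holo_on_uniform_limit)
      show "open B" by (simp add: B_def)
      show "holo_on B (q k)" for k
      proof -
        have "holo_on B (\<lambda>w. f (w + t k *\<^sub>R v))"
        proof (rule holo_onI)
          fix w assume w: "w \<in> B"
          have "((\<lambda>w. w + t k *\<^sub>R v) has_derivative (\<lambda>h. h)) (at w)"
            by (auto intro!: derivative_eq_intros)
          from has_derivative_compose[OF this holo_on_has_derivative[OF f inS[OF w]]]
          show "\<exists>D. ((\<lambda>w. f (w + t k *\<^sub>R v)) has_derivative D) (at w) \<and> (\<forall>c h. D (c *s h) = c * D h)"
            using holo_on_fderiv_smult[OF f inS[OF w]] by blast
        qed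
        moreover have "holo_on B f"
          by (rule holo_on_subset[OF f]) (use wcb r in force)
        ultimately show ?thesis
          unfolding q_def by (intro holo_on_cmult holo_on_diff)
      qed
      fix w0 assume "w0 \<in> B"
      then obtain s where s: "s > 0" "cball w0 s \<subseteq> B"
        using open_contains_cball[of B] by (metis B_def open_ball)
      have "uniform_limit B q (\<lambda>z. fderiv f z v) sequentially"
      proof (rule uniform_limitI)
        fix e :: real assume e: "e > 0"
        define C where "C = 8 * M / (r/2)\<^sup>2 * (norm v)\<^sup>2"
        have "(\<lambda>k. C * t k) \<longlonglongrightarrow> 0" using tendsto_mult[OF tendsto_const[of C] t0] by simp
        then have "\<forall>\<^sub>F k in sequentially. C * t k < e" using e by (rule order_tendstoD)
        then show "\<forall>\<^sub>F k in sequentially. \<forall>w\<in>B. dist (q k w) (fderiv f w v) < e"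
        proof (rule eventually_mono, intro ballI)
          fix k w assume k: "C * t k < e" and w: "w \<in> B"
          have wS: "w \<in> S" using wcb[OF w] r by force
          have "cmod (q k w - fderiv f w v) \<le> C * t k"
            unfolding q_def C_def
            using wcb[OF w] r t(1)[of k] tv[of k] M by (intro holo_on_difference_quotient[OF f]) auto
          then show "dist (q k w) (fderiv f w v) < e" using k by (simp add: dist_norm)
        qed
      qed
      then show "\<exists>r>0. cball w0 r \<subseteq> B \<and> uniform_limit (cball w0 r) q (\<lambda>z. fderiv f z v) sequentially"
        using s uniform_limit_on_subset by blast
    qed
    then show ?thesis using r by (intro exI[of _ B]) (auto simp: B_def)
  qed
  then show ?thesis unfolding holo_on_def by blast
qed

text \<open>Both derivatives are compared with difference quotients of the same real step. The error
  does not depend on \<open>j\<close>, and at a fixed step pointwise convergence at two points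
  suffices.\<close>

lemma tendsto_fderiv:
  assumes f: "\<And>j. j \<ge> J \<Longrightarrow> holo_on S (f j)" and g: "holo_on S g" and sub: "cball z r \<subseteq> S" and r: "r > 0"
    and M: "\<And>j w. j \<ge> J \<Longrightarrow> w \<in> cball z r \<Longrightarrow> cmod (f j w) \<le> M" "\<And>w. w \<in> cball z r \<Longrightarrow> cmod (g w) \<le> M"
    and d: "d > 0"
    and lim: "\<And>t. 0 \<le> t \<Longrightarrow> t < d \<Longrightarrow> (\<lambda>j. f j (z + t *\<^sub>R v)) \<longlonglongrightarrow> g (z + t *\<^sub>R v)"
  shows "(\<lambda>j. fderiv (f j) z v) \<longlonglongrightarrow> fderiv g z v"
proof (rule LIMSEQ_I)
  fix e :: real assume e: "e > 0"
  define C where "C = 8 * M / r\<^sup>2 * (norm v)\<^sup>2"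
  have M0: "M \<ge> 0" using M(2)[of z] r norm_ge_zero[of "g z"] by (simp del: norm_ge_zero)
  have C0: "C \<ge> 0" using M0 by (simp add: C_def)
  \<comment> \<open>Three demands: convergence is known at the sample point, the quotient estimate
    applies, and the two quotient errors together cost at most \<open>e / 2\<close>.\<close>
  define t where "t = min (d/2) (min (r / (2 * (1 + norm v))) (e / (4 * (C + 1))))"
  have p: "1 + norm v > 0" by (simp add: add_pos_nonneg)
  have t: "t > 0" "t < d" using d r e C0 p by (auto simp: t_def)
  have "t \<le> r / (2 * (1 + norm v))" by (simp add: t_def)
  then have "t * (1 + norm v) \<le> r / 2" using p by (simp add: field_simps)
  then have tv: "norm (t *\<^sub>R v) \<le> r/2" using t by (simp add: field_simps)
  have "t \<le> e / (4 * (C + 1))" by (simp add: t_def)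
  then have "t * (4 * (C + 1)) \<le> e" using C0 by (simp add: pos_le_divide_eq)
  then have Ct: "4 * (C * t) \<le> e" using t by (simp add: field_simps)
  have zS: "z \<in> S" using sub r by auto
  have approx: "cmod (inverse (of_real t) * (F (z + t *\<^sub>R v) - F z) - fderiv F z v) \<le> C * t"
    if F: "holo_on S F" and FM: "\<And>w. w \<in> cball z r \<Longrightarrow> cmod (F w) \<le> M" for F
  using holo_on_difference_quotient[OF F sub r FM t(1) tv] unfolding C_def .
  have "(\<lambda>j. inverse (of_real t) * (f j (z + t *\<^sub>R v) - f j z)) \<longlonglongrightarrow> inverse (of_real t) * (g (z + t *\<^sub>R v) - g z)"
    using lim[of t] lim[of 0] t d by (intro tendsto_intros) auto
  from LIMSEQ_D[OF this, of "e/2"] e obtain N where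
    N: "\<And>j. j \<ge> N \<Longrightarrow> cmod (inverse (of_real t) * (f j (z + t *\<^sub>R v) - f j z) - inverse (of_real t) * (g (z + t *\<^sub>R v) - g z)) < e/2"
    by auto
  show "\<exists>N. \<forall>j\<ge>N. cmod (fderiv (f j) z v - fderiv g z v) < e"
  proof (intro exI[of _ "max N J"] allI impI)
    fix j assume j: "max N J \<le> j"
    let ?q = "\<lambda>F. inverse (of_real t) * (F (z + t *\<^sub>R v) - F z)"
    have "cmod (fderiv (f j) z v - fderiv g z v) \<le> cmod (?q (f j) - fderiv (f j) z v) + cmod (?q (f j) - ?q g) + cmod (?q g - fderiv g z v)"
      using norm_triangle_ineq4[of "?q (f j) - fderiv g z v" "?q (f j) - fderiv (f j) z v"]
        norm_triangle_ineq[of "?q (f j) - ?q g" "?q g - fderiv g z v"] by simp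
    also have "\<dots> < C * t + e/2 + C * t"
      using approx[OF f M(1), of j] approx[OF g M(2)] N[of j] j by (intro add_less_le_mono add_le_less_mono) auto
    also have "\<dots> \<le> e" using Ct by simp
    finally show "cmod (fderiv (f j) z v - fderiv g z v) < e" .
  qed
qed

text \<open>\<open>holo_on\<close> speaks of vectors \<open>complex^'m\<close> only. With a sum as
  index type a pair of points is such a vector again, so everything above applies in 2n
  variables.\<close>

definition vpair :: "complex^'n::finite \<Rightarrow> complex^'n \<Rightarrow> complex^('n+'n)" where
  "vpair x y = (\<chi> i. case i of Inl a \<Rightarrow> x $ a | Inr b \<Rightarrow> y $ b)"

definition vfst :: "complex^('n+'n) \<Rightarrow> complex^'n::finite" where
  "vfst Z = (\<chi> i. Z $ Inl i)"

definition vsnd :: "complex^('n+'n) \<Rightarrow> complex^'n::finite" where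
  "vsnd Z = (\<chi> i. Z $ Inr i)"

lemma vfst_vpair [simp]: "vfst (vpair x y) = x" and vsnd_vpair [simp]: "vsnd (vpair x y) = y"
  and vpair_vfst_vsnd [simp]: "vpair (vfst Z) (vsnd Z) = Z"
  by (auto simp: vpair_def vfst_def vsnd_def vec_eq_iff split: sum.split)

lemma vfst_add: "vfst (Z + W) = vfst Z + vfst W" and vsnd_add: "vsnd (Z + W) = vsnd Z + vsnd W"
  and vfst_diff: "vfst (Z - W) = vfst Z - vfst W" and vsnd_diff: "vsnd (Z - W) = vsnd Z - vsnd W"
  and vfst_smult: "vfst (c *s Z) = c *s vfst Z" and vsnd_smult: "vsnd (c *s Z) = c *s vsnd Z"
  and vfst_scaleR: "vfst (t *\<^sub>R Z) = t *\<^sub>R vfst Z" and vsnd_scaleR: "vsnd (t *\<^sub>R Z) = t *\<^sub>R vsnd Z"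
  by (simp_all add: vec_eq_iff vfst_def vsnd_def)

lemma norm_vpair: "(norm (Z :: complex^('n::finite+'n)))\<^sup>2 = (norm (vfst Z))\<^sup>2 + (norm (vsnd Z))\<^sup>2"
proof -
  have "(\<Sum>i\<in>(UNIV::('n+'n) set). (cmod (Z $ i))\<^sup>2) = (\<Sum>i\<in>range Inl \<union> range Inr. (cmod (Z $ i))\<^sup>2)"
    by (simp add: UNIV_sum)
  also have "\<dots> = (\<Sum>i\<in>range Inl. (cmod (Z $ i))\<^sup>2) + (\<Sum>i\<in>range Inr. (cmod (Z $ i))\<^sup>2)"
    by (rule sum.union_disjoint) auto
  also have "\<dots> = (\<Sum>i\<in>UNIV. (cmod (Z $ Inl i))\<^sup>2) + (\<Sum>i\<in>UNIV. (cmod (Z $ Inr i))\<^sup>2)"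
    by (simp add: sum.reindex)
  finally show ?thesis
    by (simp add: norm_vec_def L2_set_def vfst_def vsnd_def sum_nonneg)
qed

lemma norm_vfst_le: "norm (vfst Z) \<le> norm Z" and norm_vsnd_le: "norm (vsnd Z) \<le> norm Z"
proof -
  have "(norm (vfst Z))\<^sup>2 \<le> (norm Z)\<^sup>2" "(norm (vsnd Z))\<^sup>2 \<le> (norm Z)\<^sup>2"
    by (simp_all add: norm_vpair)
  then show "norm (vfst Z) \<le> norm Z" "norm (vsnd Z) \<le> norm Z"
    by (simp_all add: power2_le_iff_abs_le)
qed

lemma linear_vfst: "linear vfst" and linear_vsnd: "linear vsnd"
  by (auto intro!: linearI simp: vfst_add vsnd_add vfst_scaleR vsnd_scaleR)

text \<open>Osgood's lemma for bounded functions, through a quadratic remainder: move first in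
  \<open>y\<close>, then in \<open>x\<close>. The delicate term is the change of the
  \<open>x\<close>-derivative under the shift of \<open>y\<close>; Cauchy's estimate for
  \<open>H u (y + k) - H u y\<close>, which is of order \<open>norm k\<close>, controls it.\<close>

lemma holo_on_vpair:
  assumes op: "open U" "open V"
    and H1: "\<And>y. y \<in> V \<Longrightarrow> holo_on U (\<lambda>x. H x y)" and H2: "\<And>x. x \<in> U \<Longrightarrow> holo_on V (\<lambda>y. H x y)"
    and bd: "\<And>x y. x \<in> U \<Longrightarrow> y \<in> V \<Longrightarrow> cmod (H x y) \<le> M"
  shows "holo_on {Z. vfst Z \<in> U \<and> vsnd Z \<in> V} (\<lambda>Z. H (vfst Z) (vsnd Z))"
proof (rule holo_onI)
  fix Z assume "Z \<in> {Z. vfst Z \<in> U \<and> vsnd Z \<in> V}"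
  then obtain x y where Z: "Z = vpair x y" and x: "x \<in> U" and y: "y \<in> V"
    using that[of "vfst Z" "vsnd Z"] by simp
  obtain r1 where r1: "r1 > 0" "cball x r1 \<subseteq> U" using op x open_contains_cball by blast
  obtain r2 where r2: "r2 > 0" "cball y r2 \<subseteq> V" using op y open_contains_cball by blast
  define r where "r = min r1 r2"
  have r: "r > 0" "cball x r \<subseteq> U" "cball y r \<subseteq> V"
    using r1 r2 by (auto simp: r_def subset_iff)
  define D where "D = (\<lambda>W. fderiv (\<lambda>x. H x y) x (vfst W) + fderiv (\<lambda>y. H x y) y (vsnd W))"
  have lin: "linear (fderiv (\<lambda>x. H x y) x)" "linear (fderiv (\<lambda>y. H x y) y)"
    using holo_on_linear_fderiv[OF H1[OF y] x] holo_on_linear_fderiv[OF H2[OF x] y] by auto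
  have "linear D"
    unfolding D_def using linear_compose[OF linear_vfst lin(1)] linear_compose[OF linear_vsnd lin(2)]
    by (intro linear_compose_add) (simp_all add: o_def)
  then have blD: "bounded_linear D" using linear_conv_bounded_linear by blast
  have M0: "M \<ge> 0" using bd[OF x y] norm_ge_zero order_trans by blast
  have est: "cmod (H (x + h) (y + k) - H x y - (fderiv (\<lambda>x. H x y) x h + fderiv (\<lambda>y. H x y) y k))
      \<le> 8 * M / r\<^sup>2 * (norm h)\<^sup>2 + 5 * M / r\<^sup>2 * (norm h * norm k) + 8 * M / r\<^sup>2 * (norm k)\<^sup>2"
    if h: "norm h \<le> r / 2" and k: "norm k \<le> r / 2" for h k
  proof -
    have yk: "y + k \<in> V" using r(3) k r(1) by (auto simp: subset_iff dist_norm)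
    have 1: "cmod (H (x + h) (y + k) - H x (y + k) - fderiv (\<lambda>x. H x (y + k)) x h) \<le> 8 * M / r\<^sup>2 * (norm h)\<^sup>2"
      by (rule holo_on_taylor[OF H1[OF yk] r(2,1) _ h]) (use bd yk r in auto)
    have 3: "cmod (H x (y + k) - H x y - fderiv (\<lambda>y. H x y) y k) \<le> 8 * M / r\<^sup>2 * (norm k)\<^sup>2"
      by (rule holo_on_taylor[OF H2[OF x] r(3,1) _ k]) (use bd x r in auto)
    have "cmod (fderiv (\<lambda>u. H u (y + k) - H u y) x h) \<le> (5 * M / r * norm k) / r * norm h"
    proof (rule holo_on_cauchy[OF holo_on_diff[OF H1[OF yk] H1[OF y]] r(2,1)])
      fix w assume "w \<in> cball x r"
      then have w: "w \<in> U" using r by auto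
      show "cmod (H w (y + k) - H w y) \<le> 5 * M / r * norm k"
        by (rule holo_on_lipschitz[OF H2[OF w] r(3,1) _ k]) (use bd w r in auto)
    qed
    then have 2: "cmod (fderiv (\<lambda>x. H x (y + k)) x h - fderiv (\<lambda>x. H x y) x h) \<le> 5 * M / r\<^sup>2 * (norm h * norm k)"
      unfolding fderiv_diff[OF H1[OF yk] H1[OF y] x] by (simp add: power2_eq_square mult.commute mult.left_commute)
    have "cmod (P - Q - (u + v)) \<le> cmod (P - P' - u') + cmod (u' - u) + cmod (P' - Q - v)" for P Q P' u u' v
      using norm_triangle_ineq[of "P - P' - u' + (u' - u)" "P' - Q - v"] norm_triangle_ineq[of "P - P' - u'" "u' - u"]
      by (simp add: algebra_simps)
    from this[of "H (x + h) (y + k)" "H x y"] 1 2 3 show ?thesis by (meson add_mono order_trans)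
  qed
  have "((\<lambda>Z. H (vfst Z) (vsnd Z)) has_derivative D) (at Z)"
  \<comment> \<open>21 is 8 + 5 + 8, as both components of the increment are at most as long as the
    increment.\<close>
  proof (rule has_derivative_quadratic[OF blD, where d = "r/2" and C = "21 * M / r\<^sup>2"])
    fix W :: "complex^('a+'a)" assume W: "norm W < r / 2"
    define h k where "h = vfst W" and "k = vsnd W"
    have h: "norm h \<le> norm W" and k: "norm k \<le> norm W"
      by (auto simp: h_def k_def norm_vfst_le norm_vsnd_le)
    have hk: "(norm h)\<^sup>2 \<le> (norm W)\<^sup>2" "(norm k)\<^sup>2 \<le> (norm W)\<^sup>2" "norm h * norm k \<le> (norm W)\<^sup>2"
      using h k by (auto intro!: power_mono mult_mono simp: power2_eq_square)
    have c: "0 \<le> M / r\<^sup>2" using M0 by simp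
    have "8 * M / r\<^sup>2 * (norm h)\<^sup>2 + 5 * M / r\<^sup>2 * (norm h * norm k) + 8 * M / r\<^sup>2 * (norm k)\<^sup>2
      = M / r\<^sup>2 * (8 * (norm h)\<^sup>2 + 5 * (norm h * norm k) + 8 * (norm k)\<^sup>2)"
      by (simp add: algebra_simps)
    also have "8 * (norm h)\<^sup>2 + 5 * (norm h * norm k) + 8 * (norm k)\<^sup>2 \<le> 21 * (norm W)\<^sup>2"
      using hk by linarith
    from mult_left_mono[OF this c]
    have "M / r\<^sup>2 * (8 * (norm h)\<^sup>2 + 5 * (norm h * norm k) + 8 * (norm k)\<^sup>2) \<le> M / r\<^sup>2 * (21 * (norm W)\<^sup>2)" .
    finally have "cmod (H (x + h) (y + k) - H x y - (fderiv (\<lambda>x. H x y) x h + fderiv (\<lambda>y. H x y) y k)) \<le> 21 * M / r\<^sup>2 * (norm W)\<^sup>2"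
      using est[of h k] h k W by (simp add: algebra_simps)
    then show "cmod (H (vfst (Z + W)) (vsnd (Z + W)) - H (vfst Z) (vsnd Z) - D W) \<le> 21 * M / r\<^sup>2 * (norm W)\<^sup>2"
      by (simp add: Z vfst_add vsnd_add D_def h_def k_def)
  qed (use r in auto)
  moreover have "D (c *s W) = c * D W" for c W
    by (simp add: D_def vfst_smult vsnd_smult holo_on_fderiv_smult[OF H1[OF y] x] holo_on_fderiv_smult[OF H2[OF x] y] algebra_simps)
  ultimately show "\<exists>D. ((\<lambda>Z. H (vfst Z) (vsnd Z)) has_derivative D) (at Z) \<and> (\<forall>c h. D (c *s h) = c * D h)"
    by blast
qed

section \<open>The Bergman space and its kernel\<close>

text \<open>The constant of the interior L2 estimate below: \<open>|f|\<close> keeps half its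
  central value on a ball whose radius is \<open>1 / (20 * 2 ^ n)\<close> of the distance to the
  sphere. The half costs the 4, the radius enters the volume in real dimension 2n.\<close>

definition bergman_const :: "nat \<Rightarrow> real" where
  "bergman_const n = 4 * (20 * 2 ^ n) ^ (2 * n) / unit_ball_vol (real (2 * n))"

lemma bergman_const_pos: "bergman_const n > 0"
  by (simp add: bergman_const_def)

text \<open>Maximise \<open>|f w| (r - |w - a|)^n\<close>, where \<open>n\<close> is half the real dimension.  On a ball around the
  maximum point whose radius is a fixed multiple of the distance to the sphere, \<open>|f|\<close> stays above half its
  central value, and the exponent \<open>n\<close> makes the volume of that ball cancel the weight.\<close>

lemma holo_on_L2_lower_bound:
  fixes f :: "complex^'n::finite \<Rightarrow> complex"
  assumes f: "holo_on S f" and sub: "cball a r \<subseteq> S" and r: "r > 0"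
  shows "ennreal ((cmod (f a))\<^sup>2 * r ^ (2 * CARD('n)) / bergman_const CARD('n))
    \<le> (\<integral>\<^sup>+ w. ennreal (indicator S w * (cmod (f w))\<^sup>2) \<partial>lborel)"
proof -
  define n where "n = CARD('n)"
  define V where "V = unit_ball_vol (real (2 * n))"
  have V: "V > 0" by (simp add: V_def)
  define p where "p = (\<lambda>w. cmod (f w) * (r - norm (w - a)) ^ n)"
  have "continuous_on (cball a r) p"
    unfolding p_def by (intro continuous_intros continuous_on_subset[OF holo_on_continuous_on[OF f] sub])
  then obtain w0 where w0: "w0 \<in> cball a r" and max: "\<And>w. w \<in> cball a r \<Longrightarrow> p w \<le> p w0"
    using continuous_attains_sup[of "cball a r" p] r by auto
  define d where "d = r - norm (w0 - a)"
  have d0: "0 \<le> d" "d \<le> r" using w0 by (auto simp: d_def dist_norm norm_minus_commute)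
  have pa: "cmod (f a) * r ^ n \<le> cmod (f w0) * d ^ n"
    using max[of a] r by (simp add: p_def d_def)
  have n: "n > 0" by (simp add: n_def)
  show ?thesis
  proof (cases "d = 0 \<or> f w0 = 0")
    case True
    then have "cmod (f a) * r ^ n \<le> 0" using pa n by (auto simp: zero_power)
    then have "f a = 0" using r zero_less_power[OF r, of n] by (simp add: mult_le_0_iff del: zero_less_power)
    then show ?thesis using n by simp
  next
    case False
    then have d: "d > 0" and fw0: "cmod (f w0) > 0" using d0 by auto
    define M where "M = 2 ^ n * cmod (f w0)"
    have cb: "cball w0 (d/2) \<subseteq> cball a r"
    proof
      fix x assume "x \<in> cball w0 (d/2)"
      then show "x \<in> cball a r" using dist_triangle[of a x w0] d by (simp add: d_def dist_norm norm_minus_commute)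
    qed
    have M: "cmod (f w) \<le> M" if w: "w \<in> cball w0 (d/2)" for w
    proof -
      have "norm (w - a) \<le> norm (w0 - a) + d/2"
        using w norm_triangle_ineq[of "w0 - a" "w - w0"] by (simp add: dist_norm norm_minus_commute)
      then have "d/2 \<le> r - norm (w - a)" unfolding d_def by (simp add: field_simps)
      then have "cmod (f w) * (d/2) ^ n \<le> cmod (f w) * (r - norm (w - a)) ^ n"
        using d by (intro mult_left_mono power_mono) auto
      also have "\<dots> \<le> cmod (f w0) * d ^ n"
        using max[of w] cb w by (auto simp: p_def d_def)
      finally show ?thesis using d by (simp add: M_def power_divide field_simps)
    qed
    \<comment> \<open>Maximality bounds \<open>|f|\<close> by \<open>M = 2 ^ n * cmod (f w0)\<close>
      on the ball of radius \<open>d / 2\<close>; over a distance \<open>c * d\<close> the Lipschitz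
      bound \<open>5 * M / (d/2)\<close> then permits a change of exactly
      \<open>cmod (f w0) / 2\<close>.\<close>
    define c where "c = 1 / (20 * 2 ^ n :: real)"
    have c: "c > 0" "c \<le> 1/4"
    proof -
      show "c > 0" by (simp add: c_def)
      have "(1::real) \<le> 2 ^ n" by simp
      then have "4 * 1 \<le> (20 * 2 ^ n :: real)" by linarith
      then show "c \<le> 1/4" unfolding c_def by (simp add: field_simps)
    qed
    have low: "cmod (f w0) / 2 \<le> cmod (f w)" if w: "w \<in> cball w0 (c * d)" for w
    proof -
      have h: "norm (w - w0) \<le> c * d" using w by (simp add: dist_norm norm_minus_commute)
      also have "\<dots> \<le> 1/4 * d" using c d by (intro mult_right_mono) auto
      finally have h4: "norm (w - w0) \<le> (d/2)/2" by simp
      have "cmod (f (w0 + (w - w0)) - f w0) \<le> 5 * M / (d/2) * norm (w - w0)"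
        by (rule holo_on_lipschitz[OF f _ _ M h4]) (use cb sub d in auto)
      also have "\<dots> \<le> 5 * M / (d/2) * (c * d)"
        using h d by (intro mult_left_mono) (auto simp: M_def)
      also have "\<dots> = cmod (f w0) / 2"
        using d by (simp add: M_def c_def)
      finally show ?thesis
        using norm_triangle_ineq2[of "f w0" "f w"] by (simp add: norm_minus_commute)
    qed
    have sub2: "cball w0 (c * d) \<subseteq> S"
    proof -
      have "c * d \<le> d/2" using c d mult_right_mono[OF c(2), of d] by simp
      then show ?thesis using cb sub by (meson order_trans subset_cball)
    qed
    have "(cmod (f a))\<^sup>2 * r ^ (2 * n) = (cmod (f a) * r ^ n)\<^sup>2"
      by (simp add: power_mult_distrib power_mult[symmetric] mult.commute)
    also have "\<dots> \<le> (cmod (f w0) * d ^ n)\<^sup>2"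
      using pa r by (intro power_mono) auto
    also have "\<dots> = (cmod (f w0) / 2)\<^sup>2 * (V * (c * d) ^ (2 * n)) * bergman_const n"
    proof -
      have "bergman_const n = 4 / (V * c ^ (2*n))"
        by (simp add: bergman_const_def c_def V_def power_divide)
      then show ?thesis using V c d
        by (simp add: power_mult_distrib power_mult[symmetric] power_divide mult.commute)
    qed
    finally have "(cmod (f a))\<^sup>2 * r ^ (2 * n) / bergman_const n \<le> (cmod (f w0) / 2)\<^sup>2 * (V * (c * d) ^ (2 * n))"
      using bergman_const_pos[of n] by (simp add: pos_divide_le_eq)
    then have "ennreal ((cmod (f a))\<^sup>2 * r ^ (2 * n) / bergman_const n)
        \<le> ennreal ((cmod (f w0) / 2)\<^sup>2) * ennreal (V * (c * d) ^ (2 * n))"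
      by (simp add: ennreal_mult'[symmetric] ennreal_leI)
    also have "ennreal (V * (c * d) ^ (2 * n)) = emeasure lborel (cball w0 (c * d))"
      using emeasure_cball[of "c * d" w0] c d by (simp add: V_def n_def mult.commute)
    also have "ennreal ((cmod (f w0) / 2)\<^sup>2) * emeasure lborel (cball w0 (c * d))
      = (\<integral>\<^sup>+ w. ennreal ((cmod (f w0) / 2)\<^sup>2) * indicator (cball w0 (c * d)) w \<partial>lborel)"
      by (simp add: nn_integral_cmult_indicator)
    also have "\<dots> \<le> (\<integral>\<^sup>+ w. ennreal (indicator S w * (cmod (f w))\<^sup>2) \<partial>lborel)"
    proof (rule nn_integral_mono)
      fix w
      show "ennreal ((cmod (f w0) / 2)\<^sup>2) * indicator (cball w0 (c * d)) w \<le> ennreal (indicator S w * (cmod (f w))\<^sup>2)"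
      proof (cases "w \<in> cball w0 (c * d)")
        case True
        have "(cmod (f w0) / 2)\<^sup>2 \<le> (cmod (f w))\<^sup>2"
          using low[OF True] by (intro power_mono) auto
        then show ?thesis using True sub2 by (auto simp: subset_iff intro!: ennreal_leI)
      qed simp
    qed
    finally show ?thesis by (simp add: n_def)
  qed
qed

text \<open>The Bergman space of \<open>S\<close>. Its members are total functions, but only their
  values on \<open>S\<close> matter.\<close>

definition A2 :: "(complex^'n::finite) set \<Rightarrow> (complex^'n \<Rightarrow> complex) set" where
  "A2 S = {f. holo_on S f \<and> set_integrable lborel S (\<lambda>w. (cmod (f w))\<^sup>2)}"

definition nsq :: "(complex^'n::finite) set \<Rightarrow> (complex^'n \<Rightarrow> complex) \<Rightarrow> real" where
  "nsq S f = (LINT w:S|lborel. (cmod (f w))\<^sup>2)"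

definition ip :: "(complex^'n::finite) set \<Rightarrow> (complex^'n \<Rightarrow> complex) \<Rightarrow> (complex^'n \<Rightarrow> complex) \<Rightarrow> complex" where
  "ip S f g = (LINT w:S|lborel. f w * cnj (g w))"

lemma A2_holo: "f \<in> A2 S \<Longrightarrow> holo_on S f"
  by (simp add: A2_def)

lemma holo_on_measurable:
  assumes "open S" "continuous_on S f"
  shows "set_borel_measurable lborel S (f :: complex^'n::finite \<Rightarrow> complex)"
  unfolding set_borel_measurable_def
  using borel_measurable_continuous_on_indicator[OF borel_open[OF assms(1)] assms(2)] by simp

lemma nn_integral_eq_nsq:
  assumes "f \<in> A2 S"
  shows "(\<integral>\<^sup>+ w. ennreal (indicator S w * (cmod (f w))\<^sup>2) \<partial>lborel) = ennreal (nsq S f)"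
  using assms unfolding A2_def set_integrable_def nsq_def set_lebesgue_integral_def
  by (simp add: nn_integral_eq_integral)

lemma nsq_nonneg: "nsq S f \<ge> 0"
  unfolding nsq_def set_lebesgue_integral_def by (intro integral_nonneg_AE) auto

text \<open>Connects the nonnegative integral in \<open>bergman_diag\<close> with Lebesgue
  integrability. Measurability is automatic, since holomorphic functions are continuous on the open
  set.\<close>

lemma A2_iff_nn_integral:
  assumes S: "open S" and f: "holo_on S f" and c: "c \<ge> 0"
  shows "(\<integral>\<^sup>+ w. ennreal (indicator S w * (cmod (f w))\<^sup>2) \<partial>lborel) \<le> ennreal c \<longleftrightarrow> f \<in> A2 S \<and> nsq S f \<le> c"
proof
  assume le: "(\<integral>\<^sup>+ w. ennreal (indicator S w * (cmod (f w))\<^sup>2) \<partial>lborel) \<le> ennreal c"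
  have "f \<in> A2 S"
    unfolding A2_def set_integrable_def
  proof (intro CollectI conjI f integrableI_bounded)
    have "continuous_on S (\<lambda>w. (cmod (f w))\<^sup>2)"
      by (intro continuous_intros holo_on_continuous_on f)
    then show "(\<lambda>x. indicat_real S x *\<^sub>R (cmod (f x))\<^sup>2) \<in> borel_measurable lborel"
      using borel_measurable_continuous_on_indicator[OF borel_open[OF S]] by (simp del: real_scaleR_def)
    show "(\<integral>\<^sup>+ x. ennreal (norm (indicat_real S x *\<^sub>R (cmod (f x))\<^sup>2)) \<partial>lborel) < \<infinity>"
      using le by (simp add: order_le_less_trans)
  qed
  then show "f \<in> A2 S \<and> nsq S f \<le> c"
    using nn_integral_eq_nsq[of f S] le c by (simp add: ennreal_le_iff)
next
  assume "f \<in> A2 S \<and> nsq S f \<le> c"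
  then show "(\<integral>\<^sup>+ w. ennreal (indicator S w * (cmod (f w))\<^sup>2) \<partial>lborel) \<le> ennreal c"
    using nn_integral_eq_nsq[of f S] by (simp add: ennreal_leI)
qed

lemma A2_pointwise_bound:
  fixes f :: "complex^'n::finite \<Rightarrow> complex"
  assumes f: "f \<in> A2 S" and sub: "cball a r \<subseteq> S" and r: "r > 0"
  shows "(cmod (f a))\<^sup>2 \<le> bergman_const CARD('n) / r ^ (2 * CARD('n)) * nsq S f"
proof -
  have "(cmod (f a))\<^sup>2 * r ^ (2 * CARD('n)) / bergman_const CARD('n) \<le> nsq S f"
    using holo_on_L2_lower_bound[OF A2_holo[OF f] sub r] nn_integral_eq_nsq[OF f] nsq_nonneg[of S f] by simp
  then show ?thesis
    using bergman_const_pos[of "CARD('n)"] r by (simp add: field_simps)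
qed

lemma ip_integrable:
  assumes S: "open S" and f: "f \<in> A2 S" and g: "g \<in> A2 S"
  shows "set_integrable lborel S (\<lambda>w. f w * cnj (g w))"
proof (rule set_integrable_bound)
  show "set_integrable lborel S (\<lambda>w. (cmod (f w))\<^sup>2 + (cmod (g w))\<^sup>2)"
    using f g by (intro set_integral_add) (auto simp: A2_def)
  show "set_borel_measurable lborel S (\<lambda>w. f w * cnj (g w))"
    by (intro holo_on_measurable S continuous_intros holo_on_continuous_on A2_holo f g)
  have "cmod (f w * cnj (g w)) \<le> (cmod (f w))\<^sup>2 + (cmod (g w))\<^sup>2" for w
    using sum_squares_bound[of "cmod (f w)" "cmod (g w)"] mult_nonneg_nonneg[OF norm_ge_zero[of "f w"] norm_ge_zero[of "g w"]]
    unfolding norm_mult complex_mod_cnj mult.assoc by linarith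
  then show "AE x in lborel. x \<in> S \<longrightarrow> norm (f x * cnj (g x)) \<le> norm ((cmod (f x))\<^sup>2 + (cmod (g x))\<^sup>2)"
    by simp
qed

lemma A2_cmult: "f \<in> A2 S \<Longrightarrow> (\<lambda>w. c * f w) \<in> A2 S"
  unfolding A2_def by (auto simp: norm_mult power_mult_distrib intro!: holo_on_cmult)

lemma A2_add:
  assumes S: "open S" and f: "f \<in> A2 S" and g: "g \<in> A2 S"
  shows "(\<lambda>w. f w + g w) \<in> A2 S"
  unfolding A2_def
proof (intro CollectI conjI)
  show h: "holo_on S (\<lambda>w. f w + g w)" by (intro holo_on_add A2_holo f g)
  show "set_integrable lborel S (\<lambda>w. (cmod (f w + g w))\<^sup>2)"
  proof (rule set_integrable_bound)
    show "set_integrable lborel S (\<lambda>w. 2 * (cmod (f w))\<^sup>2 + 2 * (cmod (g w))\<^sup>2)"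
      using f g by (intro set_integral_add) (auto simp: A2_def)
    have "continuous_on S (\<lambda>w. (cmod (f w + g w))\<^sup>2)"
      by (intro continuous_intros holo_on_continuous_on A2_holo f g)
    then show "set_borel_measurable lborel S (\<lambda>w. (cmod (f w + g w))\<^sup>2)"
      unfolding set_borel_measurable_def
      using borel_measurable_continuous_on_indicator[OF borel_open[OF S]] by (simp del: real_scaleR_def)
    have "(cmod (f w + g w))\<^sup>2 \<le> 2 * (cmod (f w))\<^sup>2 + 2 * (cmod (g w))\<^sup>2" for w
    proof -
      have "(cmod (f w + g w))\<^sup>2 \<le> (cmod (f w) + cmod (g w))\<^sup>2"
        by (intro power_mono norm_triangle_ineq) auto
      then show ?thesis using sum_squares_bound[of "cmod (f w)" "cmod (g w)"] by (simp add: power2_sum)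
    qed
    then show "AE x in lborel. x \<in> S \<longrightarrow> norm ((cmod (f x + g x))\<^sup>2) \<le> norm (2 * (cmod (f x))\<^sup>2 + 2 * (cmod (g x))\<^sup>2)"
      by simp
  qed
qed

lemma ip_add_left:
  assumes S: "open S" and f: "f \<in> A2 S" and g: "g \<in> A2 S" and h: "h \<in> A2 S"
  shows "ip S (\<lambda>w. f w + g w) h = ip S f h + ip S g h"
  unfolding ip_def distrib_right
  by (rule set_integral_add) (intro ip_integrable assms)+

lemma ip_cmult_left: "ip S (\<lambda>w. c * f w) g = c * ip S f g"
  unfolding ip_def by (simp add: mult.assoc)

lemma ip_commute: "ip S g f = cnj (ip S f g)"
proof -
  have "cnj (ip S f g) = (LINT w|lborel. cnj (indicator S w *\<^sub>R (f w * cnj (g w))))"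
    unfolding ip_def set_lebesgue_integral_def by (rule Bochner_Integration.integral_cnj[symmetric])
  also have "\<dots> = ip S g f"
    unfolding ip_def set_lebesgue_integral_def by (simp add: mult.commute)
  finally show ?thesis by simp
qed

lemma ip_self: "ip S f f = of_real (nsq S f)"
  unfolding ip_def nsq_def complex_norm_square[symmetric] by (rule set_integral_complex_of_real)

lemma nsq_cmult: "nsq S (\<lambda>w. c * f w) = (cmod c)\<^sup>2 * nsq S f"
  unfolding nsq_def by (simp add: norm_mult power_mult_distrib)

lemma nsq_add:
  assumes S: "open S" and f: "f \<in> A2 S" and g: "g \<in> A2 S"
  shows "nsq S (\<lambda>w. f w + g w) = nsq S f + nsq S g + 2 * Re (ip S g f)"
proof -
  have fg: "(\<lambda>w. f w + g w) \<in> A2 S" by (rule A2_add[OF assms])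
  have "complex_of_real (nsq S (\<lambda>w. f w + g w)) = ip S f (\<lambda>w. f w + g w) + ip S g (\<lambda>w. f w + g w)"
    by (simp add: ip_self[symmetric] ip_add_left[OF S f g fg])
  also have "\<dots> = cnj (ip S f f + ip S g f) + cnj (ip S f g + ip S g g)"
    by (simp add: ip_commute[of S _ "\<lambda>w. f w + g w"] ip_add_left[OF S f g f] ip_add_left[OF S f g g])
  also have "\<dots> = of_real (nsq S f) + of_real (nsq S g) + (ip S g f + cnj (ip S g f))"
    using ip_commute[of S f g] by (simp add: ip_self)
  also have "ip S g f + cnj (ip S g f) = of_real (2 * Re (ip S g f))"
    by (simp add: complex_add_cnj)
  finally have "complex_of_real (nsq S (\<lambda>w. f w + g w)) = complex_of_real (nsq S f + nsq S g + 2 * Re (ip S g f))"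
    by simp
  then show ?thesis
    using of_real_eq_iff by blast
qed

text \<open>Arranged so that a lower bound for the norm of a sum becomes an upper bound for the norm
  of a difference.\<close>

lemma nsq_parallelogram:
  assumes S: "open S" and f: "f \<in> A2 S" and g: "g \<in> A2 S"
  shows "nsq S (\<lambda>w. f w - g w) = 2 * nsq S f + 2 * nsq S g - nsq S (\<lambda>w. f w + g w)"
proof -
  have "nsq S (\<lambda>w. f w + (-1) * g w) = nsq S f + nsq S (\<lambda>w. (-1) * g w) + 2 * Re (ip S (\<lambda>w. (-1) * g w) f)"
    by (rule nsq_add[OF S f A2_cmult[OF g]])
  then show ?thesis
    unfolding nsq_cmult ip_cmult_left using nsq_add[OF assms] by simp
qed

section \<open>The extremal problem on the diagonal and the reproducing kernel\<close>

lemma bergman_diag_alt: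
  assumes "open S"
  shows "bergman_diag S z = Sup {(cmod (f z))\<^sup>2 | f. f \<in> A2 S \<and> nsq S f \<le> 1}"
proof -
  have "holo_on S f \<and> (\<integral>\<^sup>+ w. ennreal (indicator S w * (cmod (f w))\<^sup>2) \<partial>lborel) \<le> 1 \<longleftrightarrow> f \<in> A2 S \<and> nsq S f \<le> 1" for f
    using A2_iff_nn_integral[OF assms, of f 1] A2_holo[of f S] by auto
  then show ?thesis unfolding bergman_diag_def by simp
qed

lemma A2_unit_nonempty: "{(cmod (f z))\<^sup>2 | f. f \<in> A2 S \<and> nsq S f \<le> 1} \<noteq> {}"
proof -
  have "(\<lambda>w. 0) \<in> A2 S" "nsq S (\<lambda>w. 0) \<le> 1"
    by (auto simp: A2_def nsq_def holo_on_const set_integrable_def)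
  then show ?thesis by blast
qed

lemma bergman_diag_upper:
  assumes S: "open S" and z: "z \<in> S" and f: "f \<in> A2 S" "nsq S f \<le> 1"
  shows "(cmod (f z))\<^sup>2 \<le> bergman_diag S z"
  unfolding bergman_diag_alt[OF S]
proof (rule cSup_upper)
  obtain r where r: "r > 0" "cball z r \<subseteq> S" using open_contains_cball S z by blast
  show "bdd_above {(cmod (f z))\<^sup>2 |f. f \<in> A2 S \<and> nsq S f \<le> 1}"
  proof (rule bdd_aboveI)
    fix x assume "x \<in> {(cmod (f z))\<^sup>2 |f. f \<in> A2 S \<and> nsq S f \<le> 1}"
    then obtain g where g: "x = (cmod (g z))\<^sup>2" "g \<in> A2 S" "nsq S g \<le> 1" by blast
    have "(cmod (g z))\<^sup>2 \<le> bergman_const CARD('a) / r ^ (2 * CARD('a)) * nsq S g"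
      by (rule A2_pointwise_bound[OF g(2) r(2,1)])
    also have "\<dots> \<le> bergman_const CARD('a) / r ^ (2 * CARD('a)) * 1"
      using g(3) bergman_const_pos[of "CARD('a)"] r by (intro mult_left_mono) auto
    finally show "x \<le> bergman_const CARD('a) / r ^ (2 * CARD('a))" using g by simp
  qed
qed (use f in blast)

text \<open>The bound sees the ball but not \<open>S\<close>; this is the source of all uniformity
  in \<open>j\<close> later.\<close>

lemma bergman_diag_le:
  fixes S :: "(complex^'n::finite) set"
  assumes S: "open S" and r: "r > 0" "cball z r \<subseteq> S"
  shows "bergman_diag S z \<le> bergman_const CARD('n) / r ^ (2 * CARD('n))"
  unfolding bergman_diag_alt[OF S]
proof (rule cSup_least[OF A2_unit_nonempty])
  fix x assume "x \<in> {(cmod (f z))\<^sup>2 |f. f \<in> A2 S \<and> nsq S f \<le> 1}"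
  then obtain g where g: "x = (cmod (g z))\<^sup>2" "g \<in> A2 S" "nsq S g \<le> 1" by blast
  have "(cmod (g z))\<^sup>2 \<le> bergman_const CARD('n) / r ^ (2 * CARD('n)) * nsq S g"
    by (rule A2_pointwise_bound[OF g(2) r(2,1)])
  also have "\<dots> \<le> bergman_const CARD('n) / r ^ (2 * CARD('n)) * 1"
    using g(3) bergman_const_pos[of "CARD('n)"] r by (intro mult_left_mono) auto
  finally show "x \<le> bergman_const CARD('n) / r ^ (2 * CARD('n))" using g by simp
qed

text \<open>Normalisation of \<open>f\<close>. When the norm is zero, the interior estimate forces
  the value to vanish as well.\<close>

lemma A2_le_bergman_diag:
  assumes S: "open S" and z: "z \<in> S" and f: "f \<in> A2 S"
  shows "(cmod (f z))\<^sup>2 \<le> bergman_diag S z * nsq S f"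
proof (cases "nsq S f = 0")
  case True
  obtain r where r: "r > 0" "cball z r \<subseteq> S" using open_contains_cball S z by blast
  show ?thesis using A2_pointwise_bound[OF f r(2,1)] True by simp
next
  case False
  then have N: "nsq S f > 0" using nsq_nonneg[of S f] by simp
  define c where "c = complex_of_real (1 / sqrt (nsq S f))"
  have c: "(cmod c)\<^sup>2 = 1 / nsq S f" using N by (simp add: c_def norm_divide power_divide)
  have "(cmod (c * f z))\<^sup>2 \<le> bergman_diag S z"
    by (rule bergman_diag_upper[OF S z A2_cmult[OF f]]) (use N in \<open>simp add: nsq_cmult c\<close>)
  then show ?thesis using N by (simp add: norm_mult power_mult_distrib c field_simps)
qed

text \<open>By the parallelogram law a maximising sequence is Cauchy in the \<open>L\<^sup>2\<close> norm, hence converges locally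
  uniformly by the pointwise bound; no completeness of an \<open>L\<^sup>2\<close> space is needed.\<close>

lemma bergman_maximizer:
  fixes S :: "(complex^'n::finite) set"
  assumes S: "open S" and w: "w \<in> S" and pos: "bergman_diag S w > 0"
  obtains f where "f \<in> A2 S" "nsq S f \<le> 1" "f w = of_real (sqrt (bergman_diag S w))"
proof -
  define m where "m = sqrt (bergman_diag S w)"
  have m: "m > 0" "m\<^sup>2 = bergman_diag S w" using pos by (auto simp: m_def)
  \<comment> \<open>The shift by 2 keeps \<open>\<epsilon> k\<close> strictly between 0 and 1 also
    at \<open>k = 0\<close>, so that \<open>m * (1 - \<epsilon> k)\<close> is positive.\<close>
  define \<epsilon> where "\<epsilon> = (\<lambda>k. 1 / real (k + 2))"
  have \<epsilon>: "\<epsilon> k > 0" "\<epsilon> k < 1" for k by (auto simp: \<epsilon>_def)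
  have "\<exists>f a. f \<in> A2 S \<and> nsq S f \<le> 1 \<and> f w = complex_of_real a \<and> m * (1 - \<epsilon> k) < a \<and> a \<le> m" for k
  proof -
    have e: "0 < m * (1 - \<epsilon> k)" "m * (1 - \<epsilon> k) < m" using \<epsilon>[of k] m by auto
    then have "(m * (1 - \<epsilon> k))\<^sup>2 < m\<^sup>2" by (intro power_strict_mono) auto
    then have "(m * (1 - \<epsilon> k))\<^sup>2 < Sup {(cmod (f w))\<^sup>2 | f. f \<in> A2 S \<and> nsq S f \<le> 1}"
      using m bergman_diag_alt[OF S] by simp
    then obtain g where g: "g \<in> A2 S" "nsq S g \<le> 1" "(m * (1 - \<epsilon> k))\<^sup>2 < (cmod (g w))\<^sup>2"
      using less_cSupD[OF A2_unit_nonempty] by blast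
    then have lt: "m * (1 - \<epsilon> k) < cmod (g w)"
      by (meson norm_ge_zero power_less_imp_less_base)
    have "(cmod (g w))\<^sup>2 \<le> m\<^sup>2" using bergman_diag_upper[OF S w g(1,2)] m by simp
    then have le: "cmod (g w) \<le> m" using m(1) by (rule power2_le_imp_le[OF _ less_imp_le])
    have gw: "g w \<noteq> 0" using lt e by auto
    \<comment> \<open>A unimodular factor makes the value at \<open>w\<close> a positive real; the
      values of two members of the sequence then add without cancellation.\<close>
    have "(\<lambda>z. cnj (sgn (g w)) * g z) \<in> A2 S" by (rule A2_cmult[OF g(1)])
    moreover have "nsq S (\<lambda>z. cnj (sgn (g w)) * g z) \<le> 1"
      using g(2) gw by (simp add: nsq_cmult norm_sgn)
    moreover have "cnj (sgn (g w)) * g w = of_real (cmod (g w))"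
      using gw complex_norm_square[of "g w"] by (simp add: sgn_eq field_simps power2_eq_square)
    ultimately show ?thesis using lt le by blast
  qed
  then obtain F a where F: "\<And>k. F k \<in> A2 S" "\<And>k. nsq S (F k) \<le> 1" "\<And>k. F k w = complex_of_real (a k)"
    and a: "\<And>k. m * (1 - \<epsilon> k) < a k" "\<And>k. a k \<le> m" by metis
  have eps0: "\<epsilon> \<longlonglongrightarrow> 0"
    unfolding \<epsilon>_def by real_asymp
  \<comment> \<open>The sum of two members has a value close to \<open>2 * m\<close> at
    \<open>w\<close>, so its squared norm is close to 4; the parallelogram law leaves almost nothing
    for the difference.\<close>
  have diff: "nsq S (\<lambda>z. F k z - F l z) \<le> 4 * (\<epsilon> k + \<epsilon> l)" for k l
  proof -
    have sum: "(\<lambda>z. F k z + F l z) \<in> A2 S" by (rule A2_add[OF S F(1) F(1)])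
    have p: "0 \<le> m * (1 - \<epsilon> k)" "0 \<le> m * (1 - \<epsilon> l)" using m \<epsilon>[of k] \<epsilon>[of l] by simp_all
    have ak: "0 \<le> a k" "0 \<le> a l" using a(1)[of k] a(1)[of l] p by linarith+
    have "(m * (2 - \<epsilon> k - \<epsilon> l))\<^sup>2 \<le> (a k + a l)\<^sup>2"
      using a(1)[of k] a(1)[of l] p by (intro power_mono) (simp_all add: algebra_simps)
    also have "\<dots> = (cmod (F k w + F l w))\<^sup>2"
      using ak by (simp add: F(3) flip: of_real_add)
    also have "\<dots> \<le> m\<^sup>2 * nsq S (\<lambda>z. F k z + F l z)"
      using A2_le_bergman_diag[OF S w sum] m by simp
    finally have "(2 - \<epsilon> k - \<epsilon> l)\<^sup>2 \<le> nsq S (\<lambda>z. F k z + F l z)"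
      using pos by (simp add: power_mult_distrib m(2))
    moreover have "(2 - \<epsilon> k - \<epsilon> l)\<^sup>2 = 4 - 4 * (\<epsilon> k + \<epsilon> l) + (\<epsilon> k + \<epsilon> l)\<^sup>2"
      by (simp add: power2_eq_square algebra_simps)
    ultimately have "4 - 4 * (\<epsilon> k + \<epsilon> l) \<le> nsq S (\<lambda>z. F k z + F l z)"
      using zero_le_power2[of "\<epsilon> k + \<epsilon> l"] by linarith
    then show ?thesis
      using nsq_parallelogram[OF S F(1) F(1), of k l] F(2)[of k] F(2)[of l] by linarith
  qed
  define f where "f = (\<lambda>z. lim (\<lambda>k. F k z))"
  have ul: "\<exists>r>0. cball z r \<subseteq> S \<and> uniform_limit (cball z r) F f sequentially" if z: "z \<in> S" for z
  proof -
    obtain r where r: "r > 0" "cball z r \<subseteq> S" using open_contains_cball S z by blast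
    define B where "B = bergman_const CARD('n) / (r/2) ^ (2 * CARD('n))"
    have B: "B > 0" using r bergman_const_pos by (simp add: B_def)
    have "uniformly_Cauchy_on (cball z (r/2)) F"
    proof (rule uniformly_Cauchy_onI)
      fix e :: real assume e: "e > 0"
      have "\<forall>\<^sub>F k in sequentially. \<epsilon> k < e\<^sup>2 / (8 * B)"
        using e B by (intro order_tendstoD(2)[OF eps0]) simp
      then obtain N where N: "\<And>k. k \<ge> N \<Longrightarrow> \<epsilon> k < e\<^sup>2 / (8 * B)"
        unfolding eventually_sequentially by blast
      show "\<exists>M. \<forall>x\<in>cball z (r/2). \<forall>m\<ge>M. \<forall>n\<ge>M. dist (F m x) (F n x) < e"
      proof (intro exI[of _ N] ballI allI impI)
        fix x k l assume x: "x \<in> cball z (r/2)" and kl: "N \<le> k" "N \<le> l"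
        have "cball x (r/2) \<subseteq> S"
        proof
          fix y assume "y \<in> cball x (r/2)"
          then have "y \<in> cball z r" using x dist_triangle[of z y x] by simp
          then show "y \<in> S" using r by blast
        qed
        moreover have "(\<lambda>z. F k z - F l z) \<in> A2 S"
          using A2_add[OF S F(1) A2_cmult[OF F(1), of "-1"]] by simp
        ultimately have "(cmod (F k x - F l x))\<^sup>2 \<le> B * nsq S (\<lambda>z. F k z - F l z)"
          unfolding B_def using A2_pointwise_bound[of "\<lambda>z. F k z - F l z" S x "r/2"] r by simp
        also have "\<dots> \<le> B * (4 * (\<epsilon> k + \<epsilon> l))"
          using diff B by (intro mult_left_mono) auto
        also have "\<dots> < B * (4 * (e\<^sup>2 / (8 * B) + e\<^sup>2 / (8 * B)))"
          using N[OF kl(1)] N[OF kl(2)] B by (intro mult_strict_left_mono) linarith+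
        also have "\<dots> = e\<^sup>2" using B by simp
        finally have "(cmod (F k x - F l x))\<^sup>2 < e\<^sup>2" .
        then show "dist (F k x) (F l x) < e"
          using e power_less_imp_less_base unfolding dist_norm by fastforce
      qed
    qed
    then have "uniform_limit (cball z (r/2)) F f sequentially"
      unfolding f_def uniformly_convergent_uniform_limit_iff[symmetric] by (rule Cauchy_uniformly_convergent)
    moreover have "cball z (r/2) \<subseteq> S" using r by auto
    ultimately show ?thesis using r by (intro exI[of _ "r/2"]) auto
  qed
  have hf: "holo_on S f"
    by (rule holo_on_uniform_limit[OF S A2_holo[OF F(1)] ul])
  have lim: "(\<lambda>k. F k z) \<longlonglongrightarrow> f z" if z: "z \<in> S" for z
    using ul[OF z] tendsto_uniform_limitI by (metis centre_in_cball less_imp_le)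
  \<comment> \<open>Fatou's lemma carries the norm bound to the pointwise limit.\<close>
  have "(\<integral>\<^sup>+ z. ennreal (indicator S z * (cmod (f z))\<^sup>2) \<partial>lborel)
      = (\<integral>\<^sup>+ z. liminf (\<lambda>k. ennreal (indicator S z * (cmod (F k z))\<^sup>2)) \<partial>lborel)"
  proof (rule nn_integral_cong)
    fix z
    have "(\<lambda>k. ennreal (indicator S z * (cmod (F k z))\<^sup>2)) \<longlonglongrightarrow> ennreal (indicator S z * (cmod (f z))\<^sup>2)"
    proof (cases "z \<in> S")
      case True
      then show ?thesis by (intro tendsto_intros lim)
    qed simp
    from lim_imp_Liminf[OF _ this]
    show "ennreal (indicator S z * (cmod (f z))\<^sup>2) = liminf (\<lambda>k. ennreal (indicator S z * (cmod (F k z))\<^sup>2))"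
      by simp
  qed
  also have "\<dots> \<le> liminf (\<lambda>k. \<integral>\<^sup>+ z. ennreal (indicator S z * (cmod (F k z))\<^sup>2) \<partial>lborel)"
  proof (rule nn_integral_liminf)
    fix k
    have "(\<lambda>z. indicator S z *\<^sub>R (cmod (F k z))\<^sup>2) \<in> borel_measurable lborel"
      using F(1)[of k] borel_measurable_integrable unfolding A2_def set_integrable_def by blast
    then show "(\<lambda>z. ennreal (indicator S z * (cmod (F k z))\<^sup>2)) \<in> borel_measurable lborel"
      by simp
  qed
  also have "\<dots> \<le> ennreal 1"
  proof (rule Liminf_le)
    show "\<forall>\<^sub>F k in sequentially. (\<integral>\<^sup>+ z. ennreal (indicator S z * (cmod (F k z))\<^sup>2) \<partial>lborel) \<le> ennreal 1"
      using A2_iff_nn_integral[OF S A2_holo[OF F(1)], of 1] F(1,2) by (auto intro!: always_eventually)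
  qed simp
  finally have fA: "f \<in> A2 S" "nsq S f \<le> 1"
    using A2_iff_nn_integral[OF S hf, of 1] by auto
  have "a \<longlonglongrightarrow> m"
  proof (rule tendsto_sandwich)
    show "(\<lambda>k. m * (1 - \<epsilon> k)) \<longlonglongrightarrow> m" using tendsto_mult[OF tendsto_const[of m] tendsto_diff[OF tendsto_const[of 1] eps0]] by simp
    show "\<forall>\<^sub>F k in sequentially. m * (1 - \<epsilon> k) \<le> a k" "\<forall>\<^sub>F k in sequentially. a k \<le> m"
      using a by (auto intro!: always_eventually less_imp_le)
  qed (rule tendsto_const)
  then have "(\<lambda>k. F k w) \<longlonglongrightarrow> of_real m"
    unfolding F(3) by (rule tendsto_of_real)
  then have "f w = of_real m" using LIMSEQ_unique[OF lim[OF w]] by blast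
  then show ?thesis using that fA by (simp add: m_def)
qed

text \<open>The maximiser is orthogonal to the functions vanishing at \<open>w\<close>, since adding such a function does not
  change the value at \<open>w\<close> and so cannot decrease the norm.\<close>

lemma bergman_reproducing:
  assumes S: "open S" and w: "w \<in> S" and pos: "bergman_diag S w > 0"
  shows "\<exists>k. k \<in> A2 S \<and> (\<forall>g\<in>A2 S. ip S g k = g w) \<and> k w = of_real (bergman_diag S w)"
proof -
  obtain f where f: "f \<in> A2 S" "nsq S f \<le> 1" "f w = of_real (sqrt (bergman_diag S w))"
    using bergman_maximizer[OF assms] by blast
  define m where "m = sqrt (bergman_diag S w)"
  have m: "m > 0" "m\<^sup>2 = bergman_diag S w" using pos by (auto simp: m_def)
  have fw: "f w = of_real m" using f by (simp add: m_def)
  have one: "1 \<le> nsq S g" if "g \<in> A2 S" "g w = of_real m" for g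
  proof -
    have "m\<^sup>2 * 1 \<le> m\<^sup>2 * nsq S g"
      using A2_le_bergman_diag[OF S w that(1)] that(2) m(2) by simp
    then show ?thesis using m(1) by simp
  qed
  have nf: "nsq S f = 1" using one[OF f(1) fw] f(2) by simp
  have orth: "ip S h f = 0" if h: "h \<in> A2 S" "h w = 0" for h
  proof -
    define I where "I = ip S h f"
    \<comment> \<open>With \<open>c\<close> below, the squared norm changes by
      \<open>t * |I|^2 * (t * nsq S h - 2)\<close>. Since \<open>t * nsq S h < 1\<close>, this is
      negative unless \<open>I = 0\<close>.\<close>
    define t where "t = 1 / (nsq S h + 1)"
    have N: "nsq S h \<ge> 0" by (rule nsq_nonneg)
    have t: "t > 0" "t * nsq S h < 1" using N by (auto simp: t_def field_simps)
    define c where "c = - of_real t * cnj I"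
    have "1 \<le> nsq S (\<lambda>z. f z + c * h z)"
      by (rule one[OF A2_add[OF S f(1) A2_cmult[OF h(1)]]]) (simp add: fw h)
    also have "\<dots> = 1 + (cmod c)\<^sup>2 * nsq S h + 2 * Re (c * I)"
      unfolding nsq_add[OF S f(1) A2_cmult[OF h(1)]] nf nsq_cmult ip_cmult_left I_def by simp
    also have "c * I = of_real (- t * (cmod I)\<^sup>2)"
      unfolding c_def of_real_mult of_real_minus complex_norm_square by (simp add: mult.commute mult.left_commute)
    also have "(cmod c)\<^sup>2 = t\<^sup>2 * (cmod I)\<^sup>2"
      using t by (simp add: c_def norm_mult power_mult_distrib)
    finally have "0 \<le> t * (cmod I)\<^sup>2 * (t * nsq S h - 2)"
      by (simp add: power2_eq_square algebra_simps)
    then have "t * (cmod I)\<^sup>2 \<le> 0"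
      using t by (simp add: zero_le_mult_iff)
    then show ?thesis using t by (simp add: mult_le_0_iff I_def)
  qed
  have rep: "ip S g f = g w / of_real m" if g: "g \<in> A2 S" for g
  proof -
    let ?c = "- g w / of_real m"
    have "ip S (\<lambda>z. g z + ?c * f z) f = 0"
      by (rule orth[OF A2_add[OF S g A2_cmult[OF f(1)]]]) (use m fw in simp)
    then show ?thesis
      unfolding ip_add_left[OF S g A2_cmult[OF f(1)] f(1)] ip_cmult_left ip_self nf by simp
  qed
  show ?thesis
  \<comment> \<open>As \<open>f\<close> has norm 1 and value \<open>m\<close> at \<open>w\<close>,
    pairing with \<open>f\<close> gives \<open>g w / m\<close>; the factor \<open>m\<close> corrects
    this and yields the value \<open>m^2\<close> at \<open>w\<close>.\<close>
  proof (intro exI[of _ "\<lambda>z. of_real m * f z"] conjI ballI)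
    show "(\<lambda>z. of_real m * f z) \<in> A2 S" by (rule A2_cmult[OF f(1)])
    show "ip S g (\<lambda>z. of_real m * f z) = g w" if "g \<in> A2 S" for g
      using rep[OF that] m ip_commute[of S g "\<lambda>z. of_real m * f z"] ip_commute[of S f g]
      by (simp add: ip_cmult_left)
    show "of_real m * f w = of_real (bergman_diag S w)"
      by (simp add: fw m(2)[symmetric] power2_eq_square)
  qed
qed

text \<open>\<open>bergman_kernel S w z\<close> is K(z, w): the first argument is the
  antiholomorphic one.\<close>

definition bergman_kernel :: "(complex^'n::finite) set \<Rightarrow> complex^'n \<Rightarrow> complex^'n \<Rightarrow> complex" where
  "bergman_kernel S w = (SOME k. k \<in> A2 S \<and> (\<forall>g\<in>A2 S. ip S g k = g w) \<and> k w = of_real (bergman_diag S w))"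

context
  fixes S :: "(complex^'n::finite) set"
  assumes S: "open S" and pos: "\<And>z. z \<in> S \<Longrightarrow> bergman_diag S z > 0"
begin

lemma bergman_kernel:
  assumes "w \<in> S"
  shows "bergman_kernel S w \<in> A2 S" "g \<in> A2 S \<Longrightarrow> ip S g (bergman_kernel S w) = g w"
    "bergman_kernel S w w = of_real (bergman_diag S w)"
  using someI_ex[OF bergman_reproducing[OF S assms pos[OF assms]]]
  unfolding bergman_kernel_def by blast+

text \<open>Each of the two kernel functions evaluates the other by the reproducing
  property.\<close>

lemma bergman_kernel_commute:
  assumes "w \<in> S" "z \<in> S"
  shows "bergman_kernel S w z = cnj (bergman_kernel S z w)"
  using bergman_kernel(2)[OF assms(2) bergman_kernel(1)[OF assms(1)]]
    bergman_kernel(2)[OF assms(1) bergman_kernel(1)[OF assms(2)]]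
    ip_commute[of S "bergman_kernel S w" "bergman_kernel S z"]
  by simp

text \<open>Applied to itself, the reproducing property gives K(., w) the squared norm K(w, w); then
  the extremal bound at \<open>z\<close> applies.\<close>

lemma norm_bergman_kernel_le:
  assumes w: "w \<in> S" and z: "z \<in> S"
  shows "(cmod (bergman_kernel S w z))\<^sup>2 \<le> bergman_diag S z * bergman_diag S w"
proof -
  have "complex_of_real (nsq S (bergman_kernel S w)) = of_real (bergman_diag S w)"
    using bergman_kernel(2)[OF w bergman_kernel(1)[OF w]] bergman_kernel(3)[OF w] by (simp add: ip_self)
  then have "nsq S (bergman_kernel S w) = bergman_diag S w" using of_real_eq_iff by blast
  then show ?thesis using A2_le_bergman_diag[OF S z bergman_kernel(1)[OF w]] by simp
qed

end

section \<open>Derivatives of the kernel on the diagonal\<close>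

definition vcnj :: "complex^'n::finite \<Rightarrow> complex^'n" where
  "vcnj z = (\<chi> i. cnj (z $ i))"

text \<open>Parametrises the set y = conj x, on which the polarised kernel K(x, conj y) takes the
  values K(z, z). The map is real linear but not complex linear.\<close>

definition vdiag :: "complex^'n::finite \<Rightarrow> complex^('n+'n)" where
  "vdiag z = vpair z (vcnj z)"

lemma vcnj_vcnj [simp]: "vcnj (vcnj z) = z"
  and vcnj_add: "vcnj (z + w) = vcnj z + vcnj w" and vcnj_diff: "vcnj (z - w) = vcnj z - vcnj w"
  and vcnj_smult: "vcnj (c *s z) = cnj c *s vcnj z" and vcnj_scaleR: "vcnj (t *\<^sub>R z) = t *\<^sub>R vcnj z"
  by (simp_all add: vcnj_def vec_eq_iff)

lemma norm_vcnj [simp]: "norm (vcnj z) = norm z"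
  by (simp add: vcnj_def norm_vec_def)

lemma dist_vcnj [simp]: "dist (vcnj z) (vcnj w) = dist z w"
  by (simp add: dist_norm flip: vcnj_diff)

lemma bounded_linear_vcnj: "bounded_linear vcnj"
  by (rule bounded_linear_intro[of _ 1]) (auto simp: vcnj_add vcnj_scaleR)

lemma vpair_add: "vpair x y + vpair x' y' = vpair (x + x') (y + y')"
  and vpair_smult: "c *s vpair x y = vpair (c *s x) (c *s y)"
  and vpair_scaleR: "t *\<^sub>R vpair x y = vpair (t *\<^sub>R x) (t *\<^sub>R y)"
  and vpair_diff: "vpair x y - vpair x' y' = vpair (x - x') (y - y')"
  by (auto simp: vpair_def vec_eq_iff split: sum.split)

lemma vdiag_add: "vdiag (z + w) = vdiag z + vdiag w"
  and vdiag_scaleR: "vdiag (t *\<^sub>R z) = t *\<^sub>R vdiag z"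
  and vdiag_diff: "vdiag (z - w) = vdiag z - vdiag w"
  by (simp_all add: vdiag_def vcnj_add vcnj_scaleR vcnj_diff vpair_add vpair_scaleR vpair_diff)

lemma norm_vdiag: "norm (vdiag z) = sqrt 2 * norm z"
proof -
  have "(norm (vdiag z))\<^sup>2 = (sqrt 2 * norm z)\<^sup>2"
    by (simp add: norm_vpair vdiag_def power_mult_distrib)
  then show ?thesis by (simp add: power2_eq_iff_nonneg)
qed

lemma norm_vdiag_bounds: "norm z \<le> norm (vdiag z)" "norm (vdiag z) \<le> 2 * norm z"
proof -
  have "1 * norm z \<le> sqrt 2 * norm z" "sqrt 2 * norm z \<le> 2 * norm z"
    by (intro mult_right_mono real_le_lsqrt; simp)+
  then show "norm z \<le> norm (vdiag z)" "norm (vdiag z) \<le> 2 * norm z" by (simp_all add: norm_vdiag)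
qed

lemma bounded_linear_vdiag: "bounded_linear vdiag"
  by (rule bounded_linear_intro[of _ 2]) (auto simp: vdiag_add vdiag_scaleR mult.commute[of _ 2] norm_vdiag_bounds)

text \<open>The range of \<open>vdiag\<close> is totally real of maximal dimension: it spans the whole space over the complex numbers.\<close>

lemma vpair_eq_vdiag:
  "vpair x y = vdiag ((1/2) *s (x + vcnj y)) + \<i> *s vdiag ((-\<i>/2) *s (x - vcnj y))"
  unfolding vdiag_def vpair_smult vpair_add vcnj_smult vcnj_add vcnj_diff vcnj_vcnj
  by (rule arg_cong2[where f = vpair]) (simp_all add: vec_eq_iff field_simps)

text \<open>Schwarz reflection: the two conjugations cancel, so the derivative is complex linear
  again.\<close>

lemma holo_on_cnj:
  assumes f: "holo_on S f"
  shows "holo_on (vcnj -` S) (\<lambda>z. cnj (f (vcnj z)))"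
proof (rule holo_onI)
  fix z assume "z \<in> vcnj -` S"
  then have z: "vcnj z \<in> S" by simp
  have "((\<lambda>z. cnj (f (vcnj z))) has_derivative (\<lambda>h. cnj (fderiv f (vcnj z) (vcnj h)))) (at z)"
    by (intro has_derivative_cnj has_derivative_compose[OF bounded_linear_imp_has_derivative[OF bounded_linear_vcnj] holo_on_has_derivative[OF f z]])
  then show "\<exists>D. ((\<lambda>z. cnj (f (vcnj z))) has_derivative D) (at z) \<and> (\<forall>c h. D (c *s h) = c * D h)"
    by (intro exI[of _ "\<lambda>h. cnj (fderiv f (vcnj z) (vcnj h))"])
      (simp add: vcnj_smult holo_on_fderiv_smult[OF f z])
qed

text \<open>This is K(x, conj y): conjugating the second slot makes the kernel holomorphic in
  both.\<close>

definition bergman_kernel_ext :: "(complex^'n::finite) set \<Rightarrow> complex^('n+'n) \<Rightarrow> complex" where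
  "bergman_kernel_ext S Z = bergman_kernel S (vcnj (vsnd Z)) (vfst Z)"

text \<open>Holomorphic in \<open>x\<close> by construction, in \<open>y\<close> by Hermitian
  symmetry and reflection; boundedness upgrades this to joint holomorphy. The factor 2 in the
  hypothesis gives every point of the \<open>r\<close>-ball its own \<open>r\<close>-ball in
  \<open>S\<close>.\<close>

lemma bergman_kernel_ext:
  fixes S :: "(complex^'n::finite) set"
  assumes S: "open S" and pos: "\<And>z. z \<in> S \<Longrightarrow> bergman_diag S z > 0"
    and r: "r > 0" and sub: "cball z0 (2 * r) \<subseteq> S"
  defines "M \<equiv> bergman_const CARD('n) / r ^ (2 * CARD('n))"
  shows "holo_on (ball (vdiag z0) r) (bergman_kernel_ext S)" "\<And>Z. Z \<in> ball (vdiag z0) r \<Longrightarrow> cmod (bergman_kernel_ext S Z) \<le> M"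
    "\<And>z. z \<in> S \<Longrightarrow> bergman_kernel_ext S (vdiag z) = of_real (bergman_diag S z)"
proof -
  have xS: "x \<in> S" if "x \<in> ball z0 r" for x
    using that sub r by auto
  have K: "bergman_diag S x \<le> M" if x: "x \<in> ball z0 r" for x
    unfolding M_def
  proof (rule bergman_diag_le[OF S r])
    show "cball x r \<subseteq> S"
    proof
      fix y assume "y \<in> cball x r"
      then have "y \<in> cball z0 (2*r)" using x dist_triangle[of z0 y x] by simp
      then show "y \<in> S" using sub by blast
    qed
  qed
  have M: "M > 0" using r bergman_const_pos by (simp add: M_def)
  have kA: "bergman_kernel S w \<in> A2 S" if "w \<in> S" for w
    by (rule bergman_kernel(1)[OF S]) (use pos that in auto)
  have bd: "cmod (bergman_kernel S w x) \<le> M" if "x \<in> ball z0 r" "w \<in> ball z0 r" for w x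
  proof -
    have "(cmod (bergman_kernel S w x))\<^sup>2 \<le> bergman_diag S x * bergman_diag S w"
      by (rule norm_bergman_kernel_le[OF S]) (use pos xS that in auto)
    also have "\<dots> \<le> M * M"
      using K[OF that(1)] K[OF that(2)] pos[OF xS[OF that(2)]] M by (intro mult_mono) auto
    also have "M * M = M\<^sup>2" by (simp add: power2_eq_square)
    finally show ?thesis using less_imp_le[OF M] by (rule power2_le_imp_le)
  qed
  have inb: "vfst Z \<in> ball z0 r" "vsnd Z \<in> vcnj -` ball z0 r" if "Z \<in> ball (vdiag z0) r" for Z
    using that norm_vfst_le[of "vdiag z0 - Z"] norm_vsnd_le[of "vdiag z0 - Z"] dist_vcnj[of z0 "vcnj (vsnd Z)"]
    by (auto simp: vdiag_def dist_norm vfst_diff vsnd_diff)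
  have "holo_on {Z. vfst Z \<in> ball z0 r \<and> vsnd Z \<in> vcnj -` ball z0 r} (\<lambda>Z. bergman_kernel S (vcnj (vsnd Z)) (vfst Z))"
  proof (rule holo_on_vpair[where M = M])
    show "open (vcnj -` ball z0 r)"
      by (intro open_vimage open_ball linear_continuous_on bounded_linear_vcnj)
    show "holo_on (ball z0 r) (\<lambda>x. bergman_kernel S (vcnj y) x)" if "y \<in> vcnj -` ball z0 r" for y
      by (rule holo_on_subset[OF A2_holo[OF kA]]) (use that xS in auto)
    show "holo_on (vcnj -` ball z0 r) (\<lambda>y. bergman_kernel S (vcnj y) x)" if x: "x \<in> ball z0 r" for x
    proof (rule holo_on_cong)
      show "holo_on (vcnj -` ball z0 r) (\<lambda>y. cnj (bergman_kernel S x (vcnj y)))"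
        by (rule holo_on_cnj[OF holo_on_subset[OF A2_holo[OF kA]]]) (use x xS in auto)
      show "cnj (bergman_kernel S x (vcnj y)) = bergman_kernel S (vcnj y) x" if "y \<in> vcnj -` ball z0 r" for y
        using bergman_kernel_commute[OF S, of "vcnj y" x] pos that x xS by auto
    qed (intro open_vimage open_ball linear_continuous_on bounded_linear_vcnj)
  qed (use bd in auto)
  then show "holo_on (ball (vdiag z0) r) (bergman_kernel_ext S)"
    unfolding bergman_kernel_ext_def[abs_def] by (rule holo_on_subset) (use inb in auto)
  show "\<And>Z. Z \<in> ball (vdiag z0) r \<Longrightarrow> cmod (bergman_kernel_ext S Z) \<le> M"
    unfolding bergman_kernel_ext_def using bd inb by auto
  show "\<And>z. z \<in> S \<Longrightarrow> bergman_kernel_ext S (vdiag z) = of_real (bergman_diag S z)"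
    using bergman_kernel(3)[OF S] pos by (simp add: bergman_kernel_ext_def vdiag_def)
qed

text \<open>The radius and the bound are chosen before \<open>S\<close>: they depend on
  \<open>n\<close>, \<open>r\<close> and \<open>m\<close> only, so one choice serves the limit
  domain and all large \<open>j\<close>. The logarithm exists where the extended kernel keeps a
  positive real part.\<close>

lemma bergman_log_potential:
  fixes z0 :: "complex^'n::finite"
  assumes r: "r > 0" and m: "m > 0"
  obtains \<rho> B where "0 < \<rho>" "\<rho> \<le> r"
    "\<And>S. open S \<Longrightarrow> (\<And>z. z \<in> S \<Longrightarrow> bergman_diag S z > 0) \<Longrightarrow> cball z0 (2 * r) \<subseteq> S \<Longrightarrow> m \<le> bergman_diag S z0 \<Longrightarrow>
      \<exists>L. holo_on (ball (vdiag z0) \<rho>) L \<and> (\<forall>Z\<in>ball (vdiag z0) \<rho>. cmod (L Z) \<le> B)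
        \<and> (\<forall>z. vdiag z \<in> ball (vdiag z0) \<rho> \<longrightarrow> L (vdiag z) = of_real (ln (bergman_diag S z)))"
proof -
  define M where "M = bergman_const CARD('n) / r ^ (2 * CARD('n))"
  have M: "M > 0" using r bergman_const_pos by (simp add: M_def)
  \<comment> \<open>\<open>r / 4\<close> is the range of the Lipschitz estimate on the ball of
    radius \<open>r / 2\<close>; over a distance \<open>m * r / (20 * M)\<close> its constant
    \<open>10 * M / r\<close> lets the kernel drop by at most \<open>m / 2\<close>.\<close>
  define \<rho> where "\<rho> = min (r/4) (m * r / (20 * M))"
  define B where "B = \<bar>ln (m/2)\<bar> + \<bar>ln M\<bar> + pi"
  show ?thesis
  proof (rule that[of \<rho> B])
    show "0 < \<rho>" "\<rho> \<le> r" using r m M by (auto simp: \<rho>_def)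
    fix S :: "(complex^'n) set"
    assume S: "open S" and pos: "\<And>z. z \<in> S \<Longrightarrow> bergman_diag S z > 0" and sub: "cball z0 (2 * r) \<subseteq> S"
      and mK: "m \<le> bergman_diag S z0"
    define H where "H = bergman_kernel_ext S"
    have H: "holo_on (ball (vdiag z0) r) H" "\<And>Z. Z \<in> ball (vdiag z0) r \<Longrightarrow> cmod (H Z) \<le> M"
      "\<And>z. z \<in> S \<Longrightarrow> H (vdiag z) = of_real (bergman_diag S z)"
      using bergman_kernel_ext[OF S _ r sub] pos unfolding H_def M_def by blast+
    let ?B = "ball (vdiag z0) \<rho>"
    have sb: "?B \<subseteq> ball (vdiag z0) r" using \<open>\<rho> \<le> r\<close> by auto
    have z0: "z0 \<in> S" using sub r by auto
    have Re: "m / 2 \<le> Re (H Z)" if Z: "Z \<in> ?B" for Z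
    proof -
      have h: "norm (Z - vdiag z0) \<le> (r/2)/2" "norm (Z - vdiag z0) \<le> m * r / (20 * M)"
        using Z by (auto simp: \<rho>_def dist_norm norm_minus_commute)
      have "cmod (H (vdiag z0 + (Z - vdiag z0)) - H (vdiag z0)) \<le> 5 * M / (r/2) * norm (Z - vdiag z0)"
        by (rule holo_on_lipschitz[OF H(1) _ _ _ h(1)]) (use r H(2) in auto)
      also have "\<dots> \<le> 5 * M / (r/2) * (m * r / (20 * M))"
        using h(2) r M by (intro mult_left_mono) auto
      also have "\<dots> = m / 2" using r M by simp
      finally have "cmod (H Z - H (vdiag z0)) \<le> m / 2" by simp
      then have "\<bar>Re (H Z - H (vdiag z0))\<bar> \<le> m / 2"
        using abs_Re_le_cmod[of "H Z - H (vdiag z0)"] by linarith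
      moreover have "Re (H (vdiag z0)) = bergman_diag S z0" using H(3)[OF z0] by simp
      ultimately show ?thesis using mK unfolding minus_complex.sel by linarith
    qed
    show "\<exists>L. holo_on ?B L \<and> (\<forall>Z\<in>?B. cmod (L Z) \<le> B)
        \<and> (\<forall>z. vdiag z \<in> ?B \<longrightarrow> L (vdiag z) = of_real (ln (bergman_diag S z)))"
    proof (intro exI[of _ "\<lambda>Z. Ln (H Z)"] conjI ballI allI impI)
      show "holo_on ?B (\<lambda>Z. Ln (H Z))"
      proof (rule holo_on_compose[OF holo_on_subset[OF H(1) sb]])
        fix Z assume "Z \<in> ?B"
        then have "H Z \<notin> \<real>\<^sub>\<le>\<^sub>0" using Re[of Z] m by (auto simp: complex_nonpos_Reals_iff)
        then show "(Ln has_field_derivative inverse (H Z)) (at (H Z))" by (rule has_field_derivative_Ln)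
      qed
      show "cmod (Ln (H Z)) \<le> B" if Z: "Z \<in> ?B" for Z
      proof -
        have lo: "m / 2 \<le> cmod (H Z)" using Re[OF Z] complex_Re_le_cmod order_trans by blast
        have nz: "H Z \<noteq> 0" using lo m by auto
        have hi: "cmod (H Z) \<le> M" using H(2) Z sb by blast
        have "ln (m/2) \<le> ln (cmod (H Z))" "ln (cmod (H Z)) \<le> ln M"
          using lo hi m M nz by auto
        then have "\<bar>Re (Ln (H Z))\<bar> \<le> \<bar>ln (m/2)\<bar> + \<bar>ln M\<bar>"
          using nz by simp
        moreover have "\<bar>Im (Ln (H Z))\<bar> \<le> pi"
          using mpi_less_Im_Ln[OF nz] Im_Ln_le_pi[OF nz] by auto
        ultimately show ?thesis using cmod_le[of "Ln (H Z)"] by (simp add: B_def)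
      qed
      show "Ln (H (vdiag z)) = of_real (ln (bergman_diag S z))" if z: "vdiag z \<in> ?B" for z
      proof -
        have "dist z0 z \<le> dist (vdiag z0) (vdiag z)"
          using norm_vdiag_bounds(1)[of "z0 - z"] by (simp add: dist_norm vdiag_diff)
        then have "z \<in> cball z0 (2 * r)" using z \<open>\<rho> \<le> r\<close> r by simp
        then have zS: "z \<in> S" using sub by blast
        then show ?thesis using H(3)[OF zS] pos[OF zS] by (simp add: Ln_of_real)
      qed
    qed
  qed
qed

text \<open>Real lines through \<open>w\<close> become real lines through \<open>vdiag w\<close>.
  For a basis vector e, \<open>vdiag\<close> sends e to (e, e) and ie to (ie, -ie), so each
  Wirtinger combination isolates one of the two slots.\<close>

lemma wirtinger_diag:
  assumes B: "open B" and L: "holo_on B L" and w: "vdiag w \<in> B" and F: "\<And>z. vdiag z \<in> B \<Longrightarrow> F z = L (vdiag z)"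
  shows "dz \<mu> F w = fderiv L (vdiag w) (vpair (axis \<mu> 1) 0)"
    and "dzbar \<mu> F w = fderiv L (vdiag w) (vpair 0 (axis \<mu> 1))"
proof -
  have line: "vector_derivative (\<lambda>t. F (w + t *\<^sub>R v)) (at 0) = fderiv L (vdiag w) (vdiag v)" for v
  proof (rule vector_derivative_at)
    have d: "((\<lambda>t. vdiag (w + t *\<^sub>R v)) has_vector_derivative vdiag v) (at 0)"
      unfolding vdiag_add vdiag_scaleR by (auto intro!: derivative_eq_intros)
    have L': "(L has_derivative fderiv L (vdiag w)) (at (vdiag (w + 0 *\<^sub>R v)))"
      using holo_on_has_derivative[OF L w] by simp
    have LF: "((\<lambda>t. L (vdiag (w + t *\<^sub>R v))) has_vector_derivative fderiv L (vdiag w) (vdiag v)) (at 0)"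
      using has_derivative_compose[OF d[unfolded has_vector_derivative_def] L']
      unfolding has_vector_derivative_def linear_cmul[OF holo_on_linear_fderiv[OF L w]] .
    have "open ((\<lambda>t. vdiag (w + t *\<^sub>R v)) -` B)"
      by (intro open_vimage B continuous_intros linear_continuous_on_compose[of _ _ vdiag] bounded_linear.linear bounded_linear_vdiag)
    then show "((\<lambda>t. F (w + t *\<^sub>R v)) has_vector_derivative fderiv L (vdiag w) (vdiag v)) (at 0)"
      by (rule has_vector_derivative_transform_within_open[OF LF]) (use w F in auto)
  qed
  have dx: "dx \<mu> F w = fderiv L (vdiag w) (vdiag (axis \<mu> 1))"
    unfolding dx_def of_real_vector_smult by (rule line)
  have "(\<i> * complex_of_real t) *s axis \<mu> 1 = t *\<^sub>R (\<i> *s (axis \<mu> 1 :: complex^'a))" for t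
    by (simp add: vec_eq_iff) (simp add: scaleR_conv_of_real)
  then have dy: "dy \<mu> F w = fderiv L (vdiag w) (vdiag (\<i> *s axis \<mu> 1))"
    unfolding dy_def using line by simp
  note lin = holo_on_linear_fderiv[OF L w] and smult = holo_on_fderiv_smult[OF L w, symmetric]
  have "dz \<mu> F w = (1/2) * (fderiv L (vdiag w) (vdiag (axis \<mu> 1)) + (-\<i>) * fderiv L (vdiag w) (vdiag (\<i> *s axis \<mu> 1)))"
    unfolding dz_def dx dy by simp
  also have "\<dots> = fderiv L (vdiag w) ((1/2) *s (vdiag (axis \<mu> 1) + (-\<i>) *s vdiag (\<i> *s axis \<mu> 1)))"
    unfolding smult linear_add[OF lin, symmetric] by simp
  also have "(1/2) *s (vdiag (axis \<mu> 1) + (-\<i>) *s vdiag (\<i> *s axis \<mu> 1)) = vpair (axis \<mu> 1) 0"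
    unfolding vdiag_def vpair_smult vpair_add vcnj_smult
    by (rule arg_cong2[where f = vpair]) (auto simp: vec_eq_iff vcnj_def axis_def)
  finally show "dz \<mu> F w = fderiv L (vdiag w) (vpair (axis \<mu> 1) 0)" .
  have "dzbar \<mu> F w = (1/2) * (fderiv L (vdiag w) (vdiag (axis \<mu> 1)) + \<i> * fderiv L (vdiag w) (vdiag (\<i> *s axis \<mu> 1)))"
    unfolding dzbar_def dx dy by simp
  also have "\<dots> = fderiv L (vdiag w) ((1/2) *s (vdiag (axis \<mu> 1) + \<i> *s vdiag (\<i> *s axis \<mu> 1)))"
    unfolding smult linear_add[OF lin, symmetric] by simp
  also have "(1/2) *s (vdiag (axis \<mu> 1) + \<i> *s vdiag (\<i> *s axis \<mu> 1)) = vpair 0 (axis \<mu> 1)"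
    unfolding vdiag_def vpair_smult vpair_add vcnj_smult
    by (rule arg_cong2[where f = vpair]) (auto simp: vec_eq_iff vcnj_def axis_def)
  finally show "dzbar \<mu> F w = fderiv L (vdiag w) (vpair 0 (axis \<mu> 1))" .
qed

text \<open>The inner \<open>dzbar\<close> is again the diagonal restriction of a holomorphic
  function, so the Wirtinger identity can be used a second time.\<close>

lemma bergman_g_eq:
  assumes B: "open B" and L: "holo_on B L" and w: "vdiag w \<in> B"
    and LK: "\<And>z. vdiag z \<in> B \<Longrightarrow> L (vdiag z) = of_real (ln (bergman_diag S z))"
  shows "bergman_g S \<mu> \<nu> w = fderiv (\<lambda>Z. fderiv L Z (vpair 0 (axis \<nu> 1))) (vdiag w) (vpair (axis \<mu> 1) 0)"
  unfolding bergman_g_def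
  by (rule wirtinger_diag(1)[OF B holo_on_fderiv[OF B L] w], rule wirtinger_diag(2)[OF B L]) (auto simp: LK)

text \<open>Pointwise convergence on the diagonal handles the real directions
  \<open>vdiag v\<close>; a complex combination of two of them is an arbitrary direction.\<close>

lemma tendsto_fderiv_vdiag:
  assumes B: "open B" and f: "\<And>j. j \<ge> J \<Longrightarrow> holo_on B (f j)" and g: "holo_on B g"
    and M: "\<And>j w. j \<ge> J \<Longrightarrow> w \<in> B \<Longrightarrow> cmod (f j w) \<le> M" "\<And>w. w \<in> B \<Longrightarrow> cmod (g w) \<le> M"
    and lim: "\<And>z. vdiag z \<in> B \<Longrightarrow> (\<lambda>j. f j (vdiag z)) \<longlonglongrightarrow> g (vdiag z)"
    and z: "vdiag z \<in> B"
  shows "(\<lambda>j. fderiv (f j) (vdiag z) (vpair x y)) \<longlonglongrightarrow> fderiv g (vdiag z) (vpair x y)"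
proof -
  obtain r where r: "r > 0" "cball (vdiag z) r \<subseteq> B" using B z open_contains_cball by blast
  have real_dir: "(\<lambda>j. fderiv (f j) (vdiag z) (vdiag v)) \<longlonglongrightarrow> fderiv g (vdiag z) (vdiag v)" for v
  proof (rule tendsto_fderiv[OF f g r(2,1), where M = M])
    define d where "d = r / (1 + norm (vdiag v))"
    have p: "1 + norm (vdiag v) > 0" by (simp add: add_pos_nonneg)
    show "d > 0" using r p by (simp add: d_def)
    fix t assume t: "0 \<le> t" "t < d"
    have "t * (1 + norm (vdiag v)) < r" using t p by (simp add: d_def field_simps)
    then have "norm (t *\<^sub>R vdiag v) \<le> r" using t by (simp add: algebra_simps)
    then have "vdiag (z + t *\<^sub>R v) \<in> B" using r by (auto simp: vdiag_add vdiag_scaleR subset_iff dist_norm)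
    from lim[OF this] show "(\<lambda>j. f j (vdiag z + t *\<^sub>R vdiag v)) \<longlonglongrightarrow> g (vdiag z + t *\<^sub>R vdiag v)"
      by (simp add: vdiag_add vdiag_scaleR)
  qed (use M r in auto)
  define p q where "p = (1/2) *s (x + vcnj y)" and "q = (-\<i>/2) *s (x - vcnj y)"
  have split: "fderiv F (vdiag z) (vpair x y) = fderiv F (vdiag z) (vdiag p) + \<i> * fderiv F (vdiag z) (vdiag q)"
    if "holo_on B F" for F
    unfolding vpair_eq_vdiag[of x y, folded p_def q_def] linear_add[OF holo_on_linear_fderiv[OF that z]]
      holo_on_fderiv_smult[OF that z] ..
  have "(\<lambda>j. fderiv (f j) (vdiag z) (vdiag p) + \<i> * fderiv (f j) (vdiag z) (vdiag q))
      \<longlonglongrightarrow> fderiv g (vdiag z) (vdiag p) + \<i> * fderiv g (vdiag z) (vdiag q)"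
    by (intro tendsto_intros real_dir)
  then show ?thesis
    unfolding split[OF g]
    by (rule Lim_transform_eventually) (use f in \<open>auto simp: eventually_sequentially split intro!: exI[of _ J]\<close>)
qed

text \<open>At \<open>z0\<close> the second derivatives converge by two passages to the derivative.
  Nearby points follow from a Lipschitz bound that is the same for every large
  \<open>j\<close>.\<close>

lemma bergman_g_local_uniform:
  fixes \<Omega> :: "nat \<Rightarrow> (complex^'n::finite) set"
  assumes S: "open S" and pos: "\<And>z. z \<in> S \<Longrightarrow> bergman_diag S z > 0"
    and Sj: "\<And>j. j \<ge> J \<Longrightarrow> open (\<Omega> j)" and posj: "\<And>j z. j \<ge> J \<Longrightarrow> z \<in> \<Omega> j \<Longrightarrow> bergman_diag (\<Omega> j) z > 0"
    and r: "r > 0" and sub: "cball z0 (2 * r) \<subseteq> S" and subj: "\<And>j. j \<ge> J \<Longrightarrow> cball z0 (2 * r) \<subseteq> \<Omega> j"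
    and lim: "\<And>z. z \<in> S \<Longrightarrow> (\<lambda>j. bergman_diag (\<Omega> j) z) \<longlonglongrightarrow> bergman_diag S z"
    and e: "e > 0"
  shows "\<exists>d>0. \<exists>N. \<forall>j\<ge>N. \<forall>z\<in>ball z0 d. dist (bergman_g (\<Omega> j) \<mu> \<nu> z) (bergman_g S \<mu> \<nu> z) < e"
proof -
  have z0: "z0 \<in> S" using sub r by auto
  \<comment> \<open>Half the limit value bounds the kernels at \<open>z0\<close> from below for all
    large \<open>j\<close>; a common radius for the logarithms requires such a bound.\<close>
  define m where "m = bergman_diag S z0 / 2"
  have m: "m > 0" "m < bergman_diag S z0" using pos[OF z0] by (auto simp: m_def)
  obtain J' where J': "\<And>j. j \<ge> J' \<Longrightarrow> m < bergman_diag (\<Omega> j) z0"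
    using order_tendstoD(1)[OF lim[OF z0] m(2)] unfolding eventually_sequentially by blast
  define J2 where "J2 = max J J'"
  obtain \<rho> C where \<rho>: "0 < \<rho>" "\<rho> \<le> r" and pot:
    "\<And>S. open S \<Longrightarrow> (\<And>z. z \<in> S \<Longrightarrow> bergman_diag S z > 0) \<Longrightarrow> cball z0 (2 * r) \<subseteq> S \<Longrightarrow> m \<le> bergman_diag S z0 \<Longrightarrow>
      \<exists>L. holo_on (ball (vdiag z0) \<rho>) L \<and> (\<forall>Z\<in>ball (vdiag z0) \<rho>. cmod (L Z) \<le> C)
        \<and> (\<forall>z. vdiag z \<in> ball (vdiag z0) \<rho> \<longrightarrow> L (vdiag z) = of_real (ln (bergman_diag S z)))"
    using bergman_log_potential[OF r m(1), of z0] by metis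
  \<comment> \<open>Each Cauchy estimate consumes part of the radius: the potentials are bounded on
    \<open>B\<close>, their first derivatives on \<open>B2\<close>, the second ones on the ball of
    radius \<open>\<rho> / 8\<close>.\<close>
  define B B2 where "B = ball (vdiag z0) \<rho>" and "B2 = ball (vdiag z0) (\<rho>/2)"
  obtain L where L: "holo_on B L" "\<And>Z. Z \<in> B \<Longrightarrow> cmod (L Z) \<le> C"
    "\<And>z. vdiag z \<in> B \<Longrightarrow> L (vdiag z) = of_real (ln (bergman_diag S z))"
    using pot[OF S pos sub less_imp_le[OF m(2)]] unfolding B_def by blast
  have "\<forall>j\<ge>J2. \<exists>L. holo_on B L \<and> (\<forall>Z\<in>B. cmod (L Z) \<le> C) \<and> (\<forall>z. vdiag z \<in> B \<longrightarrow> L (vdiag z) = of_real (ln (bergman_diag (\<Omega> j) z)))"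
  proof (intro allI impI)
    fix j assume "J2 \<le> j"
    then have j: "J \<le> j" "J' \<le> j" by (auto simp: J2_def)
    show "\<exists>L. holo_on B L \<and> (\<forall>Z\<in>B. cmod (L Z) \<le> C) \<and> (\<forall>z. vdiag z \<in> B \<longrightarrow> L (vdiag z) = of_real (ln (bergman_diag (\<Omega> j) z)))"
      unfolding B_def by (rule pot[OF Sj posj subj less_imp_le[OF J']]) (use j in auto)
  qed
  then obtain Lj where Lj: "\<And>j. j \<ge> J2 \<Longrightarrow> holo_on B (Lj j)" "\<And>j Z. j \<ge> J2 \<Longrightarrow> Z \<in> B \<Longrightarrow> cmod (Lj j Z) \<le> C"
    "\<And>j z. j \<ge> J2 \<Longrightarrow> vdiag z \<in> B \<Longrightarrow> Lj j (vdiag z) = of_real (ln (bergman_diag (\<Omega> j) z))"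
    by metis
  have inS: "z \<in> S" if "vdiag z \<in> B" for z
  proof -
    have "dist z0 z \<le> dist (vdiag z0) (vdiag z)"
      using norm_vdiag_bounds(1)[of "z0 - z"] by (simp add: dist_norm vdiag_diff)
    then have "z \<in> cball z0 (2 * r)" using that \<rho> r by (simp add: B_def)
    then show ?thesis using sub by blast
  qed
  have limL: "(\<lambda>j. Lj j (vdiag z)) \<longlonglongrightarrow> L (vdiag z)" if z: "vdiag z \<in> B" for z
  proof -
    have "(\<lambda>j. complex_of_real (ln (bergman_diag (\<Omega> j) z))) \<longlonglongrightarrow> of_real (ln (bergman_diag S z))"
      using pos[OF inS[OF z]] by (intro tendsto_intros lim inS[OF z]) auto
    then show ?thesis
      unfolding L(3)[OF z]
      by (rule Lim_transform_eventually) (use z in \<open>auto simp: eventually_sequentially Lj(3) intro!: exI[of _ J2]\<close>)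
  qed
  define b a :: "complex^('n+'n)" where "b = vpair 0 (axis \<nu> 1)" and "a = vpair (axis \<mu> 1) 0"
  have nb: "norm b = 1" and na: "norm a = 1"
  proof -
    have "(norm b)\<^sup>2 = 1" "(norm a)\<^sup>2 = 1" by (simp_all add: norm_vpair a_def b_def)
    then show "norm b = 1" "norm a = 1" by (simp_all add: power2_eq_1_iff) (smt (verit) norm_ge_zero)+
  qed
  have opB: "open B" "open B2" by (auto simp: B_def B2_def)
  have cb: "cball Z (\<rho>/2) \<subseteq> B" if "Z \<in> B2" for Z
  proof
    fix Y assume "Y \<in> cball Z (\<rho>/2)"
    then show "Y \<in> B" using that dist_triangle[of "vdiag z0" Y Z] by (simp add: B_def B2_def)
  qed
  have B2B: "B2 \<subseteq> B" using \<rho> by (auto simp: B_def B2_def)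
  define D where "D = (\<lambda>(F :: complex^('n+'n) \<Rightarrow> complex) Z. fderiv F Z b)"
  have D: "holo_on B2 (D F)" "\<And>Z. Z \<in> B2 \<Longrightarrow> cmod (D F Z) \<le> C / (\<rho>/2)"
    if F: "holo_on B F" "\<And>Z. Z \<in> B \<Longrightarrow> cmod (F Z) \<le> C" for F
  proof -
    show "holo_on B2 (D F)"
      unfolding D_def using holo_on_subset[OF holo_on_fderiv[OF opB(1) F(1)] B2B] .
    show "cmod (D F Z) \<le> C / (\<rho>/2)" if Z: "Z \<in> B2" for Z
    proof -
      have "cmod (F w) \<le> C" if "w \<in> cball Z (\<rho>/2)" for w using F(2) cb[OF Z] that by blast
      from holo_on_cauchy[OF F(1) cb[OF Z] _ this, of b] show ?thesis using \<rho> nb by (simp add: D_def)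
    qed
  qed
  define G where "G = (\<lambda>F Z. fderiv (D F) Z a)"
  have G: "bergman_g S \<mu> \<nu> z = G L (vdiag z)" if "vdiag z \<in> B" for z
    unfolding G_def D_def a_def b_def by (rule bergman_g_eq[OF opB(1) L(1) that L(3)])
  have Gj: "bergman_g (\<Omega> j) \<mu> \<nu> z = G (Lj j) (vdiag z)" if "vdiag z \<in> B" "j \<ge> J2" for z j
    unfolding G_def D_def a_def b_def by (rule bergman_g_eq[OF opB(1) Lj(1) that(1) Lj(3)]) (use that in auto)
  \<comment> \<open>First passage to the derivative. The conclusion again concerns diagonal points,
    which is just what the second passage takes as input.\<close>
  have limD: "(\<lambda>j. D (Lj j) (vdiag z)) \<longlonglongrightarrow> D L (vdiag z)" if "vdiag z \<in> B2" for z
    unfolding D_def b_def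
    by (rule tendsto_fderiv_vdiag[OF opB(1) Lj(1) L(1) Lj(2) L(2) limL]) (use that B2B in auto)
  have "(\<lambda>j. G (Lj j) (vdiag z0)) \<longlonglongrightarrow> G L (vdiag z0)"
    unfolding G_def a_def
    by (rule tendsto_fderiv_vdiag[OF opB(2) D(1) D(1) D(2) D(2) limD, where J = J2])
      (use \<rho> Lj L in \<open>auto simp: B2_def\<close>)
  from LIMSEQ_D[OF this, of "e/3"] e obtain N where
    N: "\<And>j. j \<ge> N \<Longrightarrow> cmod (G (Lj j) (vdiag z0) - G L (vdiag z0)) < e/3" by auto
  define Q where "Q = C / (\<rho>/2) / (\<rho>/4)"
  have lip: "cmod (G F (vdiag z) - G F (vdiag z0)) \<le> 5 * Q / (\<rho>/8) * norm (vdiag z - vdiag z0)"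
    if F: "holo_on B F" "\<And>Z. Z \<in> B \<Longrightarrow> cmod (F Z) \<le> C" and z: "norm (vdiag z - vdiag z0) \<le> (\<rho>/8)/2" for F z
  proof -
    have "holo_on B2 (G F)"
      unfolding G_def using holo_on_fderiv[OF opB(2) D(1)[OF F]] .
    moreover have "cball (vdiag z0) (\<rho>/8) \<subseteq> B2" using \<rho> by (auto simp: B2_def)
    moreover have "cmod (G F Z) \<le> Q" if Z: "Z \<in> cball (vdiag z0) (\<rho>/8)" for Z
    proof -
      have "cball Z (\<rho>/4) \<subseteq> B2"
      proof
        fix Y assume "Y \<in> cball Z (\<rho>/4)"
        then show "Y \<in> B2" using Z \<rho> dist_triangle[of "vdiag z0" Y Z] by (simp add: B2_def)
      qed
      then have "cmod (D F w) \<le> C / (\<rho>/2)" if "w \<in> cball Z (\<rho>/4)" for w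
        using D(2)[OF F] that by blast
      from holo_on_cauchy[OF D(1)[OF F] \<open>cball Z (\<rho>/4) \<subseteq> B2\<close> _ this, of a] show ?thesis
        using \<rho> na by (simp add: G_def Q_def)
    qed
    ultimately show ?thesis
      using holo_on_lipschitz[of B2 "G F" "vdiag z0" "\<rho>/8" Q "vdiag z - vdiag z0"] z \<rho> by simp
  qed
  define K where "K = 5 * Q / (\<rho>/8)"
  have C0: "C \<ge> 0" using L(2)[of "vdiag z0"] \<rho> by (simp add: B_def) (use norm_ge_zero order_trans in blast)
  have K0: "K \<ge> 0" using C0 \<rho> by (simp add: K_def Q_def)
  \<comment> \<open>\<open>vdiag\<close> stretches by at most 2 and the Lipschitz bound reaches
    \<open>\<rho> / 16\<close>; the other term limits each of the two displacement errors to
    \<open>e / 3\<close>.\<close>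
  define d where "d = min (\<rho>/32) (e / (6 * (K + 1)))"
  have d: "d > 0" using \<rho> e K0 by (simp add: d_def)
  show ?thesis
  proof (intro exI[of _ d] conjI exI[of _ "max N J2"] allI impI ballI d)
    fix j z assume j: "max N J2 \<le> j" and z: "z \<in> ball z0 d"
    have nz: "norm (vdiag z - vdiag z0) \<le> 2 * norm (z - z0)"
      using norm_vdiag_bounds(2)[of "z - z0"] by (simp add: vdiag_diff)
    have zd: "norm (z - z0) < d" using z by (simp add: dist_norm norm_minus_commute)
    have small: "norm (vdiag z - vdiag z0) \<le> (\<rho>/8)/2" using nz zd by (simp add: d_def)
    then have zB: "vdiag z \<in> B" using \<rho> by (simp add: B_def dist_norm norm_minus_commute)
    have "K * norm (vdiag z - vdiag z0) \<le> K * (2 * d)" using nz zd K0 by (intro mult_left_mono) auto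
    also have "\<dots> \<le> (K + 1) * (2 * (e / (6 * (K + 1))))"
      using K0 d by (intro mult_mono) (auto simp: d_def)
    also have "\<dots> = e/3"
    proof -
      have "K + 1 \<noteq> 0" using K0 by simp
      then show ?thesis by (simp only: times_divide_eq_right) (simp add: divide_simps)
    qed
    finally have Ke: "K * norm (vdiag z - vdiag z0) \<le> e/3" .
    have 1: "cmod (G (Lj j) (vdiag z) - G (Lj j) (vdiag z0)) \<le> e/3"
      using lip[OF Lj(1,2) small, of j] Ke j unfolding K_def by simp
    have 2: "cmod (G L (vdiag z) - G L (vdiag z0)) \<le> e/3"
      using lip[OF L(1,2) small] Ke unfolding K_def by simp
    have 3: "cmod (G (Lj j) (vdiag z0) - G L (vdiag z0)) < e/3" using N j by simp
    have "cmod (p - q) < e" if "cmod (p - p0) \<le> e/3" "cmod (q - q0) \<le> e/3" "cmod (p0 - q0) < e/3" for p q p0 q0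
      using that norm_triangle_ineq4[of "p - q0" "q - q0"] norm_triangle_ineq[of "p - p0" "p0 - q0"] by simp
    from this[OF 1 2 3] show "dist (bergman_g (\<Omega> j) \<mu> \<nu> z) (bergman_g S \<mu> \<nu> z) < e"
      using G[OF zB] Gj[OF zB] j by (simp add: dist_norm)
  qed
qed

lemma continuous_on_bergman_g:
  fixes S :: "(complex^'n::finite) set"
  assumes S: "open S" and pos: "\<And>z. z \<in> S \<Longrightarrow> bergman_diag S z > 0"
  shows "continuous_on S (bergman_g S \<mu> \<nu>)"
proof (rule continuous_at_imp_continuous_on, rule ballI)
  fix z0 assume z0: "z0 \<in> S"
  obtain r' where r': "r' > 0" "cball z0 r' \<subseteq> S" using S z0 open_contains_cball by blast
  define r where "r = r' / 2"
  have r: "r > 0" "cball z0 (2 * r) \<subseteq> S" using r' by (auto simp: r_def)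
  obtain \<rho> C where \<rho>: "0 < \<rho>" and pot: "\<exists>L. holo_on (ball (vdiag z0) \<rho>) L \<and> (\<forall>Z\<in>ball (vdiag z0) \<rho>. cmod (L Z) \<le> C)
        \<and> (\<forall>z. vdiag z \<in> ball (vdiag z0) \<rho> \<longrightarrow> L (vdiag z) = of_real (ln (bergman_diag S z)))"
    using bergman_log_potential[OF r(1) pos[OF z0], of z0] S pos r(2) by (metis order_refl)
  define B where "B = ball (vdiag z0) \<rho>"
  have B: "open B" "vdiag z0 \<in> B" using \<rho> by (auto simp: B_def)
  obtain L where L: "holo_on B L" "\<And>z. vdiag z \<in> B \<Longrightarrow> L (vdiag z) = of_real (ln (bergman_diag S z))"
    using pot unfolding B_def by blast
  define G where "G = (\<lambda>Z. fderiv (\<lambda>Z. fderiv L Z (vpair 0 (axis \<nu> 1))) Z (vpair (axis \<mu> 1) 0))"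
  have "holo_on B G" unfolding G_def by (intro holo_on_fderiv B L)
  then have "isCont G (vdiag z0)" using holo_on_continuous_on continuous_on_eq_continuous_at B by blast
  moreover have "isCont vdiag z0" by (rule linear_continuous_at[OF bounded_linear_vdiag])
  ultimately have "isCont (\<lambda>z. G (vdiag z)) z0" using continuous_within_compose3 isCont_o2 by blast
  moreover have "\<forall>\<^sub>F z in nhds z0. G (vdiag z) = bergman_g S \<mu> \<nu> z"
  proof -
    have "open (vdiag -` B)"
      by (intro open_vimage B linear_continuous_on bounded_linear_vdiag)
    then have "\<forall>\<^sub>F z in nhds z0. z \<in> vdiag -` B" using B eventually_nhds_in_open by blast
    then show ?thesis
      by (rule eventually_mono) (use bergman_g_eq[OF B(1) L(1) _ L(2)] in \<open>auto simp: G_def\<close>)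
  qed
  ultimately show "isCont (bergman_g S \<mu> \<nu>) z0"
    using isCont_cong[of "\<lambda>z. G (vdiag z)" "bergman_g S \<mu> \<nu>" z0] by simp
qed

section \<open>Distances of Finsler metrics\<close>

abbreviation speed :: "('a::real_normed_vector \<Rightarrow> 'a \<Rightarrow> real) \<Rightarrow> (real \<Rightarrow> 'a) \<Rightarrow> real \<Rightarrow> real" where
  "speed F \<gamma> \<equiv> (\<lambda>t. F (\<gamma> t) (vector_derivative \<gamma> (at t)))"

text \<open>The conditions on paths are those of \<open>bergman_dist\<close>, so
  \<open>fdist\<close> specialises to it by reordering conjuncts.\<close>

definition rectifiable_in :: "'a::real_normed_vector set \<Rightarrow> ('a \<Rightarrow> 'a \<Rightarrow> real) \<Rightarrow> (real \<Rightarrow> 'a) \<Rightarrow> bool" where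
  "rectifiable_in U F \<gamma> \<longleftrightarrow> valid_path \<gamma> \<and> path_image \<gamma> \<subseteq> U \<and> speed F \<gamma> integrable_on {0..1}"

definition flen :: "('a::real_normed_vector \<Rightarrow> 'a \<Rightarrow> real) \<Rightarrow> (real \<Rightarrow> 'a) \<Rightarrow> real" where
  "flen F \<gamma> = integral {0..1} (speed F \<gamma>)"

definition fdist :: "'a::real_normed_vector set \<Rightarrow> ('a \<Rightarrow> 'a \<Rightarrow> real) \<Rightarrow> 'a \<Rightarrow> 'a \<Rightarrow> real" where
  "fdist U F z w = Inf {flen F \<gamma> | \<gamma>. rectifiable_in U F \<gamma> \<and> pathstart \<gamma> = z \<and> pathfinish \<gamma> = w}"

text \<open>The threshold may vary with the point; a finite subcover allows the largest one to be
  taken.\<close>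

lemma compact_eventually_uniform:
  fixes P :: "nat \<Rightarrow> 'a::metric_space \<Rightarrow> bool"
  assumes C: "compact C" and loc: "\<And>x. x \<in> C \<Longrightarrow> \<exists>d>0. \<exists>N. \<forall>n\<ge>N. \<forall>y\<in>ball x d. P n y"
  shows "\<exists>N. \<forall>n\<ge>N. \<forall>y\<in>C. P n y"
proof -
  obtain d N where d: "\<And>x. x \<in> C \<Longrightarrow> d x > 0" and N: "\<And>x n y. x \<in> C \<Longrightarrow> n \<ge> N x \<Longrightarrow> y \<in> ball x (d x) \<Longrightarrow> P n y"
    using loc by metis
  have "C \<subseteq> (\<Union>x\<in>C. ball x (d x))" using d by force
  then obtain D where D: "D \<subseteq> C" "finite D" "C \<subseteq> (\<Union>x\<in>D. ball x (d x))"
    using compactE_image[OF C, of C "\<lambda>x. ball x (d x)"] by auto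
  show ?thesis
  proof (intro exI[of _ "Max (insert 0 (N ` D))"] allI impI ballI)
    fix n y assume n: "Max (insert 0 (N ` D)) \<le> n" and "y \<in> C"
    then obtain x where x: "x \<in> D" "y \<in> ball x (d x)" using D by blast
    have "N x \<le> n" using n x(1) D(2) by (auto simp: Max_le_iff)
    then show "P n y" using N x D(1) by blast
  qed
qed

lemma valid_path_derivative:
  assumes "valid_path \<gamma>"
  obtains S where "finite S" "\<And>t. t \<in> {0..1} - S \<Longrightarrow> (\<gamma> has_vector_derivative vector_derivative \<gamma> (at t)) (at t)"
    "continuous_on ({0..1} - S) (\<lambda>t. vector_derivative \<gamma> (at t))" "continuous_on {0..1} \<gamma>"
  using assms unfolding valid_path_def piecewise_C1_differentiable_on_def C1_differentiable_on_eq
  by (metis vector_derivative_works)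

text \<open>A valid path may have an unbounded derivative near its exceptional points, so integrability of the
  speed has to be obtained by comparison.\<close>

lemma speed_integrable_comparison:
  fixes \<gamma> :: "real \<Rightarrow> 'a::euclidean_space"
  assumes \<gamma>: "valid_path \<gamma>" and ab: "{a..b} \<subseteq> {0..1}" and K: "\<gamma> ` {a..b} \<subseteq> K"
    and F: "continuous_on (K \<times> UNIV) (\<lambda>(z, v). F z v)"
    and le: "\<And>z v. z \<in> K \<Longrightarrow> \<bar>F z v\<bar> \<le> c * G z v"
    and G: "speed G \<gamma> integrable_on {a..b}"
  shows "speed F \<gamma> integrable_on {a..b}"
proof -
  obtain S where S: "finite S" "continuous_on ({0..1} - S) (\<lambda>t. vector_derivative \<gamma> (at t))" "continuous_on {0..1} \<gamma>"
    using valid_path_derivative[OF \<gamma>] by metis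
  have "continuous_on ({a..b} - S) ((\<lambda>(z, v). F z v) \<circ> (\<lambda>t. (\<gamma> t, vector_derivative \<gamma> (at t))))"
  proof (rule continuous_on_compose)
    show "continuous_on ({a..b} - S) (\<lambda>t. (\<gamma> t, vector_derivative \<gamma> (at t)))"
      using ab by (intro continuous_on_Pair continuous_on_subset[OF S(2)] continuous_on_subset[OF S(3)]) auto
    show "continuous_on ((\<lambda>t. (\<gamma> t, vector_derivative \<gamma> (at t))) ` ({a..b} - S)) (\<lambda>(z, v). F z v)"
      by (rule continuous_on_subset[OF F]) (use K in auto)
  qed
  then have cont: "continuous_on ({a..b} - S) (speed F \<gamma>)" by (simp add: o_def)
  have leb: "{a..b} - S \<in> sets lebesgue"
    using S(1) by (intro sets.Diff) (auto intro: negligible_finite negligible_imp_sets)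
  have neg: "negligible (({a..b} - S - {a..b}) \<union> ({a..b} - ({a..b} - S)))"
    by (rule negligible_subset[OF negligible_finite[OF S(1)]]) auto
  have "speed F \<gamma> integrable_on ({a..b} - S)"
  proof (rule measurable_bounded_by_integrable_imp_integrable[OF continuous_imp_measurable_on_sets_lebesgue[OF cont leb] _ _ leb])
    have "(\<lambda>t. c * speed G \<gamma> t) integrable_on {a..b}" using integrable_on_cmult_left[OF G, of c] by simp
    then show "(\<lambda>t. c * speed G \<gamma> t) integrable_on ({a..b} - S)"
      using integrable_spike_set_eq[OF neg] by blast
    show "norm (speed F \<gamma> t) \<le> c * speed G \<gamma> t" if "t \<in> {a..b} - S" for t
    proof -
      have "\<gamma> t \<in> K" using K that by auto
      then show ?thesis using le by simp
    qed
  qed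
  then show ?thesis using integrable_spike_set_eq[OF neg] by blast
qed

lemma displacement_le_length:
  fixes \<gamma> :: "real \<Rightarrow> 'a::euclidean_space"
  assumes \<gamma>: "valid_path \<gamma>" and ab: "0 \<le> a" "a \<le> b" "b \<le> 1"
    and le: "\<And>t v. t \<in> {a..b} \<Longrightarrow> c * norm v \<le> F (\<gamma> t) v" and c: "c \<ge> 0"
    and F: "speed F \<gamma> integrable_on {a..b}"
  shows "c * norm (\<gamma> b - \<gamma> a) \<le> integral {a..b} (speed F \<gamma>)"
proof -
  obtain S where S: "finite S" "\<And>t. t \<in> {0..1} - S \<Longrightarrow> (\<gamma> has_vector_derivative vector_derivative \<gamma> (at t)) (at t)"
    "continuous_on {0..1} \<gamma>"
    using valid_path_derivative[OF \<gamma>] by metis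
  have "((\<lambda>t. vector_derivative \<gamma> (at t)) has_integral (\<gamma> b - \<gamma> a)) {a..b}"
    by (rule fundamental_theorem_of_calculus_interior_strong[OF S(1) ab(2)])
      (use S ab in \<open>auto intro: continuous_on_subset\<close>)
  from has_integral_cmul[OF this, of c]
  have I: "((\<lambda>t. c *\<^sub>R vector_derivative \<gamma> (at t)) has_integral c *\<^sub>R (\<gamma> b - \<gamma> a)) {a..b}" .
  have "norm (integral {a..b} (\<lambda>t. c *\<^sub>R vector_derivative \<gamma> (at t))) \<le> integral {a..b} (speed F \<gamma>)"
    by (rule Henstock_Kurzweil_Integration.integral_norm_bound_integral[OF has_integral_integrable[OF I] F])
      (use le c in auto)
  then show ?thesis unfolding integral_unique[OF I] using c by simp
qed

text \<open>\<open>s\<close> is the first parameter outside \<open>W\<close>. Earlier points lie in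
  \<open>W\<close>, so by continuity the point at \<open>s\<close> is in the closure; a path that
  stays in \<open>W\<close> gets \<open>s = 1\<close>.\<close>

lemma path_exit:
  fixes \<gamma> :: "real \<Rightarrow> 'a::metric_space"
  assumes \<gamma>: "continuous_on {0..1} \<gamma>" and W: "open W" and "\<gamma> 0 \<in> W"
  obtains s where "0 \<le> s" "s \<le> 1" "\<gamma> ` {0..s} \<subseteq> closure W" "s = 1 \<or> \<gamma> s \<notin> W"
proof (cases "\<gamma> ` {0..1} \<subseteq> W")
  case True
  then show ?thesis using that[of 1] closure_subset[of W] by auto
next
  case False
  define T where "T = {0..1} \<inter> \<gamma> -` (- W)"
  have "closed T" unfolding T_def
    by (rule continuous_closed_preimage[OF \<gamma>]) (use W in auto)
  moreover have "T \<noteq> {}" "bounded T" using False by (auto simp: T_def intro: bounded_subset[of "{0..1}"])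
  ultimately obtain s where s: "s \<in> T" "\<And>t. t \<in> T \<Longrightarrow> s \<le> t"
    using compact_attains_inf[of T] compact_eq_bounded_closed by blast
  have s01: "0 \<le> s" "s \<le> 1" and sW: "\<gamma> s \<notin> W" using s(1) by (auto simp: T_def)
  have "s \<noteq> 0" using sW assms(3) by auto
  then have s0: "0 < s" using s01 by simp
  have before: "\<gamma> t \<in> W" if "0 \<le> t" "t < s" for t
    using s(2)[of t] that s01 by (auto simp: T_def)
  have "\<gamma> ` closure {0..<s} \<subseteq> closure W"
  proof (rule image_closure_subset)
    show "continuous_on (closure {0..<s}) \<gamma>"
      using s0 s01 by (intro continuous_on_subset[OF \<gamma>]) auto
    show "\<gamma> ` {0..<s} \<subseteq> closure W" using before closure_subset by fastforce
  qed simp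
  then have "\<gamma> ` {0..s} \<subseteq> closure W" using s0 by simp
  then show ?thesis using that s01 sW by blast
qed

text \<open>What the length arguments use, so that the limit domain and every
  \<open>\<Omega> j\<close> share one set of lemmas. The absolute value in \<open>homog\<close>
  makes length invariant under reversal.\<close>

locale finsler =
  fixes U :: "'a::euclidean_space set" and F :: "'a \<Rightarrow> 'a \<Rightarrow> real"
  assumes open_U: "open U" and connected_U: "connected U"
    and cont: "continuous_on (U \<times> UNIV) (\<lambda>(z, v). F z v)"
    and homog: "z \<in> U \<Longrightarrow> F z (t *\<^sub>R v) = \<bar>t\<bar> * F z v"
    and pos: "z \<in> U \<Longrightarrow> v \<noteq> 0 \<Longrightarrow> F z v > 0"
begin

abbreviation "d \<equiv> fdist U F"

lemma F_zero: "z \<in> U \<Longrightarrow> F z 0 = 0"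
  using homog[of z 0 0] by simp

lemma F_nonneg: "z \<in> U \<Longrightarrow> F z v \<ge> 0"
  using pos[of z v] F_zero[of z] by (cases "v = 0") auto

text \<open>Extreme values over \<open>K\<close> times the unit sphere, spread to all vectors by
  homogeneity.\<close>

lemma compact_bounds:
  assumes K: "compact K" "K \<subseteq> U"
  obtains c C where "c > 0" "C \<ge> 0" "\<And>z v. z \<in> K \<Longrightarrow> c * norm v \<le> F z v" "\<And>z v. z \<in> K \<Longrightarrow> F z v \<le> C * norm v"
proof (cases "K = {}")
  case True
  then show ?thesis using that[of 1 0] by auto
next
  case False
  let ?Q = "K \<times> sphere (0::'a) 1"
  have ne: "?Q \<noteq> {}" using False by auto
  have co: "compact ?Q" by (intro compact_Times K compact_sphere)
  have ct: "continuous_on ?Q (\<lambda>(z, v). F z v)" by (rule continuous_on_subset[OF cont]) (use K in auto)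
  obtain p where p: "p \<in> ?Q" "\<And>q. q \<in> ?Q \<Longrightarrow> (\<lambda>(z, v). F z v) p \<le> (\<lambda>(z, v). F z v) q"
    using continuous_attains_inf[OF co ne ct] by blast
  obtain q where q: "q \<in> ?Q" "\<And>p. p \<in> ?Q \<Longrightarrow> (\<lambda>(z, v). F z v) p \<le> (\<lambda>(z, v). F z v) q"
    using continuous_attains_sup[OF co ne ct] by blast
  have scale: "F z v = norm v * F z (v /\<^sub>R norm v)" "z \<in> K \<Longrightarrow> (z, v /\<^sub>R norm v) \<in> ?Q" if "z \<in> K" "v \<noteq> 0" for z v
    using homog[of z "norm v" "v /\<^sub>R norm v"] that K by auto
  show ?thesis
  proof (rule that[of "(\<lambda>(z, v). F z v) p" "(\<lambda>(z, v). F z v) q"])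
    show "(\<lambda>(z, v). F z v) p > 0" using p(1) K by (cases p) (auto intro!: pos)
    show "(\<lambda>(z, v). F z v) q \<ge> 0" using q(1) F_nonneg K by (cases q) auto
    fix z v assume z: "z \<in> K"
    show "(\<lambda>(z, v). F z v) p * norm v \<le> F z v"
    proof (cases "v = 0")
      case False
      then show ?thesis
        using p(2)[OF scale(2)[OF z False z]] scale(1)[OF z False] by (simp add: mult.commute[of _ "norm v"])
    qed (use F_zero z K in auto)
    show "F z v \<le> (\<lambda>(z, v). F z v) q * norm v"
    proof (cases "v = 0")
      case False
      then show ?thesis
        using q(2)[OF scale(2)[OF z False z]] scale(1)[OF z False] by (simp add: mult.commute[of _ "norm v"])
    qed (use F_zero z K in auto)
  qed
qed

section \<open>Metric properties of the induced distance\<close>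

lemma flen_nonneg: "rectifiable_in U F \<gamma> \<Longrightarrow> flen F \<gamma> \<ge> 0"
  unfolding flen_def rectifiable_in_def path_image_def
  by (intro integral_nonneg F_nonneg) auto

lemma fdist_le: "rectifiable_in U F \<gamma> \<Longrightarrow> pathstart \<gamma> = x \<Longrightarrow> pathfinish \<gamma> = y \<Longrightarrow> d x y \<le> flen F \<gamma>"
  unfolding fdist_def by (intro cInf_lower bdd_belowI[of _ 0]) (use flen_nonneg in auto)

text \<open>A polynomial path has continuous, hence integrable, speed. Existence matters because
  \<open>Inf\<close> of an empty set of reals carries no information.\<close>

lemma rectifiable_path_exists:
  assumes "x \<in> U" "y \<in> U"
  obtains \<gamma> where "rectifiable_in U F \<gamma>" "pathstart \<gamma> = x" "pathfinish \<gamma> = y"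
proof -
  obtain g where g: "polynomial_function g" "path_image g \<subseteq> U" "pathstart g = x" "pathfinish g = y"
    using connected_open_polynomial_connected[OF open_U connected_U assms] by blast
  obtain g' where g': "polynomial_function g'" "\<And>t. (g has_vector_derivative g' t) (at t)"
    using has_vector_derivative_polynomial_function[OF g(1)] by blast
  have vd: "vector_derivative g (at t) = g' t" for t using g'(2) by (rule vector_derivative_at)
  have cg: "continuous_on {0..1} g" "continuous_on {0..1} g'"
    using g(1) g'(1) by (auto intro: continuous_on_polymonial_function)
  have "g C1_differentiable_on {0..1}"
    unfolding C1_differentiable_on_def using g'(2) cg(2) by blast
  then have "valid_path g" unfolding valid_path_def by (rule C1_differentiable_imp_piecewise)
  moreover have "speed F g integrable_on {0..1}"
  proof (rule integrable_continuous_real)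
    have "continuous_on {0..1} ((\<lambda>(z, v). F z v) \<circ> (\<lambda>t. (g t, g' t)))"
    proof (rule continuous_on_compose)
      show "continuous_on {0..1} (\<lambda>t. (g t, g' t))" by (intro continuous_on_Pair cg)
      show "continuous_on ((\<lambda>t. (g t, g' t)) ` {0..1}) (\<lambda>(z, v). F z v)"
        by (rule continuous_on_subset[OF cont]) (use g(2) in \<open>auto simp: path_image_def\<close>)
    qed
    then show "continuous_on {0..1} (speed F g)" by (simp add: o_def vd)
  qed
  ultimately show ?thesis using that g unfolding rectifiable_in_def by blast
qed

lemma path_set_nonempty:
  assumes "x \<in> U" "y \<in> U"
  shows "{flen F \<gamma> | \<gamma>. rectifiable_in U F \<gamma> \<and> pathstart \<gamma> = x \<and> pathfinish \<gamma> = y} \<noteq> {}"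
  using rectifiable_path_exists[OF assms] by blast

lemma fdist_nonneg: "x \<in> U \<Longrightarrow> y \<in> U \<Longrightarrow> d x y \<ge> 0"
  unfolding fdist_def by (rule cInf_greatest[OF path_set_nonempty]) (use flen_nonneg in auto)

lemma fdist_greatest:
  assumes "x \<in> U" "y \<in> U"
    and "\<And>\<gamma>. rectifiable_in U F \<gamma> \<Longrightarrow> pathstart \<gamma> = x \<Longrightarrow> pathfinish \<gamma> = y \<Longrightarrow> c \<le> flen F \<gamma>"
  shows "c \<le> d x y"
  unfolding fdist_def by (rule cInf_greatest[OF path_set_nonempty]) (use assms in auto)

lemma near_minimal_path:
  assumes "x \<in> U" "y \<in> U" "d x y < c"
  obtains \<gamma> where "rectifiable_in U F \<gamma>" "pathstart \<gamma> = x" "pathfinish \<gamma> = y" "flen F \<gamma> < c"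
  using cInf_lessD[OF path_set_nonempty[OF assms(1,2)] assms(3)[unfolded fdist_def]] by blast

lemma fdist_segment:
  assumes seg: "closed_segment x y \<subseteq> U" and C: "\<And>z v. z \<in> closed_segment x y \<Longrightarrow> F z v \<le> C * norm v"
  shows "d x y \<le> C * norm (y - x)"
proof -
  have ct: "continuous_on {0..1} (speed F (linepath x y))"
  proof -
    have "continuous_on {0..1} ((\<lambda>(z, v). F z v) \<circ> (\<lambda>t. (linepath x y t, y - x)))"
    proof (rule continuous_on_compose)
      show "continuous_on {0..1} (\<lambda>t. (linepath x y t, y - x))"
        by (intro continuous_on_Pair continuous_on_linepath continuous_on_const)
      show "continuous_on ((\<lambda>t. (linepath x y t, y - x)) ` {0..1}) (\<lambda>(z, v). F z v)"
        by (rule continuous_on_subset[OF cont]) (use seg linepath_in_path in blast)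
    qed
    then show ?thesis by (simp add: o_def)
  qed
  then have int: "speed F (linepath x y) integrable_on {0..1}" by (rule integrable_continuous_real)
  then have r: "rectifiable_in U F (linepath x y)"
    using seg by (simp add: rectifiable_in_def)
  have "flen F (linepath x y) \<le> integral {0..1} (\<lambda>t::real. C * norm (y - x))"
    unfolding flen_def
    by (rule integral_le[OF int]) (use C[OF linepath_in_path] in auto)
  then show ?thesis using fdist_le[OF r, of x y] by simp
qed

lemma fdist_self:
  assumes x: "x \<in> U"
  shows "d x x = 0"
proof -
  obtain C where "\<And>v. F x v \<le> C * norm v"
    using compact_bounds[of "{x}"] x by (metis compact_sing empty_subsetI insert_subset singletonI)
  then have "d x x \<le> 0" using fdist_segment[of x x C] x by simp
  then show ?thesis using fdist_nonneg[OF x x] by simp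
qed

text \<open>One substitution serves subpaths, reversal (\<open>m = -1\<close>) and the halves of a
  concatenation (\<open>m = 2\<close>): the factor \<open>\<bar>m\<bar>\<close> from homogeneity is
  the Jacobian.\<close>

lemma speed_affine:
  assumes \<gamma>: "valid_path \<gamma>" and m: "m \<noteq> 0" and pq: "p < q"
    and g: "\<And>x. x \<in> {p..q} \<Longrightarrow> g x = \<gamma> (m * x + c)"
    and im: "(\<lambda>x. m * x + c) ` {p..q} = {a..b}" and ab: "0 \<le> a" "b \<le> 1" and U: "\<gamma> ` {a..b} \<subseteq> U"
    and I: "(speed F \<gamma> has_integral I) {a..b}"
  shows "(speed F g has_integral I) {p..q}"
proof -
  obtain S where S: "finite S" "\<And>t. t \<in> {0..1} - S \<Longrightarrow> (\<gamma> has_vector_derivative vector_derivative \<gamma> (at t)) (at t)"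
    using valid_path_derivative[OF \<gamma>] by metis
  have inv_im: "(\<lambda>x. (1 / m) * x + - ((1 / m) * c)) ` {a..b} = {p..q}"
    unfolding im[symmetric] image_image using m by (simp add: field_simps)
  have "((\<lambda>x. speed F \<gamma> (m * x + c)) has_integral (1 / \<bar>m\<bar>) * I) {p..q}"
    using has_integral_affinity[OF I[folded cbox_interval] m, of c] inv_im by simp
  from has_integral_mult_right[OF this, of "\<bar>m\<bar>"]
  have J: "((\<lambda>x. \<bar>m\<bar> * speed F \<gamma> (m * x + c)) has_integral I) {p..q}" using m by simp
  \<comment> \<open>The end points go because \<open>g\<close> is known only on
    \<open>{p..q}\<close> while the derivative is two-sided; the other points are where
    \<open>\<gamma>\<close> may fail to be differentiable.\<close>
  let ?E = "{p, q} \<union> (\<lambda>x. (x - c) / m) ` S"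
  show ?thesis
  proof (rule has_integral_spike_finite[OF _ _ J])
    show "finite ?E" using S(1) by simp
    fix x assume x: "x \<in> {p..q} - ?E"
    then have xi: "x \<in> {p<..<q}" by auto
    have mx: "m * x + c \<in> {a..b}" using x im by blast
    have "m * x + c \<notin> S"
    proof
      assume "m * x + c \<in> S"
      then have "((m * x + c) - c) / m \<in> (\<lambda>x. (x - c) / m) ` S" by (rule imageI)
      then show False using x m by simp
    qed
    then have der: "(\<gamma> has_vector_derivative vector_derivative \<gamma> (at (m * x + c))) (at (m * x + c))"
      using S(2) mx ab by auto
    have aff: "((\<lambda>x. m * x + c) has_vector_derivative m) (at x)"
      by (auto intro!: derivative_eq_intros simp: has_real_derivative_iff_has_vector_derivative[symmetric])
    have "((\<gamma> \<circ> (\<lambda>x. m * x + c)) has_vector_derivative m *\<^sub>R vector_derivative \<gamma> (at (m * x + c))) (at x)"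
      by (rule vector_diff_chain_at[OF aff der])
    then have "(g has_vector_derivative m *\<^sub>R vector_derivative \<gamma> (at (m * x + c))) (at x)"
      by (rule has_vector_derivative_transform_within_open[OF _ open_greaterThanLessThan xi]) (simp add: g)
    then have "vector_derivative g (at x) = m *\<^sub>R vector_derivative \<gamma> (at (m * x + c))"
      by (rule vector_derivative_at)
    then show "speed F g x = \<bar>m\<bar> * speed F \<gamma> (m * x + c)"
      using g[of x] x mx U by (simp add: homog image_subset_iff)
  qed
qed

lemma fdist_le_integral:
  assumes \<gamma>: "valid_path \<gamma>" and ab: "0 \<le> a" "a \<le> b" "b \<le> 1" and U: "\<gamma> ` {a..b} \<subseteq> U"
    and I: "speed F \<gamma> integrable_on {a..b}"
  shows "d (\<gamma> a) (\<gamma> b) \<le> integral {a..b} (speed F \<gamma>)"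
proof (cases "a = b")
  case True
  then show ?thesis using U fdist_self[of "\<gamma> a"] by simp
next
  case False
  then have lt: "a < b" using ab by simp
  have J: "(speed F (subpath a b \<gamma>) has_integral integral {a..b} (speed F \<gamma>)) {0..1}"
  proof (rule speed_affine[OF \<gamma>, where m = "b - a" and c = a])
    show "(\<lambda>x. (b - a) * x + a) ` {0..1} = {a..b}"
      using lt by (subst image_affinity_atLeastAtMost) auto
    show "(speed F \<gamma> has_integral integral {a..b} (speed F \<gamma>)) {a..b}"
      using I by (rule integrable_integral)
  qed (use lt ab U in \<open>auto simp: subpath_def\<close>)
  have r: "rectifiable_in U F (subpath a b \<gamma>)"
    unfolding rectifiable_in_def
  proof (intro conjI)
    show "valid_path (subpath a b \<gamma>)" using \<gamma> ab by (intro valid_path_subpath) auto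
    show "path_image (subpath a b \<gamma>) \<subseteq> U" using U ab by (simp add: path_image_subpath_gen closed_segment_eq_real_ivl)
  qed (use J in auto)
  show ?thesis
    using fdist_le[OF r, of "\<gamma> a" "\<gamma> b"] integral_unique[OF J] by (simp add: flen_def)
qed

lemma fdist_commute_le:
  assumes "x \<in> U" "y \<in> U"
  shows "d x y \<le> d y x"
proof (rule fdist_greatest[OF assms(2,1)])
  fix \<gamma> assume r: "rectifiable_in U F \<gamma>" and s: "pathstart \<gamma> = y" "pathfinish \<gamma> = x"
  have J: "(speed F (reversepath \<gamma>) has_integral flen F \<gamma>) {0..1}"
  proof (rule speed_affine[where m = "-1" and c = 1 and a = 0 and b = 1])
    show "(\<lambda>x::real. - 1 * x + 1) ` {0..1} = {0..1}"
      by (subst image_affinity_atLeastAtMost) auto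
  qed (use r in \<open>auto simp: rectifiable_in_def reversepath_def flen_def path_image_def\<close>)
  have "rectifiable_in U F (reversepath \<gamma>)"
    using r J by (auto simp: rectifiable_in_def)
  from fdist_le[OF this, of x y] show "d x y \<le> flen F \<gamma>"
    using s integral_unique[OF J] by (simp add: flen_def)
qed

lemma fdist_commute: "x \<in> U \<Longrightarrow> y \<in> U \<Longrightarrow> d x y = d y x"
  using fdist_commute_le by (simp add: order_antisym)

lemma fdist_triangle:
  assumes x: "x \<in> U" and y: "y \<in> U" and z: "z \<in> U"
  shows "d x z \<le> d x y + d y z"
proof (rule field_le_epsilon)
  fix e :: real assume e: "e > 0"
  obtain g1 where g1: "rectifiable_in U F g1" "pathstart g1 = x" "pathfinish g1 = y" "flen F g1 < d x y + e/2"
    using near_minimal_path[OF x y, of "d x y + e/2"] e by auto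
  obtain g2 where g2: "rectifiable_in U F g2" "pathstart g2 = y" "pathfinish g2 = z" "flen F g2 < d y z + e/2"
    using near_minimal_path[OF y z, of "d y z + e/2"] e by auto
  let ?g = "g1 +++ g2"
  have J1: "(speed F ?g has_integral flen F g1) {0..1/2}"
  proof (rule speed_affine[where m = 2 and c = 0 and a = 0 and b = 1])
    show "(\<lambda>x::real. 2 * x + 0) ` {0..1/2} = {0..1}"
      by (subst image_affinity_atLeastAtMost) auto
  qed (use g1 in \<open>auto simp: rectifiable_in_def joinpaths_def flen_def path_image_def\<close>)
  have J2: "(speed F ?g has_integral flen F g2) {1/2..1}"
  proof (rule speed_affine[where m = 2 and c = "-1" and a = 0 and b = 1])
    show "(\<lambda>x::real. 2 * x + - 1) ` {1/2..1} = {0..1}"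
      by (subst image_affinity_atLeastAtMost) auto
    \<comment> \<open>At \<open>t = 1/2\<close> the concatenation takes the value of
      \<open>g1\<close>, so the matching of end points enters.\<close>
    show "?g t = g2 (2 * t + - 1)" if "t \<in> {1/2..1}" for t
    proof (cases "t = 1/2")
      case True
      then have t2: "t = 1/2" by simp
      show ?thesis using g1(3) g2(2) unfolding t2 by (simp add: joinpaths_def pathfinish_def pathstart_def)
    qed (use that in \<open>simp add: joinpaths_def\<close>)
  qed (use g2 in \<open>auto simp: rectifiable_in_def flen_def path_image_def\<close>)
  have J: "(speed F ?g has_integral flen F g1 + flen F g2) {0..1}"
    by (rule has_integral_combine[OF _ _ J1 J2]) auto
  have r: "rectifiable_in U F ?g"
    unfolding rectifiable_in_def
  proof (intro conjI)
    show "valid_path ?g" using g1 g2 by (intro valid_path_join) (auto simp: rectifiable_in_def)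
    show "path_image ?g \<subseteq> U" using g1 g2 by (auto simp: rectifiable_in_def path_image_join)
  qed (use J in auto)
  have "d x z \<le> flen F g1 + flen F g2"
    using fdist_le[OF r, of x z] g1 g2 integral_unique[OF J] by (simp add: flen_def)
  then show "d x z \<le> d x y + d y z + e" using g1(4) g2(4) by simp
qed

text \<open>A nearly minimal path is cut where its length reaches \<open>a\<close>, by the
  intermediate value theorem; if it is no longer than \<open>a\<close>, its end point
  \<open>z\<close> serves.\<close>

lemma fdist_split:
  assumes x: "x \<in> U" and z: "z \<in> U" and a: "a \<ge> 0" and b: "b > 0" and lt: "d x z < a + b"
  obtains y where "y \<in> U" "d x y \<le> a" "d y z < b"
proof -
  obtain g where g: "rectifiable_in U F g" "pathstart g = x" "pathfinish g = z" "flen F g < a + b"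
    using near_minimal_path[OF x z lt] by blast
  have int: "speed F g integrable_on {0..1}" and vg: "valid_path g" and im: "g ` {0..1} \<subseteq> U"
    using g(1) by (auto simp: rectifiable_in_def path_image_def)
  have g01: "g 0 = x" "g 1 = z" using g by (auto simp: pathstart_def pathfinish_def)
  show ?thesis
  proof (cases "flen F g \<le> a")
    case True
    then have "d x z \<le> a" using fdist_le[OF g(1-3)] by simp
    then show ?thesis using that[of z] z b fdist_self[OF z] by simp
  next
    case False
    have "\<exists>t\<ge>0. t \<le> 1 \<and> integral {0..t} (speed F g) = a"
      by (rule IVT') (use False a indefinite_integral_continuous_1[OF int] in \<open>auto simp: flen_def\<close>)
    then obtain t where t: "0 \<le> t" "t \<le> 1" "integral {0..t} (speed F g) = a" by blast
    have i1: "speed F g integrable_on {0..t}" and i2: "speed F g integrable_on {t..1}"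
      using int t by (auto intro: integrable_on_subinterval)
    have sum: "integral {0..t} (speed F g) + integral {t..1} (speed F g) = flen F g"
      unfolding flen_def by (rule Henstock_Kurzweil_Integration.integral_combine[OF t(1,2) int])
    have "d (g 0) (g t) \<le> integral {0..t} (speed F g)"
      by (rule fdist_le_integral[OF vg _ _ _ _ i1]) (use t im in auto)
    moreover have "d (g t) (g 1) \<le> integral {t..1} (speed F g)"
      by (rule fdist_le_integral[OF vg _ _ _ _ i2]) (use t im in auto)
    moreover have "g t \<in> U" using im t by auto
    ultimately show ?thesis using that[of "g t"] g01 t sum g(4) by auto
  qed
qed

section \<open>Comparison with the Euclidean norm, and the Hopf-Rinow theorem\<close>

lemma fdist_upper_local:
  assumes "cball x r \<subseteq> U"
  obtains C where "C \<ge> 0" "\<And>y. y \<in> cball x r \<Longrightarrow> d x y \<le> C * norm (y - x)"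
proof -
  obtain C where C: "C \<ge> 0" "\<And>z v. z \<in> cball x r \<Longrightarrow> F z v \<le> C * norm v"
    using compact_bounds[OF compact_cball assms] by metis
  have "d x y \<le> C * norm (y - x)" if y: "y \<in> cball x r" for y
  proof -
    have "x \<in> cball x r" using y order_trans[OF zero_le_dist[of x y]] by simp
    then have "closed_segment x y \<subseteq> cball x r" using y by (intro closed_segment_subset) auto
    then show ?thesis using fdist_segment[of x y C] C(2) assms by blast
  qed
  then show ?thesis using that C(1) by blast
qed

text \<open>A path may leave the ball, but its part up to the first exit has displacement
  \<open>r\<close> already; hence the \<open>min\<close>.\<close>

lemma fdist_lower_local:
  assumes r: "r > 0" "cball x r \<subseteq> U"
  obtains c where "c > 0" "\<And>y. y \<in> U \<Longrightarrow> c * min r (norm (y - x)) \<le> d x y"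
proof -
  obtain c where c: "c > 0" "\<And>z v. z \<in> cball x r \<Longrightarrow> c * norm v \<le> F z v"
    using compact_bounds[OF compact_cball r(2)] by metis
  have x: "x \<in> U" using r by auto
  have "c * min r (norm (y - x)) \<le> d x y" if y: "y \<in> U" for y
  proof (rule fdist_greatest[OF x y])
    fix g assume g: "rectifiable_in U F g" "pathstart g = x" "pathfinish g = y"
    have int: "speed F g integrable_on {0..1}" and vg: "valid_path g" and im: "g ` {0..1} \<subseteq> U"
      using g(1) by (auto simp: rectifiable_in_def path_image_def)
    have g01: "g 0 = x" "g 1 = y" using g by (auto simp: pathstart_def pathfinish_def)
    have cg: "continuous_on {0..1} g" using vg valid_path_derivative by blast
    obtain s where s: "0 \<le> s" "s \<le> 1" "g ` {0..s} \<subseteq> closure (ball x r)" "s = 1 \<or> g s \<notin> ball x r"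
      using path_exit[OF cg open_ball, of x r] g01 r by auto
    have int_s: "speed F g integrable_on {0..s}" using int s by (auto intro: integrable_on_subinterval)
    have "min r (norm (y - x)) \<le> norm (g s - g 0)"
      using s(4) g01 by (auto simp: dist_norm norm_minus_commute)
    then have "c * min r (norm (y - x)) \<le> c * norm (g s - g 0)" using c(1) by (intro mult_left_mono) auto
    also have "\<dots> \<le> integral {0..s} (speed F g)"
      by (rule displacement_le_length[OF vg _ _ _ _ _ int_s]) (use s c r in \<open>auto simp: image_subset_iff\<close>)
    also have "\<dots> \<le> flen F g"
      unfolding flen_def by (rule integral_subset_le[OF _ int_s int]) (use s im F_nonneg in auto)
    finally show "c * min r (norm (y - x)) \<le> flen F g" .
  qed
  then show ?thesis using that c(1) by blast
qed

lemma continuous_on_fdist: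
  assumes x: "x \<in> U"
  shows "continuous_on U (d x)"
  unfolding continuous_on_iff
proof (intro ballI allI impI)
  fix w and e :: real assume w: "w \<in> U" and e: "e > 0"
  obtain r where r: "r > 0" "cball w r \<subseteq> U" using open_U w open_contains_cball by blast
  obtain C where C: "C \<ge> 0" "\<And>y. y \<in> cball w r \<Longrightarrow> d w y \<le> C * norm (y - w)"
    using fdist_upper_local[OF r(2)] by blast
  show "\<exists>\<delta>>0. \<forall>w'\<in>U. dist w' w < \<delta> \<longrightarrow> dist (d x w') (d x w) < e"
  proof (intro exI[of _ "min r (e / (C + 1))"] conjI ballI impI)
    show "0 < min r (e / (C + 1))" using r e C by simp
    fix w' assume w': "w' \<in> U" and dist: "dist w' w < min r (e / (C + 1))"
    have "d w w' \<le> C * norm (w' - w)" using C(2)[of w'] dist by (simp add: dist_commute)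
    also have "\<dots> \<le> (C + 1) * norm (w' - w)" by (intro mult_right_mono) auto
    also have "\<dots> < e" using dist C by (simp add: dist_norm pos_less_divide_eq mult.commute)
    finally have "d w w' < e" .
    then show "dist (d x w') (d x w) < e"
      using fdist_triangle[OF x w w'] fdist_triangle[OF x w' w] fdist_commute[OF w w'] by (simp add: dist_real_def)
  qed
qed

text \<open>Asking for a compact superset inside \<open>U\<close>, instead of compactness, lets the
  property pass directly to smaller balls and to finite unions.\<close>

definition bounded_ball :: "'a \<Rightarrow> real \<Rightarrow> bool" where
  "bounded_ball x b \<longleftrightarrow> (\<exists>K. compact K \<and> K \<subseteq> U \<and> {w \<in> U. d x w \<le> b} \<subseteq> K)"

lemma bounded_ball_small:
  assumes "x \<in> U"
  obtains r where "r > 0" "bounded_ball x r"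
proof -
  obtain r where r: "r > 0" "cball x r \<subseteq> U" using open_U assms open_contains_cball by blast
  obtain c where c: "c > 0" "\<And>y. y \<in> U \<Longrightarrow> c * min r (norm (y - x)) \<le> d x y"
    using fdist_lower_local[OF r] by blast
  have "{w \<in> U. d x w \<le> c * r / 2} \<subseteq> cball x r"
  proof
    fix w assume "w \<in> {w \<in> U. d x w \<le> c * r / 2}"
    then have "c * min r (norm (w - x)) \<le> c * (r / 2)" using c(2)[of w] by auto
    then have "min r (norm (w - x)) \<le> r / 2" using c(1) by simp
    then show "w \<in> cball x r" using r(1) by (auto simp: dist_norm norm_minus_commute min_def split: if_splits)
  qed
  then have "bounded_ball x (c * r / 2)" unfolding bounded_ball_def using r(2) compact_cball by blast
  moreover have "c * r / 2 > 0" using c r by simp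
  ultimately show ?thesis using that by blast
qed

lemma bounded_ball_mono:
  assumes "bounded_ball y b" "x \<in> U" "y \<in> U" "d y x + a \<le> b"
  shows "bounded_ball x a"
proof -
  have "{w \<in> U. d x w \<le> a} \<subseteq> {w \<in> U. d y w \<le> b}"
    using fdist_triangle[OF assms(3,2)] assms(4) by fastforce
  then show ?thesis using assms(1) unfolding bounded_ball_def by blast
qed

lemma compact_bounded_ball:
  assumes x: "x \<in> U" and "bounded_ball x a"
  shows "compact {w \<in> U. d x w \<le> a}"
proof -
  obtain K where K: "compact K" "K \<subseteq> U" "{w \<in> U. d x w \<le> a} \<subseteq> K"
    using assms(2) unfolding bounded_ball_def by blast
  have "closed {w \<in> K. d x w \<le> a}"
    by (intro continuous_on_closed_Collect_le continuous_on_subset[OF continuous_on_fdist[OF x] K(2)]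
        continuous_on_const compact_imp_closed K)
  then have "compact (K \<inter> {w \<in> K. d x w \<le> a})" using K(1) by (intro compact_Int_closed)
  moreover have "K \<inter> {w \<in> K. d x w \<le> a} = {w \<in> U. d x w \<le> a}" using K by auto
  ultimately show ?thesis by simp
qed

text \<open>Otherwise the half ball would be compact and finitely many of its points would be
  \<open>b / 24\<close>-dense in it; their \<open>2 * b / 3\<close>-balls, each in a compact set,
  would cover the whole \<open>b\<close>-ball.\<close>

lemma unbounded_ball_step:
  assumes x: "x \<in> U" and b: "b > 0" and nb: "\<not> bounded_ball x b"
  shows "\<exists>y\<in>U. d x y \<le> b/2 \<and> \<not> bounded_ball y (2 * b / 3)"
proof (rule ccontr)
  assume "\<not> ?thesis"
  then have all: "bounded_ball y (2 * b / 3)" if "y \<in> U" "d x y \<le> b/2" for y using that by blast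
  define A where "A = {w \<in> U. d x w \<le> b/2}"
  have "bounded_ball x (b/2)"
    by (rule bounded_ball_mono[OF all[OF x] x x]) (use b fdist_self[OF x] in auto)
  then have cA: "compact A" unfolding A_def by (rule compact_bounded_ball[OF x])
  have "\<exists>\<rho>>0. \<forall>w\<in>ball y \<rho>. d y w \<le> b/24" if y: "y \<in> A" for y
  proof -
    have yU: "y \<in> U" using y by (simp add: A_def)
    obtain r where r: "r > 0" "cball y r \<subseteq> U" using open_U yU open_contains_cball by blast
    obtain C where C: "C \<ge> 0" "\<And>w. w \<in> cball y r \<Longrightarrow> d y w \<le> C * norm (w - y)"
      using fdist_upper_local[OF r(2)] by blast
    show ?thesis
    proof (intro exI[of _ "min r (b / (24 * (C + 1)))"] conjI ballI)
      show "0 < min r (b / (24 * (C + 1)))" using r b C by simp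
      fix w assume w: "w \<in> ball y (min r (b / (24 * (C + 1))))"
      have "d y w \<le> C * norm (w - y)" using C(2)[of w] w by simp
      also have "\<dots> \<le> (C + 1) * norm (w - y)" by (intro mult_right_mono) auto
      also have "\<dots> \<le> (C + 1) * (b / (24 * (C + 1)))"
        using w C by (intro mult_left_mono) (auto simp: dist_norm norm_minus_commute)
      also have "\<dots> = b / 24" using C by (simp add: divide_simps)
      finally show "d y w \<le> b/24" .
    qed
  qed
  then obtain \<rho> where \<rho>: "\<And>y. y \<in> A \<Longrightarrow> \<rho> y > 0" "\<And>y w. y \<in> A \<Longrightarrow> w \<in> ball y (\<rho> y) \<Longrightarrow> d y w \<le> b/24"
    by metis
  have "A \<subseteq> (\<Union>y\<in>A. ball y (\<rho> y))" using \<rho>(1) by force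
  then obtain Y where Y: "Y \<subseteq> A" "finite Y" "A \<subseteq> (\<Union>y\<in>Y. ball y (\<rho> y))"
    using compactE_image[OF cA, of A "\<lambda>y. ball y (\<rho> y)"] by auto
  have "\<forall>y\<in>Y. \<exists>K. compact K \<and> K \<subseteq> U \<and> {w \<in> U. d y w \<le> 2 * b / 3} \<subseteq> K"
    using all Y(1) unfolding bounded_ball_def A_def by blast
  then obtain K where K: "\<And>y. y \<in> Y \<Longrightarrow> compact (K y)" "\<And>y. y \<in> Y \<Longrightarrow> K y \<subseteq> U"
    "\<And>y. y \<in> Y \<Longrightarrow> {w \<in> U. d y w \<le> 2 * b / 3} \<subseteq> K y" by metis
  have "{w \<in> U. d x w \<le> b} \<subseteq> (\<Union>y\<in>Y. K y)"
  proof
    fix w assume "w \<in> {w \<in> U. d x w \<le> b}"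
    then have w: "w \<in> U" "d x w \<le> b" by auto
    \<comment> \<open>A minimal path need not exist, hence the slack \<open>b/24\<close>. With the
      \<open>b/24\<close> from the cover the total, \<open>7 * b / 12\<close>, stays below
      \<open>2 * b / 3\<close>.\<close>
    obtain u where u: "u \<in> U" "d x u \<le> b/2" "d u w < b/2 + b/24"
      by (rule fdist_split[OF x w(1), of "b/2" "b/2 + b/24"]) (use w b in auto)
    then have "u \<in> A" by (simp add: A_def)
    then obtain y where y: "y \<in> Y" "u \<in> ball y (\<rho> y)" using Y(3) by blast
    have yU: "y \<in> U" using y(1) Y(1) by (auto simp: A_def)
    have "d y u \<le> b/24" using \<rho>(2) y Y(1) by blast
    then have "d y w \<le> 2 * b / 3" using fdist_triangle[OF yU u(1) w(1)] u(3) b by simp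
    then show "w \<in> (\<Union>y\<in>Y. K y)" using K(3)[OF y(1)] w(1) y(1) by blast
  qed
  moreover have "compact (\<Union>y\<in>Y. K y)" "(\<Union>y\<in>Y. K y) \<subseteq> U" using K Y(2) by (auto intro!: compact_UN)
  ultimately show False using nb unfolding bounded_ball_def by blast
qed

text \<open>Hopf--Rinow: an unbounded ball would contain a Cauchy sequence of centres of unbounded balls whose
  radii shrink geometrically, which is absurd at the limit.\<close>

lemma hopf_rinow:
  assumes complete: "\<And>x. (\<And>k. x k \<in> U) \<Longrightarrow> (\<And>e. e > 0 \<Longrightarrow> \<exists>N. \<forall>m\<ge>N. \<forall>k\<ge>N. d (x m) (x k) < e)
      \<Longrightarrow> \<exists>y\<in>U. (\<lambda>k. d (x k) y) \<longlonglongrightarrow> 0"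
    and x0: "x0 \<in> U"
  shows "bounded_ball x0 b0"
proof (rule ccontr)
  assume nb0: "\<not> bounded_ball x0 b0"
  define b where "b = max b0 1"
  have b: "b > 0" by (simp add: b_def)
  have nb: "\<not> bounded_ball x0 b"
    using bounded_ball_mono[of x0 b x0 b0] x0 fdist_self[OF x0] nb0 by (auto simp: b_def)
  define r where "r = (\<lambda>k. b * (2/3) ^ k :: real)"
  have r: "r k > 0" for k using b by (simp add: r_def)
  have rS: "r (Suc k) = 2 * r k / 3" for k by (simp add: r_def)
  have "\<exists>x. \<forall>k. (x k \<in> U \<and> \<not> bounded_ball (x k) (r k)) \<and> d (x k) (x (Suc k)) \<le> r k / 2"
  proof (rule dependent_nat_choice)
    show "\<exists>x. x \<in> U \<and> \<not> bounded_ball x (r 0)" using x0 nb by (auto simp: r_def)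
    fix x k assume "x \<in> U \<and> \<not> bounded_ball x (r k)"
    then show "\<exists>y. (y \<in> U \<and> \<not> bounded_ball y (r (Suc k))) \<and> d x y \<le> r k / 2"
      using unbounded_ball_step[of x "r k"] r unfolding rS by blast
  qed
  then obtain x where x: "\<And>k. x k \<in> U" "\<And>k. \<not> bounded_ball (x k) (r k)" "\<And>k. d (x k) (x (Suc k)) \<le> r k / 2"
    by blast
  \<comment> \<open>A telescoping sum: \<open>r k / 2\<close> equals
    \<open>3/2 * (r k - r (Suc k))\<close> because each step removes a third of the radius.\<close>
  have tail: "d (x m) (x (m + p)) \<le> 3/2 * (r m - r (m + p))" for m p
  proof (induction p)
    case 0
    then show ?case using fdist_self x(1) by simp
  next
    case (Suc p)
    have "d (x m) (x (m + Suc p)) \<le> d (x m) (x (m + p)) + d (x (m + p)) (x (m + Suc p))"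
      by (intro fdist_triangle x)
    also have "\<dots> \<le> 3/2 * (r m - r (m + p)) + r (m + p) / 2"
      using Suc x(3)[of "m + p"] unfolding add_Suc_right by linarith
    also have "\<dots> = 3/2 * (r m - r (m + Suc p))" using rS[of "m + p"] by (simp add: field_simps)
    finally show ?case .
  qed
  have r0: "r \<longlonglongrightarrow> 0"
    unfolding r_def using tendsto_mult[OF tendsto_const[of b] LIMSEQ_power_zero[of "2/3::real"]] by simp
  have "\<exists>y\<in>U. (\<lambda>k. d (x k) y) \<longlonglongrightarrow> 0"
  proof (rule complete[OF x(1)])
    fix e :: real assume e: "e > 0"
    then have "\<forall>\<^sub>F k in sequentially. r k < e/2" by (intro order_tendstoD(2)[OF r0]) simp
    then obtain N where N: "\<And>k. k \<ge> N \<Longrightarrow> r k < e/2" unfolding eventually_sequentially by blast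
    have le: "d (x m) (x k) < e" if "N \<le> m" "m \<le> k" for m k
      using tail[of m "k - m"] N[OF that(1)] r[of k] that(2) e by simp
    show "\<exists>N. \<forall>m\<ge>N. \<forall>k\<ge>N. d (x m) (x k) < e"
    proof (intro exI[of _ N] allI impI)
      fix m k assume "N \<le> m" "N \<le> k"
      then show "d (x m) (x k) < e" using le[of m k] le[of k m] fdist_commute[OF x(1) x(1), of m k] by (cases "m \<le> k") auto
    qed
  qed
  then obtain y where y: "y \<in> U" "(\<lambda>k. d (x k) y) \<longlonglongrightarrow> 0" by blast
  obtain s where s: "s > 0" "bounded_ball y s" using bounded_ball_small[OF y(1)] by blast
  have "\<forall>\<^sub>F k in sequentially. d (x k) y < s/2 \<and> r k < s/2"
    using s by (intro eventually_conj order_tendstoD(2)[OF y(2)] order_tendstoD(2)[OF r0]) auto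
  then obtain k where k: "d (x k) y < s/2" "r k < s/2"
    using eventually_happens trivial_limit_sequentially by blast
  have "bounded_ball (x k) (r k)"
    by (rule bounded_ball_mono[OF s(2) x(1) y(1)]) (use k fdist_commute[OF x(1) y(1)] in simp)
  then show False using x(2) by blast
qed

end

text \<open>A path in \<open>V j\<close> may run outside \<open>U\<close>, where \<open>F\<close>
  means nothing. Up to its first exit from \<open>W\<close> it stays in the compact
  \<open>K'\<close>, where the metrics compare; by then it has reached \<open>w\<close> or a point
  farther from \<open>z0\<close> than \<open>R\<close>, hence at least as far as
  \<open>w\<close>.\<close>

lemma fdist_convergence_lower:
  fixes V :: "nat \<Rightarrow> 'a::euclidean_space set"
  assumes Fj: "\<And>j. j \<ge> J0 \<Longrightarrow> finsler (V j) (G j)" and F: "finsler U F"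
    and bb: "\<And>b. finsler.bounded_ball U F z0 b"
    and ev: "\<And>C. compact C \<Longrightarrow> C \<subseteq> U \<Longrightarrow> \<exists>J. \<forall>j\<ge>J. C \<subseteq> V j"
    and comp: "\<And>C e. compact C \<Longrightarrow> C \<subseteq> U \<Longrightarrow> e > 0 \<Longrightarrow>
        \<exists>J. \<forall>j\<ge>J. \<forall>z\<in>C. \<forall>v. (1 - e) * F z v \<le> G j z v \<and> G j z v \<le> (1 + e) * F z v"
    and z0: "z0 \<in> U" and C: "compact C" "C \<subseteq> U" and e: "0 < e" "e < 1"
  shows "\<exists>J. \<forall>j\<ge>J. \<forall>w\<in>C. (1 - e) * fdist U F z0 w \<le> fdist (V j) (G j) z0 w"
proof -
  interpret F: finsler U F by (rule F)
  have "bounded (fdist U F z0 ` C)"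
    by (intro compact_imp_bounded compact_continuous_image continuous_on_subset[OF F.continuous_on_fdist[OF z0] C(2)] C(1))
  then obtain R' where R': "\<And>w. w \<in> C \<Longrightarrow> norm (fdist U F z0 w) \<le> R'" unfolding bounded_iff by blast
  \<comment> \<open>Nonnegativity puts \<open>z0\<close> into \<open>K\<close> even if
    \<open>C\<close> is empty and \<open>R'\<close> arbitrary.\<close>
  define R where "R = max R' 0"
  have R: "fdist U F z0 w \<le> R" if "w \<in> C" for w using R'[OF that] by (simp add: R_def)
  obtain K where K: "compact K" "K \<subseteq> U" "{w \<in> U. fdist U F z0 w \<le> R} \<subseteq> K"
    using bb[of R] unfolding F.bounded_ball_def by blast
  have z0K: "z0 \<in> K" using K(3) z0 F.fdist_self[OF z0] by (auto simp: R_def)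
  obtain r where r: "r > 0" "(\<Union>x\<in>K. cball x r) \<subseteq> U"
    using compact_subset_open_imp_cball_epsilon_subset[OF K(1) F.open_U K(2)] by blast
  \<comment> \<open>The exit point must lie outside \<open>K\<close> yet still in \<open>U\<close>:
    \<open>W\<close> surrounds \<open>K\<close>, and the compact \<open>K'\<close> contains its
    closure.\<close>
  define K' where "K' = (\<Union>x\<in>K. cball x r)"
  define W where "W = (\<Union>x\<in>K. ball x r)"
  have K': "compact K'" "K' \<subseteq> U" unfolding K'_def using compact_minkowski_sum_cball[OF K(1)] r by auto
  have W: "open W" "K \<subseteq> W" "W \<subseteq> K'" using r(1) by (auto simp: W_def K'_def)
  have clW: "closure W \<subseteq> K'" using W(3) K'(1) compact_imp_closed closure_minimal by blast
  obtain J1 where J1: "\<And>j. j \<ge> J1 \<Longrightarrow> insert z0 C \<subseteq> V j" using ev[of "insert z0 C"] C z0 by auto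
  obtain J2 where J2: "\<And>j z v. j \<ge> J2 \<Longrightarrow> z \<in> K' \<Longrightarrow> (1 - e) * F z v \<le> G j z v"
    using comp[OF K' e(1)] by blast
  show ?thesis
  proof (intro exI[of _ "max J0 (max J1 J2)"] allI impI ballI)
    fix j w assume "max J0 (max J1 J2) \<le> j" and w: "w \<in> C"
    then have j: "J0 \<le> j" "J1 \<le> j" "J2 \<le> j" by auto
    interpret G: finsler "V j" "G j" by (rule Fj[OF j(1)])
    have wU: "w \<in> U" using w C by auto
    have inV: "z0 \<in> V j" "w \<in> V j" using J1[OF j(2)] w by auto
    show "(1 - e) * fdist U F z0 w \<le> fdist (V j) (G j) z0 w"
    proof (rule G.fdist_greatest[OF inV])
      fix g assume g: "rectifiable_in (V j) (G j) g" "pathstart g = z0" "pathfinish g = w"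
      have int: "speed (G j) g integrable_on {0..1}" and vg: "valid_path g" and im: "g ` {0..1} \<subseteq> V j"
        using g(1) by (auto simp: rectifiable_in_def path_image_def)
      have g01: "g 0 = z0" "g 1 = w" using g by (auto simp: pathstart_def pathfinish_def)
      have cg: "continuous_on {0..1} g" using vg valid_path_derivative by blast
      obtain s where s: "0 \<le> s" "s \<le> 1" "g ` {0..s} \<subseteq> closure W" "s = 1 \<or> g s \<notin> W"
        using path_exit[OF cg W(1)] g01 z0K W(2) by blast
      have gK: "g ` {0..s} \<subseteq> K'" using s(3) clW by blast
      have int_s: "speed (G j) g integrable_on {0..s}" using int s by (auto intro: integrable_on_subinterval)
      have le: "F z v \<le> 1 / (1 - e) * G j z v" if "z \<in> K'" for z v
        using J2[OF j(3) that, of v] e by (simp add: field_simps)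
      have intF: "speed F g integrable_on {0..s}"
      proof (rule speed_integrable_comparison[OF vg _ gK _ _ int_s])
        show "continuous_on (K' \<times> UNIV) (\<lambda>(z, v). F z v)"
          by (rule continuous_on_subset[OF F.cont]) (use K' in auto)
        show "\<bar>F z v\<bar> \<le> 1 / (1 - e) * G j z v" if "z \<in> K'" for z v
          using le[OF that, of v] F.F_nonneg[of z v] that K' by auto
      qed (use s in auto)
      have gs: "g s \<in> K'" using gK s(1) by auto
      have "fdist U F z0 w \<le> fdist U F z0 (g s)"
      proof (cases "s = 1")
        case False
        then have "g s \<notin> K" using s(4) W(2) by blast
        then have "fdist U F z0 (g s) > R" using K(3) gs K' by fastforce
        then show ?thesis using R[OF w] by simp
      qed (use g01 in simp)
      also have "\<dots> \<le> integral {0..s} (speed F g)"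
        using F.fdist_le_integral[OF vg _ _ _ _ intF] s gK K' g01 by auto
      also have "\<dots> \<le> integral {0..s} (\<lambda>t. 1 / (1 - e) * speed (G j) g t)"
      proof (rule integral_le[OF intF integrable_on_mult_right[OF int_s]])
        fix t assume "t \<in> {0..s}"
        then have "g t \<in> K'" using gK by blast
        then show "speed F g t \<le> 1 / (1 - e) * speed (G j) g t" by (rule le)
      qed
      also have "\<dots> = 1 / (1 - e) * integral {0..s} (speed (G j) g)" by simp
      also have "\<dots> \<le> 1 / (1 - e) * flen (G j) g"
        unfolding flen_def using e s im G.F_nonneg
        by (intro mult_left_mono integral_subset_le int_s int) auto
      finally show "(1 - e) * fdist U F z0 w \<le> flen (G j) g" using e by (simp add: field_simps)
    qed
  qed
qed

text \<open>One nearly minimal path to \<open>w0\<close> serves all nearby \<open>w\<close>,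
  prolonged by a segment. This gives uniformity on a neighbourhood of \<open>w0\<close>.\<close>

lemma fdist_convergence_upper:
  fixes V :: "nat \<Rightarrow> 'a::euclidean_space set"
  assumes Fj: "\<And>j. j \<ge> J0 \<Longrightarrow> finsler (V j) (G j)" and F: "finsler U F"
    and ev: "\<And>C. compact C \<Longrightarrow> C \<subseteq> U \<Longrightarrow> \<exists>J. \<forall>j\<ge>J. C \<subseteq> V j"
    and comp: "\<And>C e. compact C \<Longrightarrow> C \<subseteq> U \<Longrightarrow> e > 0 \<Longrightarrow>
        \<exists>J. \<forall>j\<ge>J. \<forall>z\<in>C. \<forall>v. (1 - e) * F z v \<le> G j z v \<and> G j z v \<le> (1 + e) * F z v"
    and z0: "z0 \<in> U" and w0: "w0 \<in> U" and e: "0 < e"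
  shows "\<exists>\<delta>>0. \<exists>J. \<forall>j\<ge>J. \<forall>w\<in>ball w0 \<delta>. fdist (V j) (G j) z0 w \<le> fdist U F z0 w + e"
proof -
  interpret F: finsler U F by (rule F)
  obtain r where r: "r > 0" "cball w0 r \<subseteq> U" using F.open_U w0 open_contains_cball by blast
  obtain C where C: "C \<ge> 0" "\<And>z v. z \<in> cball w0 r \<Longrightarrow> F z v \<le> C * norm v"
    using F.compact_bounds[OF compact_cball r(2)] by metis
  obtain g where g: "rectifiable_in U F g" "pathstart g = z0" "pathfinish g = w0" "flen F g < fdist U F z0 w0 + e/8"
    using F.near_minimal_path[OF z0 w0, of "fdist U F z0 w0 + e/8"] e by auto
  have int: "speed F g integrable_on {0..1}" and vg: "valid_path g" and im: "path_image g \<subseteq> U"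
    using g(1) by (auto simp: rectifiable_in_def)
  have l0: "flen F g \<ge> 0" by (rule F.flen_nonneg[OF g(1)])
  \<comment> \<open>The budget: \<open>e/8\<close> for near-minimality, \<open>e/8\<close> for
    changing the metric along the path, \<open>e/4\<close> for the segment in the new metric (at
    most twice the old), \<open>e/8\<close> for moving the end point in the old one.\<close>
  define \<eta> where "\<eta> = min 1 (e / (8 * (flen F g + 1)))"
  have \<eta>: "\<eta> > 0" "\<eta> \<le> 1" using e l0 by (auto simp: \<eta>_def)
  have "\<eta> \<le> e / (8 * (flen F g + 1))" by (simp add: \<eta>_def)
  then have "\<eta> * (8 * (flen F g + 1)) \<le> e" using l0 by (simp add: pos_le_divide_eq)
  then have \<eta>l: "\<eta> * flen F g \<le> e/8" using \<eta> by (simp add: algebra_simps)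
  define K where "K = path_image g \<union> cball w0 r"
  have K: "compact K" "K \<subseteq> U" using im r compact_valid_path_image[OF vg] by (auto simp: K_def)
  obtain J1 where J1: "\<And>j. j \<ge> J1 \<Longrightarrow> K \<subseteq> V j" using ev[OF K] by blast
  obtain J2 where J2: "\<And>j z v. j \<ge> J2 \<Longrightarrow> z \<in> K \<Longrightarrow> G j z v \<le> (1 + \<eta>) * F z v"
    using comp[OF K \<eta>(1)] by blast
  define \<delta> where "\<delta> = min r (e / (8 * (C + 1)))"
  have \<delta>: "\<delta> > 0" using r e C by (simp add: \<delta>_def)
  show ?thesis
  proof (intro exI[of _ \<delta>] conjI \<delta> exI[of _ "max J0 (max J1 J2)"] allI impI ballI)
    fix j w assume "max J0 (max J1 J2) \<le> j" and w: "w \<in> ball w0 \<delta>"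
    then have j: "J0 \<le> j" "J1 \<le> j" "J2 \<le> j" by auto
    interpret G: finsler "V j" "G j" by (rule Fj[OF j(1)])
    have wr: "w \<in> cball w0 r" using w by (simp add: \<delta>_def)
    have wU: "w \<in> U" using wr r by blast
    have inV: "z0 \<in> V j" "w \<in> V j" "w0 \<in> V j"
      using J1[OF j(2)] wr g(2) pathstart_in_path_image[of g] r(1) by (auto simp: K_def)
    have seg: "closed_segment w0 w \<subseteq> cball w0 r" using wr r(1) by (intro closed_segment_subset) auto
    have "norm (w - w0) \<le> e / (8 * (C + 1))" using w by (simp add: \<delta>_def dist_norm norm_minus_commute)
    then have "norm (w - w0) * (8 * (C + 1)) \<le> e" using C(1) by (simp add: pos_le_divide_eq)
    then have Cw: "C * norm (w - w0) \<le> e/8" using norm_ge_zero[of "w - w0"] by (simp add: algebra_simps del: norm_ge_zero)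
    have d1: "fdist U F w0 w \<le> e/8"
      using F.fdist_segment[of w0 w C] seg r(2) C(2) Cw by (meson order_trans subsetD)
    have G2: "G j z v \<le> (2 * C) * norm v" if "z \<in> closed_segment w0 w" for z v
    proof -
      have z: "z \<in> cball w0 r" using that seg by blast
      have "G j z v \<le> (1 + \<eta>) * F z v" using J2[OF j(3)] z by (simp add: K_def)
      also have "\<dots> \<le> 2 * (C * norm v)"
        using \<eta> C(2)[OF z] F.F_nonneg[of z v] z r(2) by (intro mult_mono) auto
      finally show ?thesis by simp
    qed
    have "closed_segment w0 w \<subseteq> V j" using seg J1[OF j(2)] unfolding K_def by blast
    from G.fdist_segment[OF this G2] have d2: "fdist (V j) (G j) w0 w \<le> e/4"
      using Cw by simp
    have intG: "speed (G j) g integrable_on {0..1}"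
    proof (rule speed_integrable_comparison[OF vg _ _ _ _ int])
      show "g ` {0..1} \<subseteq> path_image g" by (simp add: path_image_def)
      show "continuous_on (path_image g \<times> UNIV) (\<lambda>(z, v). G j z v)"
        by (rule continuous_on_subset[OF G.cont]) (use J1[OF j(2)] in \<open>auto simp: K_def\<close>)
      show "\<bar>G j z v\<bar> \<le> (1 + \<eta>) * F z v" if "z \<in> path_image g" for z v
        using J2[OF j(3), of z v] G.F_nonneg[of z v] J1[OF j(2)] that by (auto simp: K_def)
    qed auto
    have rG: "rectifiable_in (V j) (G j) g"
      using vg intG J1[OF j(2)] by (auto simp: rectifiable_in_def K_def)
    have "flen (G j) g \<le> integral {0..1} (\<lambda>t. (1 + \<eta>) * speed F g t)"
      unfolding flen_def
      by (rule integral_le[OF intG integrable_on_mult_right[OF int]])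
        (use J2[OF j(3)] in \<open>auto simp: K_def path_image_def\<close>)
    also have "\<dots> = flen F g + \<eta> * flen F g"
      by (subst Henstock_Kurzweil_Integration.integral_mult_right) (simp add: flen_def distrib_right)
    finally have "flen (G j) g \<le> fdist U F z0 w0 + e/4" using \<eta>l g(4) by simp
    then have d3: "fdist (V j) (G j) z0 w0 \<le> fdist U F z0 w0 + e/4"
      using G.fdist_le[OF rG g(2,3)] by simp
    show "fdist (V j) (G j) z0 w \<le> fdist U F z0 w + e"
      using d1 d2 d3 G.fdist_triangle[OF inV(1,3,2)] F.fdist_triangle[OF z0 wU w0] F.fdist_commute[OF w0 wU] e by simp
  qed
qed

theorem fdist_uniform_limit:
  fixes V :: "nat \<Rightarrow> 'a::euclidean_space set"
  assumes Fj: "\<And>j. j \<ge> J0 \<Longrightarrow> finsler (V j) (G j)" and F: "finsler U F"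
    and bb: "\<And>b. finsler.bounded_ball U F z0 b"
    and ev: "\<And>C. compact C \<Longrightarrow> C \<subseteq> U \<Longrightarrow> \<exists>J. \<forall>j\<ge>J. C \<subseteq> V j"
    and comp: "\<And>C e. compact C \<Longrightarrow> C \<subseteq> U \<Longrightarrow> e > 0 \<Longrightarrow>
        \<exists>J. \<forall>j\<ge>J. \<forall>z\<in>C. \<forall>v. (1 - e) * F z v \<le> G j z v \<and> G j z v \<le> (1 + e) * F z v"
    and z0: "z0 \<in> U" and C: "compact C" "C \<subseteq> U"
  shows "uniform_limit C (\<lambda>j w. fdist (V j) (G j) z0 w) (fdist U F z0) sequentially"
proof (rule uniform_limitI)
  fix e :: real assume e: "e > 0"
  interpret F: finsler U F by (rule F)
  have "bounded (fdist U F z0 ` C)"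
    by (intro compact_imp_bounded compact_continuous_image continuous_on_subset[OF F.continuous_on_fdist[OF z0] C(2)] C(1))
  then obtain R where R: "\<And>w. w \<in> C \<Longrightarrow> norm (fdist U F z0 w) \<le> R" unfolding bounded_iff by blast
  \<comment> \<open>Turns the multiplicative lower bound into an additive one, as the limit distance
    is bounded by \<open>R\<close> on \<open>C\<close>.\<close>
  define \<eta> where "\<eta> = min (1/2) (e / (2 * (\<bar>R\<bar> + 1)))"
  have \<eta>: "0 < \<eta>" "\<eta> < 1" using e by (auto simp: \<eta>_def)
  have "\<eta> \<le> e / (2 * (\<bar>R\<bar> + 1))" by (simp add: \<eta>_def)
  then have "\<eta> * (2 * (\<bar>R\<bar> + 1)) \<le> e" by (simp add: pos_le_divide_eq)
  then have \<eta>R: "\<eta> * \<bar>R\<bar> < e" using \<eta> e by (simp add: algebra_simps)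
  obtain J1 where J1: "\<And>j w. j \<ge> J1 \<Longrightarrow> w \<in> C \<Longrightarrow> (1 - \<eta>) * fdist U F z0 w \<le> fdist (V j) (G j) z0 w"
    using fdist_convergence_lower[OF Fj F bb ev comp z0 C \<eta>] by blast
  have "\<exists>N. \<forall>j\<ge>N. \<forall>w\<in>C. fdist (V j) (G j) z0 w \<le> fdist U F z0 w + e/2"
  proof (rule compact_eventually_uniform[OF C(1)])
    fix w0 assume "w0 \<in> C"
    then have "w0 \<in> U" using C by blast
    then show "\<exists>\<delta>>0. \<exists>J. \<forall>j\<ge>J. \<forall>w\<in>ball w0 \<delta>. fdist (V j) (G j) z0 w \<le> fdist U F z0 w + e/2"
      using fdist_convergence_upper[OF Fj F ev comp z0, where ?w0.0 = w0 and e = "e/2"] e by simp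
  qed
  then obtain J2 where J2: "\<And>j w. j \<ge> J2 \<Longrightarrow> w \<in> C \<Longrightarrow> fdist (V j) (G j) z0 w \<le> fdist U F z0 w + e/2" by blast
  show "\<forall>\<^sub>F j in sequentially. \<forall>w\<in>C. dist (fdist (V j) (G j) z0 w) (fdist U F z0 w) < e"
    unfolding eventually_sequentially
  proof (intro exI[of _ "max J1 J2"] allI impI ballI)
    fix j w assume j: "max J1 J2 \<le> j" and w: "w \<in> C"
    have "\<eta> * fdist U F z0 w \<le> \<eta> * \<bar>R\<bar>"
      using R[OF w] \<eta> by (intro mult_left_mono) auto
    then have "fdist U F z0 w - e < fdist (V j) (G j) z0 w"
      using J1[of j w] j w \<eta>R by (simp add: algebra_simps)
    then show "dist (fdist (V j) (G j) z0 w) (fdist U F z0 w) < e"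
      using J2[of j w] j w e by (simp add: dist_real_def)
  qed
qed

section \<open>Convergence of the Bergman distances\<close>

lemma bergman_dist_eq_fdist: "bergman_dist \<Omega> = fdist \<Omega> (bergman_metric \<Omega>)"
  unfolding fun_eq_iff bergman_dist_def fdist_def rectifiable_in_def flen_def bergman_length_def
  by (simp add: conj_ac)

lemma bergman_form_scaleR: "bergman_form \<Omega> z (t *\<^sub>R v) = of_real (t\<^sup>2) * bergman_form \<Omega> z v"
  unfolding bergman_form_def sum_distrib_left
  by (intro sum.cong refl) (simp add: scaleR_conv_of_real[where 'a = complex] power2_eq_square mult_ac)

lemma finsler_bergman:
  assumes dom: "cdomain \<Omega>" and pos: "\<forall>z\<in>\<Omega>. bergman_diag \<Omega> z > 0" and pd: "bergman_pos_def \<Omega>"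
  shows "finsler \<Omega> (bergman_metric \<Omega>)"
proof
  show "open \<Omega>" "connected \<Omega>" using dom by (auto simp: cdomain_def)
  then have g: "continuous_on \<Omega> (bergman_g \<Omega> \<mu> \<nu>)" for \<mu> \<nu>
    using continuous_on_bergman_g pos by blast
  show "continuous_on (\<Omega> \<times> UNIV) (\<lambda>(z, v). bergman_metric \<Omega> z v)"
    unfolding bergman_metric_def bergman_form_def case_prod_unfold
    by (intro continuous_intros continuous_on_compose2[OF g]) auto
  show "bergman_metric \<Omega> z (t *\<^sub>R v) = \<bar>t\<bar> * bergman_metric \<Omega> z v" for z t v
    unfolding bergman_metric_def bergman_form_scaleR by (simp add: real_sqrt_mult)
  show "bergman_metric \<Omega> z v > 0" if "z \<in> \<Omega>" "v \<noteq> 0" for z v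
    using pd that unfolding bergman_pos_def_def bergman_metric_def by simp
qed

text \<open>Convergence of coefficients is additive; the lower bound \<open>c\<close> of the limit
  metric on \<open>C\<close> makes it multiplicative, uniformly in the vector.\<close>

lemma bergman_metric_comparable:
  fixes \<Omega> :: "nat \<Rightarrow> (complex ^ 'n::finite) set" and OmInf :: "(complex ^ 'n) set"
  assumes dom: "\<And>j. j \<ge> 1 \<Longrightarrow> open (\<Omega> j)" and dom_inf: "cdomain OmInf"
    and conv: "\<And>C. compact C \<Longrightarrow> C \<subseteq> OmInf \<Longrightarrow> \<exists>J. \<forall>j\<ge>J. C \<subseteq> \<Omega> j"
    and pos: "\<forall>z\<in>OmInf. bergman_diag OmInf z > 0" and pd: "bergman_pos_def OmInf"
    and posj: "\<And>j z. j \<ge> 1 \<Longrightarrow> z \<in> \<Omega> j \<Longrightarrow> bergman_diag (\<Omega> j) z > 0"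
    and lim: "\<And>z. z \<in> OmInf \<Longrightarrow> (\<lambda>j. bergman_diag (\<Omega> j) z) \<longlonglongrightarrow> bergman_diag OmInf z"
    and C: "compact C" "C \<subseteq> OmInf" and e: "e > 0"
  shows "\<exists>J. \<forall>j\<ge>J. \<forall>z\<in>C. \<forall>v. (1 - e) * bergman_metric OmInf z v \<le> bergman_metric (\<Omega> j) z v
    \<and> bergman_metric (\<Omega> j) z v \<le> (1 + e) * bergman_metric OmInf z v"
proof -
  interpret F: finsler OmInf "bergman_metric OmInf" by (rule finsler_bergman[OF dom_inf pos pd])
  obtain c where c: "c > 0" "\<And>z v. z \<in> C \<Longrightarrow> c * norm v \<le> bergman_metric OmInf z v"
    using F.compact_bounds[OF C] by metis
  define n where "n = real CARD('n)"
  have n: "n > 0" by (simp add: n_def)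
  \<comment> \<open>The cap keeps \<open>e'\<close> below 1, so
    \<open>(1 - e')^2 \<le> 1 - e'\<close> when roots are taken.\<close>
  define e' where "e' = min e (1/2)"
  have e': "0 < e'" "e' \<le> e" "e' < 1" using e by (auto simp: e'_def)
  \<comment> \<open>The \<open>n^2\<close> coefficients contribute at most
    \<open>\<delta> * |v|^2\<close> each, in total \<open>e' * (c * |v|)^2\<close>, which is at most
    \<open>e'\<close> times the limit form.\<close>
  define \<delta> where "\<delta> = e' * c\<^sup>2 / n\<^sup>2"
  have \<delta>: "\<delta> > 0" using e' c n by (simp add: \<delta>_def)
  have g: "\<forall>\<^sub>F j in sequentially. \<forall>z\<in>C. dist (bergman_g (\<Omega> j) \<mu> \<nu> z) (bergman_g OmInf \<mu> \<nu> z) < \<delta>" for \<mu> \<nu>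
    unfolding eventually_sequentially
  proof (rule compact_eventually_uniform[OF C(1)])
    fix z0 assume "z0 \<in> C"
    then have "z0 \<in> OmInf" using C by blast
    then obtain r where r: "r > 0" "cball z0 r \<subseteq> OmInf" using F.open_U open_contains_cball by blast
    obtain J where J: "\<And>j. j \<ge> J \<Longrightarrow> cball z0 r \<subseteq> \<Omega> j" using conv[OF compact_cball r(2)] by blast
    show "\<exists>d>0. \<exists>N. \<forall>j\<ge>N. \<forall>z\<in>ball z0 d. dist (bergman_g (\<Omega> j) \<mu> \<nu> z) (bergman_g OmInf \<mu> \<nu> z) < \<delta>"
      by (rule bergman_g_local_uniform[where J = "max 1 J" and r = "r/2"])
        (use F.open_U pos dom posj r J lim \<delta> in auto)
  qed
  have "\<forall>\<^sub>F j in sequentially. \<forall>\<mu> \<nu>. \<forall>z\<in>C. dist (bergman_g (\<Omega> j) \<mu> \<nu> z) (bergman_g OmInf \<mu> \<nu> z) < \<delta>"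
    by (intro eventually_all_finite g)
  then obtain J where J: "\<And>j \<mu> \<nu> z. j \<ge> J \<Longrightarrow> z \<in> C \<Longrightarrow> dist (bergman_g (\<Omega> j) \<mu> \<nu> z) (bergman_g OmInf \<mu> \<nu> z) < \<delta>"
    unfolding eventually_sequentially by blast
  show ?thesis
  proof (intro exI[of _ J] allI impI ballI)
    fix j z v assume j: "J \<le> j" and z: "z \<in> C"
    define f where "f = bergman_metric OmInf z v"
    have f0: "f \<ge> 0" unfolding f_def using F.F_nonneg z C by blast
    have f2: "f\<^sup>2 = Re (bergman_form OmInf z v)"
    proof -
      have "Re (bergman_form OmInf z v) \<ge> 0" using f0 by (simp add: f_def bergman_metric_def)
      then show ?thesis by (simp add: f_def bergman_metric_def)
    qed
    have "cmod (bergman_form (\<Omega> j) z v - bergman_form OmInf z v)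
      = cmod (\<Sum>\<mu>\<in>UNIV. \<Sum>\<nu>\<in>UNIV. (bergman_g (\<Omega> j) \<mu> \<nu> z - bergman_g OmInf \<mu> \<nu> z) * v $ \<mu> * cnj (v $ \<nu>))"
      unfolding bergman_form_def by (simp add: sum_subtractf algebra_simps)
    also have "\<dots> \<le> (\<Sum>\<mu>\<in>(UNIV::'n set). \<Sum>\<nu>\<in>(UNIV::'n set). \<delta> * norm v * norm v)"
    proof (intro sum_norm_le)
      fix \<mu> \<nu> :: 'n
      show "cmod ((bergman_g (\<Omega> j) \<mu> \<nu> z - bergman_g OmInf \<mu> \<nu> z) * v $ \<mu> * cnj (v $ \<nu>)) \<le> \<delta> * norm v * norm v"
        unfolding norm_mult complex_mod_cnj
        using J[OF j z, of \<mu> \<nu>] \<delta> Finite_Cartesian_Product.norm_nth_le[of v]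
        by (intro mult_mono) (auto simp: dist_norm)
    qed
    also have "\<dots> = n\<^sup>2 * \<delta> * (norm v)\<^sup>2" by (simp add: n_def power2_eq_square)
    also have "\<dots> = e' * (c * norm v)\<^sup>2" using n by (simp add: \<delta>_def power_mult_distrib)
    also have "\<dots> \<le> e' * f\<^sup>2"
      using c(2)[OF z, of v] c(1) e' unfolding f_def by (intro mult_left_mono power_mono) auto
    finally have "\<bar>Re (bergman_form (\<Omega> j) z v - bergman_form OmInf z v)\<bar> \<le> e' * f\<^sup>2"
      using abs_Re_le_cmod order_trans by blast
    then have diff: "\<bar>Re (bergman_form (\<Omega> j) z v) - f\<^sup>2\<bar> \<le> e' * f\<^sup>2" by (simp add: f2)
    have ee: "e' * e' \<le> e' * 1" using e' by (intro mult_left_mono) auto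
    have "((1 - e') * f)\<^sup>2 = (1 - 2 * e' + e' * e') * f\<^sup>2" by (simp add: power2_eq_square algebra_simps)
    also have "\<dots> \<le> (1 - e') * f\<^sup>2" using ee by (intro mult_right_mono) auto
    also have "\<dots> \<le> Re (bergman_form (\<Omega> j) z v)" using diff by (simp add: algebra_simps abs_le_iff)
    finally have "(1 - e') * f \<le> bergman_metric (\<Omega> j) z v"
      unfolding bergman_metric_def by (rule real_le_rsqrt)
    moreover have "(1 - e) * f \<le> (1 - e') * f" using e' f0 by (intro mult_right_mono) auto
    moreover have "bergman_metric (\<Omega> j) z v \<le> (1 + e') * f"
      unfolding bergman_metric_def
    proof (rule real_le_lsqrt)
      have "Re (bergman_form (\<Omega> j) z v) \<le> (1 + e') * f\<^sup>2" using diff by (simp add: algebra_simps abs_le_iff)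
      also have "\<dots> \<le> (1 + 2 * e' + e' * e') * f\<^sup>2" using e' by (intro mult_right_mono) auto
      also have "\<dots> = ((1 + e') * f)\<^sup>2" by (simp add: power2_eq_square algebra_simps)
      finally show "Re (bergman_form (\<Omega> j) z v) \<le> ((1 + e') * f)\<^sup>2" .
    qed (use e' f0 in auto)
    moreover have "(1 + e') * f \<le> (1 + e) * f" using e' f0 by (intro mult_right_mono) auto
    ultimately show "(1 - e) * bergman_metric OmInf z v \<le> bergman_metric (\<Omega> j) z v
        \<and> bergman_metric (\<Omega> j) z v \<le> (1 + e) * bergman_metric OmInf z v"
      unfolding f_def by linarith
  qed
qed

theorem theorem4p1:
  fixes \<Omega> :: "nat \<Rightarrow> (complex ^ 'n::finite) set" and OmInf :: "(complex ^ 'n) set"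
  assumes dom: "\<And>j. j \<ge> 1 \<Longrightarrow> cdomain (\<Omega> j)" and dom_inf: "cdomain OmInf"
    and conv: "local_hausdorff_conv \<Omega> OmInf"
    and a: "\<forall>z\<in>OmInf. bergman_diag OmInf z > 0" "bergman_pos_def OmInf"
    and b: "\<And>j. j \<ge> 1 \<Longrightarrow> bergman_complete (\<Omega> j)" "bergman_complete OmInf"
    and c: "\<And>z. z \<in> OmInf \<Longrightarrow> (\<lambda>j. bergman_diag (\<Omega> j) z) \<longlonglongrightarrow> bergman_diag OmInf z"
  shows "\<forall>z0\<in>OmInf. \<forall>C. compact C \<and> C \<subseteq> OmInf \<longrightarrow>
           uniform_limit C (\<lambda>j w. bergman_dist (\<Omega> j) z0 w) (\<lambda>w. bergman_dist OmInf z0 w) sequentially"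
proof (intro ballI allI impI)
  fix z0 C assume z0: "z0 \<in> OmInf" and C: "compact C \<and> C \<subseteq> OmInf"
  have Fj: "finsler (\<Omega> j) (bergman_metric (\<Omega> j))" if "j \<ge> 1" for j
    using finsler_bergman[OF dom[OF that]] b(1)[OF that] by (simp add: bergman_complete_def)
  have F: "finsler OmInf (bergman_metric OmInf)" by (rule finsler_bergman[OF dom_inf a])
  have ev: "\<exists>J. \<forall>j\<ge>J. K \<subseteq> \<Omega> j" if "compact K" "K \<subseteq> OmInf" for K
    using conv that unfolding local_hausdorff_conv_def by blast
  \<comment> \<open>Bergman completeness of \<open>OmInf\<close> is the Cauchy criterion in the
    Hopf-Rinow lemma, so balls of every radius are relatively compact.\<close>
  have bb: "finsler.bounded_ball OmInf (bergman_metric OmInf) z0 r" for r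
  proof (rule finsler.hopf_rinow[OF F _ z0])
    fix x :: "nat \<Rightarrow> complex^'n"
    assume "\<And>k. x k \<in> OmInf"
      and "\<And>e. e > 0 \<Longrightarrow> \<exists>N. \<forall>m\<ge>N. \<forall>k\<ge>N. fdist OmInf (bergman_metric OmInf) (x m) (x k) < e"
    then show "\<exists>y\<in>OmInf. (\<lambda>k. fdist OmInf (bergman_metric OmInf) (x k) y) \<longlonglongrightarrow> 0"
      using b(2) unfolding bergman_complete_def bergman_dist_eq_fdist by blast
  qed
  have opens: "\<And>j. j \<ge> 1 \<Longrightarrow> open (\<Omega> j)" and posj: "\<And>j z. j \<ge> 1 \<Longrightarrow> z \<in> \<Omega> j \<Longrightarrow> bergman_diag (\<Omega> j) z > 0"
    using dom b(1) by (auto simp: cdomain_def bergman_complete_def)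
  show "uniform_limit C (\<lambda>j w. bergman_dist (\<Omega> j) z0 w) (\<lambda>w. bergman_dist OmInf z0 w) sequentially"
    unfolding bergman_dist_eq_fdist
    by (rule fdist_uniform_limit[OF Fj F bb ev bergman_metric_comparable[OF opens dom_inf ev a posj c] z0])
      (use C in auto)
qed

end
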